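(* Let $G$ be a finite group, let $H\leq G$ be a subgroup, and let $F$ be a field whose characteristic does not divide $|G|$. Suppose that $H$ admits a faithful irreducible representation over $F$. Then there exists an irreducible $1$-projective representation $\overline{\sigma}$ of $G$ over $F$ such that $\ker(\overline{\sigma})\cap H\leq \mathrm{Z}(G)$. In particular, if $\mathrm{Z}(G)\cap H=\{1\}$, then $\overline{\sigma}$ is an irreducible $1$-projective representation of $G$ which is faithful on $H$.
   Context: Representations are finite-dimensional linear representations over $F$, and $\mathrm{Z}(G)$ denotes the center of $G$. A projective $F$-representation of $G$ is a homomorphism $\overline{\sigma}\colon G\to \mathrm{PGL}(V)$ with $V$ a finite-dimensional $F$-vector space; it is irreducible if $V\neq 0$ and $V$ has no proper nonzero subspace invariant under $G$. Its class in $H^2(G,F^\times)$ (trivial action) is the class of the pullback along $\overline{\sigma}$ of the central extension $1\to F^\times\to \mathrm{GL}(V)\to \mathrm{PGL}(V)\to 1$. A $1$-projective representation is a projective representation whose class is trivial, i.e. one that lifts to a linear representation $G\to \mathrm{GL}(V)$. It is faithful on $H$ if its restriction to $H$ is injective. *)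

theory Defs
  imports "HOL-Algebra.Coset" "Jordan_Normal_Form.VS_Connect"
begin

definition group_center :: "('g, 'b) monoid_scheme \<Rightarrow> 'g set" where
  "group_center G = {z \<in> carrier G. \<forall>g \<in> carrier G. z \<otimes>\<^bsub>G\<^esub> g = g \<otimes>\<^bsub>G\<^esub> z}"

text \<open>
  A finite-dimensional vector space over the field \<open>'f\<close> is taken in coordinates, as the space
  \<open>carrier_vec n\<close> of column vectors, where the dimension \<open>n\<close> is an arbitrary natural number
  (zero included).
\<close>

definition GL :: "'f::field itself \<Rightarrow> nat \<Rightarrow> 'f mat monoid" where
  "GL ty n = units_of (ring_mat ty n ())"

definition scalar_mats :: "'f::field itself \<Rightarrow> nat \<Rightarrow> 'f mat set" where
  "scalar_mats ty n = {c \<cdot>\<^sub>m 1\<^sub>m n | c. c \<noteq> 0}"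

definition PGL :: "'f::field itself \<Rightarrow> nat \<Rightarrow> 'f mat set monoid" where
  "PGL ty n = GL ty n Mod scalar_mats ty n"

definition irreducible_mats :: "nat \<Rightarrow> 'f::field mat set \<Rightarrow> bool" where
  "irreducible_mats n S \<longleftrightarrow> n \<noteq> 0 \<and>
     (\<forall>W. subspace class_ring W (module_vec TYPE('f) n) \<and> (\<forall>A \<in> S. \<forall>w \<in> W. A *\<^sub>v w \<in> W)
        \<longrightarrow> W = {0\<^sub>v n} \<or> W = carrier_vec n)"

definition linear_rep :: "('g, 'b) monoid_scheme \<Rightarrow> nat \<Rightarrow> ('g \<Rightarrow> 'f::field mat) \<Rightarrow> bool" where
  "linear_rep G n \<rho> \<longleftrightarrow> \<rho> \<in> hom G (GL TYPE('f) n)"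

definition irreducible_rep :: "('g, 'b) monoid_scheme \<Rightarrow> nat \<Rightarrow> ('g \<Rightarrow> 'f::field mat) \<Rightarrow> bool" where
  "irreducible_rep G n \<rho> \<longleftrightarrow> linear_rep G n \<rho> \<and> irreducible_mats n (\<rho> ` carrier G)"

definition faithful_rep :: "('g, 'b) monoid_scheme \<Rightarrow> nat \<Rightarrow> ('g \<Rightarrow> 'f::field mat) \<Rightarrow> bool" where
  "faithful_rep G n \<rho> \<longleftrightarrow> linear_rep G n \<rho> \<and> inj_on \<rho> (carrier G)"

definition proj_rep :: "('g, 'b) monoid_scheme \<Rightarrow> nat \<Rightarrow> ('g \<Rightarrow> 'f::field mat set) \<Rightarrow> bool" where
  "proj_rep G n \<sigma> \<longleftrightarrow> \<sigma> \<in> hom G (PGL TYPE('f) n)"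

text \<open>
  Elements of \<open>PGL\<close> are cosets, that is, sets of matrices that differ by nonzero scalars; a
  subspace is invariant under such an element iff it is invariant under all of its representatives.
\<close>

definition irreducible_proj_rep ::
    "('g, 'b) monoid_scheme \<Rightarrow> nat \<Rightarrow> ('g \<Rightarrow> 'f::field mat set) \<Rightarrow> bool" where
  "irreducible_proj_rep G n \<sigma> \<longleftrightarrow>
     proj_rep G n \<sigma> \<and> irreducible_mats n (\<Union>g \<in> carrier G. \<sigma> g)"

text \<open>
  The class of \<open>\<sigma>\<close> in the second cohomology group is that of the pullback of the extension
  \<open>GL \<rightarrow> PGL\<close> along \<open>\<sigma>\<close>; it is trivial iff the pullback splits, and a splitting is the same thing
  as a linear representation lifting \<open>\<sigma>\<close>.
\<close>

definition one_proj_rep :: "('g, 'b) monoid_scheme \<Rightarrow> nat \<Rightarrow> ('g \<Rightarrow> 'f::field mat set) \<Rightarrow> bool" where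
  "one_proj_rep G n \<sigma> \<longleftrightarrow> proj_rep G n \<sigma> \<and>
     (\<exists>\<rho>. linear_rep G n \<rho> \<and>
        (\<forall>g \<in> carrier G. \<sigma> g = scalar_mats TYPE('f) n #>\<^bsub>GL TYPE('f) n\<^esub> \<rho> g))"

text \<open>The library's factor group is meaningful only for a normal subgroup.\<close>

lemma GL_group: "group (GL TYPE('f::field) n)"
proof -
  interpret ring "ring_mat TYPE('f) n ()" by (rule ring_mat)
  show ?thesis unfolding GL_def by (rule units_group)
qed

lemma scalar_mats_normal: "scalar_mats TYPE('f::field) n \<lhd> GL TYPE('f) n"
proof -
  interpret R: ring "ring_mat TYPE('f) n ()" by (rule ring_mat)
  interpret G: group "GL TYPE('f) n" by (rule GL_group)
  have mult: "x \<otimes>\<^bsub>GL TYPE('f) n\<^esub> y = x * y" for x y :: "'f mat"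
    by (simp add: GL_def units_of_def ring_mat_def)
  have one: "\<one>\<^bsub>GL TYPE('f) n\<^esub> = 1\<^sub>m n"
    by (simp add: GL_def units_of_def ring_mat_def)
  have car: "x \<in> carrier_mat n n" if "x \<in> carrier (GL TYPE('f) n)" for x
    using that by (auto simp: GL_def units_of_def Units_def ring_mat_def)
  have prod: "(c \<cdot>\<^sub>m 1\<^sub>m n) * (d \<cdot>\<^sub>m 1\<^sub>m n) = (c * d) \<cdot>\<^sub>m 1\<^sub>m n" for c d :: 'f
    by (subst mult_smult_assoc_mat[of _ n n _ n]) (auto intro!: eq_matI)
  have sub: "scalar_mats TYPE('f) n \<subseteq> carrier (GL TYPE('f) n)"
  proof
    fix x :: "'f mat" assume "x \<in> scalar_mats TYPE('f) n"
    then obtain c where c: "c \<noteq> 0" "x = c \<cdot>\<^sub>m 1\<^sub>m n" by (auto simp: scalar_mats_def)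
    have "(inverse c \<cdot>\<^sub>m 1\<^sub>m n) * x = 1\<^sub>m n" "x * (inverse c \<cdot>\<^sub>m 1\<^sub>m n) = 1\<^sub>m n"
      unfolding c(2) prod using c(1) by (auto intro!: eq_matI)
    moreover have "x \<in> carrier_mat n n" "inverse c \<cdot>\<^sub>m 1\<^sub>m n \<in> carrier_mat n n"
      using c by auto
    ultimately show "x \<in> carrier (GL TYPE('f) n)"
      unfolding GL_def units_of_def Units_def ring_mat_def by auto
  qed
  have inv: "inv\<^bsub>GL TYPE('f) n\<^esub> (c \<cdot>\<^sub>m 1\<^sub>m n) = inverse c \<cdot>\<^sub>m 1\<^sub>m n" if "c \<noteq> 0" for c :: 'f
  proof (rule G.inv_equality)
    show "(inverse c \<cdot>\<^sub>m 1\<^sub>m n) \<otimes>\<^bsub>GL TYPE('f) n\<^esub> (c \<cdot>\<^sub>m 1\<^sub>m n) = \<one>\<^bsub>GL TYPE('f) n\<^esub>"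
      unfolding mult one prod using that by (auto intro!: eq_matI)
    show "c \<cdot>\<^sub>m 1\<^sub>m n \<in> carrier (GL TYPE('f) n)" "inverse c \<cdot>\<^sub>m 1\<^sub>m n \<in> carrier (GL TYPE('f) n)"
      using that nonzero_imp_inverse_nonzero[OF that]
      by (intro subsetD[OF sub]; unfold scalar_mats_def; blast)+
  qed
  have sg: "subgroup (scalar_mats TYPE('f) n) (GL TYPE('f) n)"
  proof
    show "scalar_mats TYPE('f) n \<subseteq> carrier (GL TYPE('f) n)" by (rule sub)
    show "\<one>\<^bsub>GL TYPE('f) n\<^esub> \<in> scalar_mats TYPE('f) n"
      unfolding one scalar_mats_def by (auto intro!: exI[of _ 1] eq_matI)
  next
    fix x y :: "'f mat"
    assume x: "x \<in> scalar_mats TYPE('f) n" and y: "y \<in> scalar_mats TYPE('f) n"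
    from x y obtain c d where "c \<noteq> 0" "d \<noteq> 0" "x = c \<cdot>\<^sub>m 1\<^sub>m n" "y = d \<cdot>\<^sub>m 1\<^sub>m n"
      by (auto simp: scalar_mats_def)
    then show "x \<otimes>\<^bsub>GL TYPE('f) n\<^esub> y \<in> scalar_mats TYPE('f) n"
      unfolding mult by (auto simp: prod scalar_mats_def intro!: exI[of _ "c * d"])
  next
    fix x :: "'f mat" assume "x \<in> scalar_mats TYPE('f) n"
    then obtain c where "c \<noteq> 0" "x = c \<cdot>\<^sub>m 1\<^sub>m n" by (auto simp: scalar_mats_def)
    then show "inv\<^bsub>GL TYPE('f) n\<^esub> x \<in> scalar_mats TYPE('f) n"
      by (auto simp: inv scalar_mats_def intro!: exI[of _ "inverse c"])
  qed
  show ?thesis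
    unfolding G.normal_inv_iff
  proof (intro conjI ballI)
    show "subgroup (scalar_mats TYPE('f) n) (GL TYPE('f) n)" by (rule sg)
  next
    fix x h :: "'f mat"
    assume x: "x \<in> carrier (GL TYPE('f) n)" and h: "h \<in> scalar_mats TYPE('f) n"
    from h obtain c where c: "c \<noteq> 0" "h = c \<cdot>\<^sub>m 1\<^sub>m n" by (auto simp: scalar_mats_def)
    have "x \<otimes>\<^bsub>GL TYPE('f) n\<^esub> h = h \<otimes>\<^bsub>GL TYPE('f) n\<^esub> x"
      unfolding mult c(2) using car[OF x]
      by (simp add: mult_smult_assoc_mat[of _ n n _ n] mult_smult_distrib[of _ n n _ n])
    moreover have "h \<in> carrier (GL TYPE('f) n)" using h sub by auto
    ultimately have "x \<otimes>\<^bsub>GL TYPE('f) n\<^esub> h \<otimes>\<^bsub>GL TYPE('f) n\<^esub> inv\<^bsub>GL TYPE('f) n\<^esub> x = h"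
      using x by (simp add: G.m_assoc)
    then show "x \<otimes>\<^bsub>GL TYPE('f) n\<^esub> h \<otimes>\<^bsub>GL TYPE('f) n\<^esub> inv\<^bsub>GL TYPE('f) n\<^esub> x \<in> scalar_mats TYPE('f) n"
      using h by simp
  qed
qed

end

theory Submission
  imports Defs "HOL-Algebra.Multiplicative_Group" "Jordan_Normal_Form.DL_Rank"
begin

text \<open>Write \<open>V\<close> for the faithful irreducible representation of \<open>H\<close>. Elements of the group algebra of
  \<open>G\<close> are functions on \<open>G\<close>, and a representation \<open>\<sigma>\<close> extends linearly to them. The plan is to
  write down a nonzero element of the group algebra such that every irreducible \<open>\<sigma>\<close> on which it
  does not vanish has the required property; the characteristic hypothesis makes the group algebra
  semisimple, so such a \<open>\<sigma>\<close> exists (\<open>irreducible_not_annihilated\<close>).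

  A diagonal matrix coefficient of \<open>V\<close> gives an element \<open>b\<close> supported on \<open>H\<close> which is killed by
  the sum over any nontrivial normal subgroup of \<open>H\<close>. Hence \<open>\<sigma>(b) \<noteq> 0\<close> forces \<open>\<sigma>\<close> to be faithful
  on \<open>H\<close> (\<open>faithful_weight_kernel\<close>). If \<open>\<sigma>(h)\<close> is scalar, then all commutators of \<open>h\<close> with
  elements of \<open>G\<close> lie in the kernel of \<open>\<sigma>\<close>. So the remaining task is to prevent the kernel from
  containing a normal subgroup \<open>N\<close> of \<open>G\<close>, meeting \<open>H\<close> trivially, such that some noncentral
  element of \<open>H\<close> becomes central in \<open>G/N\<close>. If \<open>n\<close> lies in \<open>N\<close>, then a representation that does
  not vanish on \<open>(1 - n) f\<close> is nontrivial on \<open>N\<close>. One therefore looks for elements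
  \<open>n\<^sub>1, \<dots>, n\<^sub>k\<close> that meet all the dangerous \<open>N\<close>, with \<open>(1 - n\<^sub>1) \<cdots> (1 - n\<^sub>k) b \<noteq> 0\<close>. The coefficient
  of this element at the identity is \<open>b(1) = 1\<close> as soon as no nonempty ordered subproduct of the
  \<open>n\<^sub>i\<close> lies in \<open>H\<close> (\<open>twist_list_one\<close>).

  To find the \<open>n\<^sub>i\<close>, divide by a normal subgroup \<open>R\<close> that is as large as possible among those that
  meet \<open>H\<close> trivially and make no noncentral element of \<open>H\<close> central. After that, each minimal
  normal subgroup \<open>L\<close> with \<open>L \<inter> H = 1\<close> comes with a noncentral \<open>y\<^sub>L \<in> H\<close> that is central modulo \<open>L\<close>,
  and one may take \<open>y\<^sub>L\<close> of order a power of a prime \<open>p\<^sub>L\<close>. It suffices to choose one \<open>n\<^sub>L\<close> in each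
  such \<open>L\<close>. Distinct minimal normal subgroups commute, and \<open>y\<^sub>L\<close> centralises \<open>H\<close> and all the others.
  If \<open>y\<^sub>L\<close> does not centralise \<open>L\<close>, take \<open>n\<^sub>L\<close> not commuting with it: a product involving \<open>n\<^sub>L\<close>
  does not commute with \<open>y\<^sub>L\<close>, so it is not in \<open>H\<close>. Otherwise a commutator \<open>n\<^sub>L\<close> of \<open>y\<^sub>L\<close> has
  \<open>p\<^sub>L\<close>-power order. The primes \<open>p\<^sub>L\<close> are distinct: the centre of \<open>H\<close> has at most one subgroup of each
  prime order (\<open>central_prime_order_subgroup_unique\<close>), so of two elements \<open>y\<^sub>L\<close> with the same prime one
  would be a power of the other, hence central modulo two subgroups with trivial intersection.
  Therefore a power of a product of such \<open>n\<^sub>L\<close> isolates a single factor, and \<open>L \<inter> H = 1\<close> keeps it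
  out of \<open>H\<close> (\<open>separated_products_avoid_subgroup\<close>).\<close>

section \<open>Linear representations and linear combinations of matrices\<close>

lemma carrier_GL_I:
  fixes A B :: "'f::field mat"
  assumes "A \<in> carrier_mat n n" "B \<in> carrier_mat n n" "A * B = 1\<^sub>m n" "B * A = 1\<^sub>m n"
  shows "A \<in> carrier (GL TYPE('f) n)"
  using assms unfolding GL_def units_of_def Units_def ring_mat_def by auto

lemma carrier_GL_D: "A \<in> carrier (GL TYPE('f::field) n) \<Longrightarrow> A \<in> carrier_mat n n"
  unfolding GL_def units_of_def Units_def ring_mat_def by auto

lemma mult_GL: "A \<otimes>\<^bsub>GL TYPE('f::field) n\<^esub> B = A * B"
  by (simp add: GL_def units_of_def ring_mat_def)

lemma one_GL: "\<one>\<^bsub>GL TYPE('f::field) n\<^esub> = 1\<^sub>m n"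
  by (simp add: GL_def units_of_def ring_mat_def)

lemma linear_repI:
  fixes \<rho> :: "'g \<Rightarrow> 'f::field mat"
  assumes "group G"
    and car: "\<And>g. g \<in> carrier G \<Longrightarrow> \<rho> g \<in> carrier_mat n n"
    and mult: "\<And>g h. g \<in> carrier G \<Longrightarrow> h \<in> carrier G \<Longrightarrow> \<rho> (g \<otimes>\<^bsub>G\<^esub> h) = \<rho> g * \<rho> h"
    and one: "\<rho> \<one>\<^bsub>G\<^esub> = 1\<^sub>m n"
  shows "linear_rep G n \<rho>"
proof -
  interpret group G by fact
  have "\<rho> g \<in> carrier (GL TYPE('f) n)" if g: "g \<in> carrier G" for g
  proof (rule carrier_GL_I[OF car[OF g] car[OF inv_closed[OF g]]])
    show "\<rho> g * \<rho> (inv\<^bsub>G\<^esub> g) = 1\<^sub>m n"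
      unfolding mult[OF g inv_closed[OF g], symmetric] using g one by simp
    show "\<rho> (inv\<^bsub>G\<^esub> g) * \<rho> g = 1\<^sub>m n"
      unfolding mult[OF inv_closed[OF g] g, symmetric] using g one by simp
  qed
  then show ?thesis
    unfolding linear_rep_def hom_def using mult by (auto simp: mult_GL)
qed

lemma linear_rep_carrier:
  "linear_rep G n \<rho> \<Longrightarrow> g \<in> carrier G \<Longrightarrow> \<rho> g \<in> carrier_mat n n"
  unfolding linear_rep_def hom_def by (auto dest: carrier_GL_D)

lemma linear_rep_mult:
  "linear_rep G n \<rho> \<Longrightarrow> g \<in> carrier G \<Longrightarrow> h \<in> carrier G \<Longrightarrow> \<rho> (g \<otimes>\<^bsub>G\<^esub> h) = \<rho> g * \<rho> h"
  unfolding linear_rep_def hom_def by (auto simp: mult_GL)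

lemma linear_rep_one:
  fixes \<rho> :: "'g \<Rightarrow> 'f::field mat"
  assumes "group G" "linear_rep G n \<rho>"
  shows "\<rho> \<one>\<^bsub>G\<^esub> = 1\<^sub>m n"
  using hom_one[of \<rho> G "GL TYPE('f) n"] assms GL_group unfolding linear_rep_def by (auto simp: one_GL)

text \<open>Linear combinations of matrices are formed entry by entry, with the size as a parameter. For
  \<open>S = carrier G\<close> and \<open>X\<close> a representation this is the action of the group algebra element
  \<open>\<Sum>g. f g g\<close>.\<close>

definition weighted_sum :: "nat \<Rightarrow> nat \<Rightarrow> 'i set \<Rightarrow> ('i \<Rightarrow> 'f) \<Rightarrow> ('i \<Rightarrow> 'f mat) \<Rightarrow> 'f::field mat" where
  "weighted_sum nr nc S f X = mat nr nc (\<lambda>(i, j). \<Sum>s\<in>S. f s * X s $$ (i, j))"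

lemma weighted_sum_carrier [simp]: "weighted_sum nr nc S f X \<in> carrier_mat nr nc"
  by (simp add: weighted_sum_def)

lemma weighted_sum_cong:
  "S = T \<Longrightarrow> (\<And>s. s \<in> T \<Longrightarrow> f s = g s) \<Longrightarrow> (\<And>s. s \<in> T \<Longrightarrow> X s = Y s) \<Longrightarrow>
   weighted_sum nr nc S f X = weighted_sum nr nc T g Y"
  unfolding weighted_sum_def by (rule cong_mat) (simp_all cong: sum.cong)

lemma mult_weighted_sum:
  assumes A: "A \<in> carrier_mat m nr" and X: "\<And>s. s \<in> S \<Longrightarrow> X s \<in> carrier_mat nr nc"
  shows "A * weighted_sum nr nc S f X = weighted_sum m nc S f (\<lambda>s. A * X s)"
proof (rule eq_matI)
  fix i j assume "i < dim_row (weighted_sum m nc S f (\<lambda>s. A * X s))"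
    and "j < dim_col (weighted_sum m nc S f (\<lambda>s. A * X s))"
  then have ij: "i < m" "j < nc" by (auto simp: weighted_sum_def)
  have "(A * weighted_sum nr nc S f X) $$ (i, j)
      = (\<Sum>k<nr. A $$ (i, k) * (\<Sum>s\<in>S. f s * X s $$ (k, j)))"
    using A ij by (auto simp: weighted_sum_def scalar_prod_def atLeast0LessThan intro!: sum.cong)
  also have "\<dots> = (\<Sum>s\<in>S. f s * (\<Sum>k<nr. A $$ (i, k) * X s $$ (k, j)))"
    unfolding sum_distrib_left by (subst sum.swap) (simp add: ac_simps)
  also have "\<dots> = (\<Sum>s\<in>S. f s * (A * X s) $$ (i, j))"
  proof (intro sum.cong refl arg_cong2[where f="(*)"])
    fix s assume s: "s \<in> S"
    show "(\<Sum>k<nr. A $$ (i, k) * X s $$ (k, j)) = (A * X s) $$ (i, j)"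
      using A X[OF s] ij by (auto simp: scalar_prod_def atLeast0LessThan intro!: sum.cong)
  qed
  finally show "(A * weighted_sum nr nc S f X) $$ (i, j) = weighted_sum m nc S f (\<lambda>s. A * X s) $$ (i, j)"
    using ij by (simp add: weighted_sum_def)
qed (use A in \<open>auto simp: weighted_sum_def\<close>)

lemma weighted_sum_mult:
  assumes A: "A \<in> carrier_mat nc m" and X: "\<And>s. s \<in> S \<Longrightarrow> X s \<in> carrier_mat nr nc"
  shows "weighted_sum nr nc S f X * A = weighted_sum nr m S f (\<lambda>s. X s * A)"
proof (rule eq_matI)
  fix i j assume "i < dim_row (weighted_sum nr m S f (\<lambda>s. X s * A))"
    and "j < dim_col (weighted_sum nr m S f (\<lambda>s. X s * A))"
  then have ij: "i < nr" "j < m" by (auto simp: weighted_sum_def)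
  have "(weighted_sum nr nc S f X * A) $$ (i, j)
      = (\<Sum>k<nc. (\<Sum>s\<in>S. f s * X s $$ (i, k)) * A $$ (k, j))"
    using A ij by (auto simp: weighted_sum_def scalar_prod_def atLeast0LessThan intro!: sum.cong)
  also have "\<dots> = (\<Sum>s\<in>S. f s * (\<Sum>k<nc. X s $$ (i, k) * A $$ (k, j)))"
    unfolding sum_distrib_left sum_distrib_right by (subst sum.swap) (simp add: ac_simps)
  also have "\<dots> = (\<Sum>s\<in>S. f s * (X s * A) $$ (i, j))"
  proof (intro sum.cong refl arg_cong2[where f="(*)"])
    fix s assume s: "s \<in> S"
    show "(\<Sum>k<nc. X s $$ (i, k) * A $$ (k, j)) = (X s * A) $$ (i, j)"
      using A X[OF s] ij by (auto simp: scalar_prod_def atLeast0LessThan intro!: sum.cong)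
  qed
  finally show "(weighted_sum nr nc S f X * A) $$ (i, j) = weighted_sum nr m S f (\<lambda>s. X s * A) $$ (i, j)"
    using ij by (simp add: weighted_sum_def)
qed (use A in \<open>auto simp: weighted_sum_def\<close>)

lemma weighted_sum_reindex:
  assumes "bij_betw \<pi> S T"
  shows "weighted_sum nr nc T f X = weighted_sum nr nc S (\<lambda>s. f (\<pi> s)) (\<lambda>s. X (\<pi> s))"
proof (rule eq_matI)
  fix i j assume "i < dim_row (weighted_sum nr nc S (\<lambda>s. f (\<pi> s)) (\<lambda>s. X (\<pi> s)))"
    and "j < dim_col (weighted_sum nr nc S (\<lambda>s. f (\<pi> s)) (\<lambda>s. X (\<pi> s)))"
  then have ij: "i < nr" "j < nc" by (auto simp: weighted_sum_def)
  show "weighted_sum nr nc T f X $$ (i, j) = weighted_sum nr nc S (\<lambda>s. f (\<pi> s)) (\<lambda>s. X (\<pi> s)) $$ (i, j)"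
    using ij by (simp add: weighted_sum_def sum.reindex_bij_betw[OF assms, of "\<lambda>t. f t * X t $$ (i, j)"])
qed (auto simp: weighted_sum_def)

section \<open>Bases adapted to a subspace\<close>

text \<open>The first \<open>k\<close> columns of \<open>M\<close> form a basis of \<open>W\<close>, extended to a basis of the whole space by the
  other columns; \<open>M'\<close> computes coordinates, so those with index \<open>k\<close> or more vanish on \<open>W\<close>. In these
  coordinates a matrix preserving \<open>W\<close> is block triangular.\<close>

lemma adapted_basis:
  fixes W :: "'f::field vec set"
  assumes W: "VectorSpace.subspace class_ring W (module_vec TYPE('f) n)"
    and nonzero: "W \<noteq> {0\<^sub>v n}" and proper: "W \<noteq> carrier_vec n"
  obtains M M' :: "'f mat" and k where "0 < k" "k < n"
    "M \<in> carrier_mat n n" "M' \<in> carrier_mat n n" "M * M' = 1\<^sub>m n" "M' * M = 1\<^sub>m n"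
    "\<And>j. j < k \<Longrightarrow> col M j \<in> W"
    "\<And>w i. w \<in> W \<Longrightarrow> k \<le> i \<Longrightarrow> i < n \<Longrightarrow> (M' *\<^sub>v w) $ i = 0"
proof -
  interpret vec_space "TYPE('f)" n .
  have Wsub: "W \<subseteq> carrier_vec n" and W0: "0\<^sub>v n \<in> W"
    and Wmod: "LinearCombinations.submodule class_ring W (module_vec TYPE('f) n)"
    using W unfolding VectorSpace.subspace_def LinearCombinations.submodule_def
    by (auto simp: module_vec_simps)
  \<comment> \<open>A linearly independent subset of \<open>W\<close> of largest cardinality is a basis of \<open>W\<close>.\<close>
  let ?P = "\<lambda>B. B \<subseteq> W \<and> lin_indpt B"
  have bound: "finite B \<and> card B \<le> n" if "?P B" for B
    using that Wsub li_le_dim(1)[OF fin_dim, of B] li_le_dim(2)[OF fin_dim, of B] dim_is_n by auto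
  have "?P {}" by (auto simp: lin_dep_def)
  then obtain B where B: "?P B" and max: "\<And>B'. ?P B' \<Longrightarrow> card B' \<le> card B"
    using ex_has_greatest_nat[of ?P "{}" card "Suc n"] bound by (meson le_imp_less_Suc)
  have Bfin: "finite B" and Bcar: "B \<subseteq> carrier_vec n" using bound[OF B] B Wsub by auto
  have spanB: "span B = W"
  proof
    show "span B \<subseteq> W" using span_is_subset[OF _ Wmod] B by blast
    show "W \<subseteq> span B"
    proof
      fix w assume w: "w \<in> W"
      show "w \<in> span B"
      proof (rule ccontr)
        assume nin: "w \<notin> span B"
        then have wB: "w \<notin> B" using in_own_span[OF Bcar] by auto
        have "lin_indpt (B \<union> {w})"
          using lin_dep_iff_in_span[OF Bcar _ _ wB] B w Wsub nin by blast
        then have "card (B \<union> {w}) \<le> card B" using max[of "B \<union> {w}"] B w by blast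
        then show False using wB Bfin by simp
      qed
    qed
  qed
  let ?E = "set (unit_vecs n) :: 'f vec set"
  have spanE: "span ?E = carrier_vec n" by (rule span_unit_vecs_is_carrier)
  have cardE: "card ?E = n"
    using distinct_card[OF unit_vecs_distinct] unit_vecs_length by metis
  have Ecar: "?E \<subseteq> carrier_vec n" using unit_vecs_carrier by blast
  have "\<exists>C. finite C \<and> C \<subseteq> carrier_vec n \<and> C \<subseteq> span ?E \<and> C \<inter> B = {}
      \<and> int (card C) \<le> int (card ?E) - int (card B) \<and> span (B \<union> C) = span ?E"
    by (rule replacement[OF Bfin finite_set Ecar conjunct2[OF B]]) (unfold spanE, rule Bcar)
  then obtain C where C: "finite C" "C \<subseteq> carrier_vec n" "C \<inter> B = {}"
    "int (card C) \<le> int n - int (card B)" "span (B \<union> C) = carrier_vec n"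
    unfolding spanE cardE by blast
  have cardBC: "card (B \<union> C) \<le> n" using C(4) card_Un_le[of B C] by linarith
  have basis: "basis (B \<union> C)"
    using dim_gen_is_basis[of "B \<union> C"] Bfin C Bcar cardBC dim_is_n by auto
  have card_eq: "card (B \<union> C) = n" using dim_basis[OF _ basis] Bfin C(1) dim_is_n by auto
  obtain bs cs where bs: "set bs = B" "distinct bs" and cs: "set cs = C" "distinct cs"
    using finite_distinct_list[OF Bfin] finite_distinct_list[OF C(1)] by auto
  have dist: "distinct (bs @ cs)" using bs cs C(3) by auto
  have len: "length (bs @ cs) = n" using distinct_card[OF dist] bs cs card_eq by simp
  define M where "M = mat_of_cols n (bs @ cs)"
  define k where "k = length bs"
  have M: "M \<in> carrier_mat n n" unfolding M_def using len by (metis mat_of_cols_carrier(1))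
  have colsM: "cols M = bs @ cs" unfolding M_def by (rule cols_mat_of_cols) (use bs cs Bcar C in auto)
  have "rank M = n"
    by (rule lin_indpt_full_rank[OF M]) (use colsM dist basis bs cs in \<open>auto simp: basis_def\<close>)
  then have "det M \<noteq> 0" using det_rank_iff[OF M] by simp
  then have "M \<in> Units (ring_mat TYPE('f) n ())" by (rule det_non_zero_imp_unit[OF M])
  then obtain M' where M': "M' \<in> carrier_mat n n" "M * M' = 1\<^sub>m n" "M' * M = 1\<^sub>m n"
    unfolding Units_def by (auto simp: ring_mat_simps)
  have colM: "col M j = bs ! j" if "j < k" for j
  proof -
    have "j < dim_col M" using that len M unfolding k_def by auto
    then have "col M j = (bs @ cs) ! j" unfolding colsM[symmetric] by (rule cols_nth[symmetric])
    then show ?thesis using that unfolding k_def by (simp add: nth_append)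
  qed
  have colW: "col M j \<in> W" if "j < k" for j
    unfolding colM[OF that] using that bs B unfolding k_def by auto
  let ?U = "{w \<in> carrier_vec n. \<forall>i. k \<le> i \<and> i < n \<longrightarrow> (M' *\<^sub>v w) $ i = 0}"
  have "LinearCombinations.submodule class_ring ?U V"
    unfolding LinearCombinations.submodule_def
  proof (intro conjI allI impI vec_module)
    fix v w assume "v \<in> ?U" "w \<in> ?U"
    then show "v \<oplus>\<^bsub>V\<^esub> w \<in> ?U"
      using M'(1) by (auto simp: module_vec_simps scalar_prod_add_distrib[of _ n])
  next
    fix c v assume "v \<in> ?U"
    then show "c \<odot>\<^bsub>V\<^esub> v \<in> ?U"
      using M'(1) by (auto simp: module_vec_simps mult_mat_vec[OF M'(1)])
  qed (use M'(1) in \<open>auto simp: module_vec_simps scalar_prod_def\<close>)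
  moreover have "B \<subseteq> ?U"
  proof
    fix b assume b: "b \<in> B"
    then obtain j where j: "j < k" "b = col M j" using bs colM unfolding k_def by (metis in_set_conv_nth)
    have jn: "j < n" using j(1) len unfolding k_def by simp
    have "M' *\<^sub>v b = col (M' * M) j" unfolding j(2) using col_mult2[OF M'(1) M jn] by simp
    then show "b \<in> ?U" using b Bcar j(1) jn unfolding M'(3) by auto
  qed
  ultimately have "span B \<subseteq> ?U" using span_is_subset by blast
  then have WU: "W \<subseteq> ?U" unfolding spanB .
  have "k \<noteq> 0"
  proof
    assume "k = 0" then have "B = {}" using bs unfolding k_def by auto
    then show False using spanB span_empty nonzero by auto
  qed
  moreover have "k \<noteq> n"
  proof
    assume "k = n"
    then have "C = {}" using len cs unfolding k_def by simp
    then show False using C(5) spanB proper by simp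
  qed
  moreover have "k \<le> n" using len unfolding k_def by simp
  ultimately show thesis
    using that[of k M M'] M M' colW WU by (auto simp: subset_iff)
qed

section \<open>Averaging over the group\<close>

lemma four_block_mat_inject:
  assumes eq: "four_block_mat A B C D = four_block_mat A' B' C' D'"
    and dims: "A \<in> carrier_mat r1 c1" "A' \<in> carrier_mat r1 c1" "B \<in> carrier_mat r1 c2" "B' \<in> carrier_mat r1 c2"
      "C \<in> carrier_mat r2 c1" "C' \<in> carrier_mat r2 c1" "D \<in> carrier_mat r2 c2" "D' \<in> carrier_mat r2 c2"
  shows "A = A'" "B = B'" "C = C'" "D = D'"
proof -
  have e: "four_block_mat A B C D $$ (i, j) = four_block_mat A' B' C' D' $$ (i, j)" for i j
    using eq by simp
  show "A = A'"
  proof (rule eq_matI)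
    fix i j assume "i < dim_row A'" "j < dim_col A'"
    then show "A $$ (i, j) = A' $$ (i, j)" using e[of i j] dims by simp
  qed (use dims in auto)
  show "B = B'"
  proof (rule eq_matI)
    fix i j assume "i < dim_row B'" "j < dim_col B'"
    then show "B $$ (i, j) = B' $$ (i, j)" using e[of i "j + c1"] dims by simp
  qed (use dims in auto)
  show "C = C'"
  proof (rule eq_matI)
    fix i j assume "i < dim_row C'" "j < dim_col C'"
    then show "C $$ (i, j) = C' $$ (i, j)" using e[of "i + r1" j] dims by simp
  qed (use dims in auto)
  show "D = D'"
  proof (rule eq_matI)
    fix i j assume "i < dim_row D'" "j < dim_col D'"
    then show "D $$ (i, j) = D' $$ (i, j)" using e[of "i + r1" "j + c1"] dims by simp
  qed (use dims in auto)
qed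

lemma weighted_sum_diff:
  assumes "\<And>s. s \<in> S \<Longrightarrow> X s \<in> carrier_mat nr nc" "\<And>s. s \<in> S \<Longrightarrow> Z s \<in> carrier_mat nr nc"
  shows "weighted_sum nr nc S f (\<lambda>s. X s - Z s) = weighted_sum nr nc S f X - weighted_sum nr nc S f Z"
proof (rule eq_matI)
  fix i j assume "i < dim_row (weighted_sum nr nc S f X - weighted_sum nr nc S f Z)"
    "j < dim_col (weighted_sum nr nc S f X - weighted_sum nr nc S f Z)"
  then have ij: "i < nr" "j < nc" by (auto simp: weighted_sum_def)
  have "(\<Sum>s\<in>S. f s * (X s - Z s) $$ (i, j)) = (\<Sum>s\<in>S. f s * X s $$ (i, j) - f s * Z s $$ (i, j))"
  proof (rule sum.cong[OF refl])
    fix s assume "s \<in> S"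
    then show "f s * (X s - Z s) $$ (i, j) = f s * X s $$ (i, j) - f s * Z s $$ (i, j)"
      using ij assms[of s] by (simp add: right_diff_distrib)
  qed
  then show "weighted_sum nr nc S f (\<lambda>s. X s - Z s) $$ (i, j)
      = (weighted_sum nr nc S f X - weighted_sum nr nc S f Z) $$ (i, j)"
    using ij by (simp add: weighted_sum_def sum_subtractf)
qed (auto simp: weighted_sum_def)

lemma weighted_sum_const:
  assumes "Z \<in> carrier_mat nr nc" "(\<Sum>s\<in>S. f s) = 1"
  shows "weighted_sum nr nc S f (\<lambda>_. Z) = Z"
  using assms by (auto simp: weighted_sum_def sum_distrib_right[symmetric])

lemma left_translation_bij:
  assumes "group G" "g \<in> carrier G"
  shows "bij_betw (\<lambda>h. g \<otimes>\<^bsub>G\<^esub> h) (carrier G) (carrier G)"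
proof -
  interpret group G by fact
  show ?thesis
    by (rule bij_betwI[where g="\<lambda>h. inv\<^bsub>G\<^esub> g \<otimes>\<^bsub>G\<^esub> h"]) (use assms(2) in \<open>auto simp: m_assoc[symmetric]\<close>)
qed

lemma mat_add_diff_cancel:
  "A \<in> carrier_mat nr nc \<Longrightarrow> B \<in> carrier_mat nr nc \<Longrightarrow> A + B - B = (A :: 'a::ab_group_add mat)"
  by (rule eq_matI) auto

lemma mat_diff_diff_cancel:
  "A \<in> carrier_mat nr nc \<Longrightarrow> B \<in> carrier_mat nr nc \<Longrightarrow> A - (A - B) = (B :: 'a::ab_group_add mat)"
  by (rule eq_matI) auto

text \<open>Maschke's averaging argument. The off-diagonal block of a block triangular representation is a
  cocycle, and the average of \<open>B(h) D(h)\<^sup>-\<^sup>1\<close> over the group exhibits it as a coboundary, that is, \<open>1 + Y\<close>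
  conjugates the representation to block diagonal form.\<close>

lemma averaged_cocycle:
  fixes A B D :: "'g \<Rightarrow> 'f::field mat"
  assumes "group G" "finite (carrier G)" and card: "of_nat (card (carrier G)) \<noteq> (0::'f)"
    and A: "\<And>g. g \<in> carrier G \<Longrightarrow> A g \<in> carrier_mat k k"
    and B: "\<And>g. g \<in> carrier G \<Longrightarrow> B g \<in> carrier_mat k m"
    and D: "linear_rep G m D"
    and cocycle: "\<And>g h. g \<in> carrier G \<Longrightarrow> h \<in> carrier G \<Longrightarrow> B (g \<otimes>\<^bsub>G\<^esub> h) = A g * B h + B g * D h"
  obtains Y where "Y \<in> carrier_mat k m" "\<And>g. g \<in> carrier G \<Longrightarrow> B g = Y * D g - A g * Y"
proof -
  interpret group G by fact
  note Dc = linear_rep_carrier[OF D] and Dm = linear_rep_mult[OF D] and D1 = linear_rep_one[OF assms(1) D]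
  define c where "c = (\<lambda>h::'g. inverse (of_nat (card (carrier G))) :: 'f)"
  define Z where "Z h = B h * D (inv\<^bsub>G\<^esub> h)" for h
  define Y where "Y = weighted_sum k m (carrier G) c Z"
  have sum_c: "(\<Sum>h\<in>carrier G. c h) = 1" unfolding c_def using card by simp
  have Zc: "Z h \<in> carrier_mat k m" if "h \<in> carrier G" for h
    unfolding Z_def using B[OF that] Dc[of "inv\<^bsub>G\<^esub> h"] that by simp
  have Y: "Y \<in> carrier_mat k m" unfolding Y_def by simp
  have "B g = Y * D g - A g * Y" if g: "g \<in> carrier G" for g
  proof -
    have step: "A g * Z h = Z (g \<otimes>\<^bsub>G\<^esub> h) * D g - B g" if h: "h \<in> carrier G" for h
    proof -
      have Dinv: "D (inv\<^bsub>G\<^esub> h) \<in> carrier_mat m m" using Dc h by simp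
      have e1: "Z (g \<otimes>\<^bsub>G\<^esub> h) * D g = B (g \<otimes>\<^bsub>G\<^esub> h) * (D (inv\<^bsub>G\<^esub> (g \<otimes>\<^bsub>G\<^esub> h)) * D g)"
        unfolding Z_def by (rule assoc_mult_mat[of _ k m _ m _ m]) (use B Dc g h in auto)
      have e2: "D (inv\<^bsub>G\<^esub> (g \<otimes>\<^bsub>G\<^esub> h)) * D g = D (inv\<^bsub>G\<^esub> h)"
      proof -
        have "inv\<^bsub>G\<^esub> (g \<otimes>\<^bsub>G\<^esub> h) \<otimes>\<^bsub>G\<^esub> g = inv\<^bsub>G\<^esub> h"
          using g h by (simp add: inv_mult_group m_assoc)
        moreover have "inv\<^bsub>G\<^esub> (g \<otimes>\<^bsub>G\<^esub> h) \<in> carrier G" using g h by simp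
        ultimately show ?thesis using Dm[of "inv\<^bsub>G\<^esub> (g \<otimes>\<^bsub>G\<^esub> h)" g] g by metis
      qed
      have e3: "B (g \<otimes>\<^bsub>G\<^esub> h) * D (inv\<^bsub>G\<^esub> h) = A g * B h * D (inv\<^bsub>G\<^esub> h) + B g * D h * D (inv\<^bsub>G\<^esub> h)"
        unfolding cocycle[OF g h]
        by (rule add_mult_distrib_mat[OF mult_carrier_mat[OF A[OF g] B[OF h]]
              mult_carrier_mat[OF B[OF g] Dc[OF h]] Dinv])
      have e4: "A g * B h * D (inv\<^bsub>G\<^esub> h) = A g * Z h"
        unfolding Z_def by (rule assoc_mult_mat[OF A[OF g] B[OF h] Dinv])
      have e5: "B g * D h * D (inv\<^bsub>G\<^esub> h) = B g * (D h * D (inv\<^bsub>G\<^esub> h))"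
        by (rule assoc_mult_mat[OF B[OF g] Dc[OF h] Dinv])
      have e6: "D h * D (inv\<^bsub>G\<^esub> h) = 1\<^sub>m m"
        using Dm[OF h inv_closed[OF h]] h D1 by simp
      have "Z (g \<otimes>\<^bsub>G\<^esub> h) * D g = A g * Z h + B g"
        unfolding e1 e2 e3 e4 e5 e6 right_mult_one_mat[OF B[OF g]] ..
      then show ?thesis
        using mult_carrier_mat[OF A[OF g] Zc[OF h]] B[OF g] by (simp add: mat_add_diff_cancel)
    qed
    have Zg: "Z (g \<otimes>\<^bsub>G\<^esub> h) \<in> carrier_mat k m" if "h \<in> carrier G" for h using Zc that g by simp
    have f1: "A g * Y = weighted_sum k m (carrier G) c (\<lambda>h. A g * Z h)"
      unfolding Y_def by (rule mult_weighted_sum[OF A[OF g] Zc])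
    have f2: "weighted_sum k m (carrier G) c (\<lambda>h. A g * Z h)
        = weighted_sum k m (carrier G) c (\<lambda>h. Z (g \<otimes>\<^bsub>G\<^esub> h) * D g - B g)"
      by (rule weighted_sum_cong) (auto simp: step)
    have f3: "weighted_sum k m (carrier G) c (\<lambda>h. Z (g \<otimes>\<^bsub>G\<^esub> h) * D g - B g)
        = weighted_sum k m (carrier G) c (\<lambda>h. Z (g \<otimes>\<^bsub>G\<^esub> h) * D g) - weighted_sum k m (carrier G) c (\<lambda>h. B g)"
      by (rule weighted_sum_diff[OF mult_carrier_mat[OF Zg Dc[OF g]] B[OF g]])
    have f4: "weighted_sum k m (carrier G) c (\<lambda>h. B g) = B g"
      by (rule weighted_sum_const[OF B[OF g] sum_c])
    have f5: "weighted_sum k m (carrier G) c (\<lambda>h. Z (g \<otimes>\<^bsub>G\<^esub> h) * D g)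
        = weighted_sum k m (carrier G) c (\<lambda>h. Z (g \<otimes>\<^bsub>G\<^esub> h)) * D g"
      by (rule weighted_sum_mult[symmetric, OF Dc[OF g] Zg])
    have f6: "weighted_sum k m (carrier G) c (\<lambda>h. Z (g \<otimes>\<^bsub>G\<^esub> h)) = Y"
      unfolding Y_def weighted_sum_reindex[OF left_translation_bij[OF assms(1) g], of _ _ _ Z] by (simp add: c_def)
    have "A g * Y = Y * D g - B g" unfolding f1 f2 f3 f4 f5 f6 ..
    then show ?thesis
      using mat_diff_diff_cancel[OF mult_carrier_mat[OF Y Dc[OF g]] B[OF g]] by simp
  qed
  with Y show thesis by (rule that)
qed

section \<open>Irreducible representations detecting a group algebra element\<close>

text \<open>In the regular representation the diagonal entry at the identity of the action of \<open>f\<close> is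
  \<open>f(1)\<close>.\<close>

lemma regular_rep_nonzero:
  fixes f :: "'g \<Rightarrow> 'f::field"
  assumes "group G" "finite (carrier G)" and f1: "f \<one>\<^bsub>G\<^esub> \<noteq> 0"
  shows "\<exists>n \<rho>. linear_rep G n \<rho> \<and> weighted_sum n n (carrier G) f \<rho> \<noteq> 0\<^sub>m n n"
proof -
  interpret group G by fact
  define n where "n = card (carrier G)"
  obtain e where e: "bij_betw e {..<n} (carrier G)"
    using ex_bij_betw_nat_finite[OF assms(2)] unfolding n_def atLeast0LessThan by blast
  have e_in: "e i \<in> carrier G" if "i < n" for i using e that by (auto dest: bij_betwE)
  define \<rho> where "\<rho> g = mat n n (\<lambda>(i, j). if e i = g \<otimes>\<^bsub>G\<^esub> e j then 1 else 0 :: 'f)" for g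
  have "linear_rep G n \<rho>"
  proof (rule linear_repI[OF assms(1)])
    show "\<rho> g \<in> carrier_mat n n" for g by (simp add: \<rho>_def)
    show "\<rho> \<one>\<^bsub>G\<^esub> = 1\<^sub>m n"
    proof (rule eq_matI)
      fix i j assume "i < dim_row (1\<^sub>m n :: 'f mat)" "j < dim_col (1\<^sub>m n :: 'f mat)"
      then have ij: "i < n" "j < n" by auto
      then have "e i = e j \<longleftrightarrow> i = j" using e by (auto simp: bij_betw_def inj_on_def)
      then show "\<rho> \<one>\<^bsub>G\<^esub> $$ (i, j) = (1\<^sub>m n :: 'f mat) $$ (i, j)"
        using ij e_in[OF ij(2)] by (simp add: \<rho>_def)
    qed (auto simp: \<rho>_def)
    fix g h assume g: "g \<in> carrier G" and h: "h \<in> carrier G"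
    show "\<rho> (g \<otimes>\<^bsub>G\<^esub> h) = \<rho> g * \<rho> h"
    proof (rule eq_matI)
      fix i k assume "i < dim_row (\<rho> g * \<rho> h)" "k < dim_col (\<rho> g * \<rho> h)"
      then have ik: "i < n" "k < n" by (auto simp: \<rho>_def)
      have "(\<rho> g * \<rho> h) $$ (i, k)
          = (\<Sum>j<n. (if e i = g \<otimes>\<^bsub>G\<^esub> e j then 1 else 0) * (if e j = h \<otimes>\<^bsub>G\<^esub> e k then 1 else 0))"
        using ik by (auto simp: \<rho>_def scalar_prod_def atLeast0LessThan intro!: sum.cong)
      also have "\<dots> = (\<Sum>x\<in>carrier G. (if e i = g \<otimes>\<^bsub>G\<^esub> x then 1 else 0) * (if x = h \<otimes>\<^bsub>G\<^esub> e k then 1 else 0))"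
        by (rule sum.reindex_bij_betw[OF e])
      also have "\<dots> = (\<Sum>x\<in>carrier G. if x = h \<otimes>\<^bsub>G\<^esub> e k then (if e i = g \<otimes>\<^bsub>G\<^esub> x then 1 else 0) else 0)"
        by (intro sum.cong) auto
      also have "\<dots> = (if e i = g \<otimes>\<^bsub>G\<^esub> (h \<otimes>\<^bsub>G\<^esub> e k) then 1 else 0)"
        using assms(2) h e_in[OF ik(2)] by simp
      finally show "\<rho> (g \<otimes>\<^bsub>G\<^esub> h) $$ (i, k) = (\<rho> g * \<rho> h) $$ (i, k)"
        using ik g h e_in[OF ik(2)] by (simp add: \<rho>_def m_assoc)
    qed (auto simp: \<rho>_def)
  qed
  moreover have "weighted_sum n n (carrier G) f \<rho> \<noteq> 0\<^sub>m n n"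
  proof
    assume zero: "weighted_sum n n (carrier G) f \<rho> = 0\<^sub>m n n"
    have "\<one>\<^bsub>G\<^esub> \<in> e ` {..<n}" using e unfolding bij_betw_def by simp
    then obtain i where i: "i < n" "e i = \<one>\<^bsub>G\<^esub>" by auto
    have "weighted_sum n n (carrier G) f \<rho> $$ (i, i) = (\<Sum>g\<in>carrier G. if g = \<one>\<^bsub>G\<^esub> then f g else 0)"
      using i by (auto simp: weighted_sum_def \<rho>_def intro!: sum.cong)
    also have "\<dots> = f \<one>\<^bsub>G\<^esub>" using assms(2) by simp
    finally show False using zero i f1 by simp
  qed
  ultimately show ?thesis by blast
qed

text \<open>By averaging, the off-diagonal block of the action of \<open>f\<close> is \<open>Y D(f) - A(f) Y\<close>, so it vanishes
  along with the diagonal blocks. This is the form in which complete reducibility is used; no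
  invariant complement has to be constructed.\<close>

lemma block_triangular_rep:
  fixes f :: "'g \<Rightarrow> 'f::field"
  assumes "group G" "finite (carrier G)" and card: "of_nat (card (carrier G)) \<noteq> (0::'f)"
    and A: "\<And>g. g \<in> carrier G \<Longrightarrow> A g \<in> carrier_mat k k"
    and B: "\<And>g. g \<in> carrier G \<Longrightarrow> B g \<in> carrier_mat k m"
    and D: "\<And>g. g \<in> carrier G \<Longrightarrow> D g \<in> carrier_mat m m"
    and \<tau>: "linear_rep G (k + m) \<tau>"
    and block: "\<And>g. g \<in> carrier G \<Longrightarrow> \<tau> g = four_block_mat (A g) (B g) (0\<^sub>m m k) (D g)"
  shows "linear_rep G k A" "linear_rep G m D"
    and "weighted_sum k k (carrier G) f A = 0\<^sub>m k k \<Longrightarrow> weighted_sum m m (carrier G) f D = 0\<^sub>m m m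
      \<Longrightarrow> weighted_sum (k + m) (k + m) (carrier G) f \<tau> = 0\<^sub>m (k + m) (k + m)"
proof -
  interpret group G by fact
  have mult: "A (g \<otimes>\<^bsub>G\<^esub> h) = A g * A h" "B (g \<otimes>\<^bsub>G\<^esub> h) = A g * B h + B g * D h" "D (g \<otimes>\<^bsub>G\<^esub> h) = D g * D h"
    if g: "g \<in> carrier G" and h: "h \<in> carrier G" for g h
  proof -
    note c = A[OF g] A[OF h] B[OF g] B[OF h] D[OF g] D[OF h]
    have "four_block_mat (A (g \<otimes>\<^bsub>G\<^esub> h)) (B (g \<otimes>\<^bsub>G\<^esub> h)) (0\<^sub>m m k) (D (g \<otimes>\<^bsub>G\<^esub> h))
        = four_block_mat (A g) (B g) (0\<^sub>m m k) (D g) * four_block_mat (A h) (B h) (0\<^sub>m m k) (D h)"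
      using linear_rep_mult[OF \<tau> g h] block[OF g] block[OF h] block[OF m_closed[OF g h]] by simp
    also have "\<dots> = four_block_mat (A g * A h + B g * 0\<^sub>m m k) (A g * B h + B g * D h)
        (0\<^sub>m m k * A h + D g * 0\<^sub>m m k) (0\<^sub>m m k * B h + D g * D h)"
      by (rule mult_four_block_mat[OF c(1,3) zero_carrier_mat c(5) c(2,4) zero_carrier_mat c(6)])
    finally have eq: "four_block_mat (A (g \<otimes>\<^bsub>G\<^esub> h)) (B (g \<otimes>\<^bsub>G\<^esub> h)) (0\<^sub>m m k) (D (g \<otimes>\<^bsub>G\<^esub> h))
      = four_block_mat (A g * A h + B g * 0\<^sub>m m k) (A g * B h + B g * D h)
        (0\<^sub>m m k * A h + D g * 0\<^sub>m m k) (0\<^sub>m m k * B h + D g * D h)" .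
    have z: "A g * A h + B g * 0\<^sub>m m k = A g * A h" "0\<^sub>m m k * B h + D g * D h = D g * D h"
      using c by simp_all
    note inj = four_block_mat_inject[OF eq[unfolded z], of k k m m]
    show "A (g \<otimes>\<^bsub>G\<^esub> h) = A g * A h" "B (g \<otimes>\<^bsub>G\<^esub> h) = A g * B h + B g * D h" "D (g \<otimes>\<^bsub>G\<^esub> h) = D g * D h"
      using inj c A[OF m_closed[OF g h]] B[OF m_closed[OF g h]] D[OF m_closed[OF g h]] by auto
  qed
  have "four_block_mat (A \<one>\<^bsub>G\<^esub>) (B \<one>\<^bsub>G\<^esub>) (0\<^sub>m m k) (D \<one>\<^bsub>G\<^esub>) = four_block_mat (1\<^sub>m k) (0\<^sub>m k m) (0\<^sub>m m k) (1\<^sub>m m)"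
    using block[OF one_closed] linear_rep_one[OF assms(1) \<tau>] by simp
  note inj1 = four_block_mat_inject[OF this, of k k m m]
  show repA: "linear_rep G k A"
    by (rule linear_repI[OF assms(1) A mult(1)]) (use inj1 A B D in auto)
  show repD: "linear_rep G m D"
    by (rule linear_repI[OF assms(1) D mult(3)]) (use inj1 A B D in auto)
  assume fA: "weighted_sum k k (carrier G) f A = 0\<^sub>m k k" and fD: "weighted_sum m m (carrier G) f D = 0\<^sub>m m m"
  obtain Y where Y: "Y \<in> carrier_mat k m" and BY: "\<And>g. g \<in> carrier G \<Longrightarrow> B g = Y * D g - A g * Y"
    using averaged_cocycle[OF assms(1,2) card A B repD mult(2)] by blast
  have "weighted_sum k m (carrier G) f B = weighted_sum k m (carrier G) f (\<lambda>g. Y * D g - A g * Y)"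
    by (rule weighted_sum_cong) (auto simp: BY)
  also have "\<dots> = weighted_sum k m (carrier G) f (\<lambda>g. Y * D g) - weighted_sum k m (carrier G) f (\<lambda>g. A g * Y)"
    by (rule weighted_sum_diff[OF mult_carrier_mat[OF Y D] mult_carrier_mat[OF A Y]])
  also have "\<dots> = Y * weighted_sum m m (carrier G) f D - weighted_sum k k (carrier G) f A * Y"
    using mult_weighted_sum[OF Y, of "carrier G" D m f] weighted_sum_mult[OF Y, of "carrier G" A k f] A D by simp
  also have "\<dots> = 0\<^sub>m k m" unfolding fA fD using Y by simp
  finally have fB: "weighted_sum k m (carrier G) f B = 0\<^sub>m k m" .
  show "weighted_sum (k + m) (k + m) (carrier G) f \<tau> = 0\<^sub>m (k + m) (k + m)"
  proof (rule eq_matI)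
    fix i j assume "i < dim_row (0\<^sub>m (k + m) (k + m) :: 'f mat)" "j < dim_col (0\<^sub>m (k + m) (k + m) :: 'f mat)"
    then have ij: "i < k + m" "j < k + m" by auto
    have entry: "\<tau> g $$ (i, j) = (if i < k then if j < k then A g $$ (i, j) else B g $$ (i, j - k)
        else if j < k then 0 else D g $$ (i - k, j - k))" if "g \<in> carrier G" for g
      using ij A[OF that] B[OF that] D[OF that] unfolding block[OF that] by auto
    have "(\<Sum>g\<in>carrier G. f g * \<tau> g $$ (i, j)) = (if i < k then if j < k then weighted_sum k k (carrier G) f A $$ (i, j)
        else weighted_sum k m (carrier G) f B $$ (i, j - k)
        else if j < k then 0 else weighted_sum m m (carrier G) f D $$ (i - k, j - k))"
      using ij by (auto simp: weighted_sum_def entry intro!: sum.neutral)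
    also have "\<dots> = 0" using ij unfolding fA fB fD by auto
    finally show "weighted_sum (k + m) (k + m) (carrier G) f \<tau> $$ (i, j) = (0\<^sub>m (k + m) (k + m) :: 'f mat) $$ (i, j)"
      using ij by (simp add: weighted_sum_def)
  qed (auto simp: weighted_sum_def)
qed

text \<open>A reducible representation is block triangular in suitable coordinates, and one of its two
  diagonal blocks still does not annihilate \<open>f\<close>; the dimension goes down until the representation
  is irreducible.\<close>

lemma irreducible_not_annihilated:
  fixes f :: "'g \<Rightarrow> 'f::field"
  assumes "group G" "finite (carrier G)" and card: "of_nat (card (carrier G)) \<noteq> (0::'f)"
    and "linear_rep G n \<rho>" "weighted_sum n n (carrier G) f \<rho> \<noteq> 0\<^sub>m n n"
  shows "\<exists>n \<sigma>. irreducible_rep G n \<sigma> \<and> weighted_sum n n (carrier G) f \<sigma> \<noteq> 0\<^sub>m n n"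
  using assms(4,5)
proof (induction n arbitrary: \<rho> rule: less_induct)
  case (less n)
  note \<rho> = less.prems(1) and nz = less.prems(2)
  interpret group G by fact
  show ?case
  proof (cases "irreducible_rep G n \<rho>")
    case True
    then show ?thesis using nz by blast
  next
    case False
    have "n \<noteq> 0"
    proof
      assume "n = 0"
      then show False using nz by (auto simp: weighted_sum_def)
    qed
    have "\<not> irreducible_mats n (\<rho> ` carrier G)"
      using False \<rho> unfolding irreducible_rep_def by simp
    then obtain W where W0: "VectorSpace.subspace class_ring W (module_vec TYPE('f) n)
        \<and> (\<forall>A \<in> \<rho> ` carrier G. \<forall>w \<in> W. A *\<^sub>v w \<in> W) \<and> \<not> (W = {0\<^sub>v n} \<or> W = carrier_vec n)"
      using \<open>n \<noteq> 0\<close> unfolding irreducible_mats_def by meson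
    have W: "VectorSpace.subspace class_ring W (module_vec TYPE('f) n)"
      "\<And>g w. g \<in> carrier G \<Longrightarrow> w \<in> W \<Longrightarrow> \<rho> g *\<^sub>v w \<in> W" "W \<noteq> {0\<^sub>v n}" "W \<noteq> carrier_vec n"
      using W0 by simp_all
    obtain M M' :: "'f mat" and k where k: "0 < k" "k < n"
      and M: "M \<in> carrier_mat n n" and M': "M' \<in> carrier_mat n n" and MM': "M * M' = 1\<^sub>m n" "M' * M = 1\<^sub>m n"
      and colM: "\<And>j. j < k \<Longrightarrow> col M j \<in> W"
      and vanish: "\<And>w i. w \<in> W \<Longrightarrow> k \<le> i \<Longrightarrow> i < n \<Longrightarrow> (M' *\<^sub>v w) $ i = 0"
      by (rule adapted_basis[OF W(1,3,4)], rule that) assumption+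
    define m where "m = n - k"
    have nkm: "n = k + m" using k unfolding m_def by simp
    note \<rho>c = linear_rep_carrier[OF \<rho>]
    define \<tau> where "\<tau> g = M' * \<rho> g * M" for g
    have \<tau>c: "\<tau> g \<in> carrier_mat n n" if "g \<in> carrier G" for g
      unfolding \<tau>_def using M M' \<rho>c[OF that] by simp
    have \<tau>rep: "linear_rep G n \<tau>"
    proof (rule linear_repI[OF assms(1) \<tau>c])
      show "\<tau> \<one>\<^bsub>G\<^esub> = 1\<^sub>m n"
        unfolding \<tau>_def linear_rep_one[OF assms(1) \<rho>] using M' MM' by simp
      fix g h assume g: "g \<in> carrier G" and h: "h \<in> carrier G"
      have e1: "\<tau> g * \<tau> h = M' * \<rho> g * (M * (M' * \<rho> h * M))"
        unfolding \<tau>_def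
        by (rule assoc_mult_mat[OF mult_carrier_mat[OF M' \<rho>c[OF g]] M \<tau>c[OF h, unfolded \<tau>_def]])
      have e2: "M * (M' * \<rho> h * M) = M * (M' * (\<rho> h * M))"
        unfolding assoc_mult_mat[OF M' \<rho>c[OF h] M] by (rule refl)
      have e3: "M * (M' * (\<rho> h * M)) = (M * M') * (\<rho> h * M)"
        by (rule assoc_mult_mat[symmetric, OF M M' mult_carrier_mat[OF \<rho>c[OF h] M]])
      have e4: "1\<^sub>m n * (\<rho> h * M) = \<rho> h * M" by (rule left_mult_one_mat[OF mult_carrier_mat[OF \<rho>c[OF h] M]])
      have e5: "M' * \<rho> g * (\<rho> h * M) = M' * \<rho> g * \<rho> h * M"
        by (rule assoc_mult_mat[symmetric, OF mult_carrier_mat[OF M' \<rho>c[OF g]] \<rho>c[OF h] M])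
      have e6: "M' * \<rho> g * \<rho> h = M' * (\<rho> g * \<rho> h)"
        by (rule assoc_mult_mat[OF M' \<rho>c[OF g] \<rho>c[OF h]])
      show "\<tau> (g \<otimes>\<^bsub>G\<^esub> h) = \<tau> g * \<tau> h"
        unfolding e1 e2 e3 MM'(1) e4 e5 e6 unfolding \<tau>_def linear_rep_mult[OF \<rho> g h] by (rule refl)
    qed
    \<comment> \<open>Column \<open>j\<close> of \<open>M\<close> lies in \<open>W\<close>, and so does its image, whose later coordinates vanish.\<close>
    have corner: "\<tau> g $$ (i, j) = 0" if g: "g \<in> carrier G" and ij: "k \<le> i" "i < n" "j < k" for g i j
    proof -
      have jn: "j < n" using ij k by simp
      have "\<tau> g = M' * (\<rho> g * M)" unfolding \<tau>_def by (rule assoc_mult_mat[OF M' \<rho>c[OF g] M])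
      then have "\<tau> g $$ (i, j) = (M' *\<^sub>v (\<rho> g *\<^sub>v col M j)) $ i"
        using M' \<rho>c[OF g] M ij jn col_mult2[OF \<rho>c[OF g] M jn] by simp
      then show ?thesis using vanish[OF W(2)[OF g colM[OF ij(3)]] ij(1,2)] by simp
    qed
    define A where "A g = mat k k (\<lambda>(i, j). \<tau> g $$ (i, j))" for g
    define B where "B g = mat k m (\<lambda>(i, j). \<tau> g $$ (i, j + k))" for g
    define D where "D g = mat m m (\<lambda>(i, j). \<tau> g $$ (i + k, j + k))" for g
    have block: "\<tau> g = four_block_mat (A g) (B g) (0\<^sub>m m k) (D g)" if g: "g \<in> carrier G" for g
    proof (rule eq_matI)
      fix i j assume "i < dim_row (four_block_mat (A g) (B g) (0\<^sub>m m k) (D g))"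
        "j < dim_col (four_block_mat (A g) (B g) (0\<^sub>m m k) (D g))"
      then have ij: "i < k + m" "j < k + m" by (auto simp: A_def D_def)
      then show "\<tau> g $$ (i, j) = four_block_mat (A g) (B g) (0\<^sub>m m k) (D g) $$ (i, j)"
        using corner[OF g, of i j] nkm by (auto simp: A_def B_def D_def)
    qed (use \<tau>c[OF g] nkm in \<open>auto simp: A_def D_def\<close>)
    have "weighted_sum n n (carrier G) f \<tau> \<noteq> 0\<^sub>m n n"
    proof
      assume zero: "weighted_sum n n (carrier G) f \<tau> = 0\<^sub>m n n"
      have "weighted_sum n n (carrier G) f \<rho> = weighted_sum n n (carrier G) f (\<lambda>g. M * (\<tau> g * M'))"
      proof (rule weighted_sum_cong[OF refl refl])
        fix g assume g: "g \<in> carrier G"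
        have e1: "\<tau> g * M' = M' * \<rho> g * (M * M')"
          unfolding \<tau>_def by (rule assoc_mult_mat[OF mult_carrier_mat[OF M' \<rho>c[OF g]] M M'])
        have e2: "M' * \<rho> g * 1\<^sub>m n = M' * \<rho> g"
          by (rule right_mult_one_mat[OF mult_carrier_mat[OF M' \<rho>c[OF g]]])
        have e3: "M * (M' * \<rho> g) = M * M' * \<rho> g"
          by (rule assoc_mult_mat[symmetric, OF M M' \<rho>c[OF g]])
        show "\<rho> g = M * (\<tau> g * M')" unfolding e1 MM'(1) e2 e3 by (rule left_mult_one_mat[symmetric, OF \<rho>c[OF g]])
      qed
      also have "\<dots> = M * weighted_sum n n (carrier G) f (\<lambda>g. \<tau> g * M')"
        by (rule mult_weighted_sum[symmetric, OF M mult_carrier_mat[OF \<tau>c M']])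
      also have "\<dots> = M * (weighted_sum n n (carrier G) f \<tau> * M')"
        using weighted_sum_mult[OF M', of "carrier G" \<tau> n f] \<tau>c by simp
      also have "\<dots> = 0\<^sub>m n n" unfolding zero using M M' by simp
      finally show False using nz by simp
    qed
    then have nz': "weighted_sum (k + m) (k + m) (carrier G) f \<tau> \<noteq> 0\<^sub>m (k + m) (k + m)" unfolding nkm .
    have dims: "A g \<in> carrier_mat k k" "B g \<in> carrier_mat k m" "D g \<in> carrier_mat m m" for g
      by (auto simp: A_def B_def D_def)
    have rep_A: "linear_rep G k A" and rep_D: "linear_rep G m D"
      and zero_AD: "weighted_sum k k (carrier G) f A = 0\<^sub>m k k \<Longrightarrow> weighted_sum m m (carrier G) f D = 0\<^sub>m m m
        \<Longrightarrow> weighted_sum (k + m) (k + m) (carrier G) f \<tau> = 0\<^sub>m (k + m) (k + m)"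
      using block_triangular_rep(1,2)[where A=A and B=B and D=D, OF assms(1,2) card _ _ _ \<tau>rep[unfolded nkm]]
        block_triangular_rep(3)[where A=A and B=B and D=D and f=f, OF assms(1,2) card _ _ _ \<tau>rep[unfolded nkm]]
        dims block by simp_all
    have "weighted_sum k k (carrier G) f A \<noteq> 0\<^sub>m k k \<or> weighted_sum m m (carrier G) f D \<noteq> 0\<^sub>m m m"
      using zero_AD nz' by blast
    then show ?thesis
    proof
      assume "weighted_sum k k (carrier G) f A \<noteq> 0\<^sub>m k k"
      then show ?thesis by (rule less.IH[OF k(2) rep_A])
    next
      have "m < n" using k unfolding m_def by simp
      moreover assume "weighted_sum m m (carrier G) f D \<noteq> 0\<^sub>m m m"
      ultimately show ?thesis using less.IH[OF _ rep_D] by simp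
    qed
  qed
qed

section \<open>A group algebra element that detects faithfulness on H\<close>

text \<open>A normalised element \<open>b\<close> of the group algebra of \<open>H\<close> such that \<open>b\<close> times the sum of the elements
  of \<open>K\<close> is zero for every nontrivial normal subgroup \<open>K\<close> of \<open>H\<close>. Where \<open>K\<close> acts trivially, this
  sum acts as the number \<open>card K\<close>, so \<open>b\<close> itself must act as zero there.\<close>

definition faithful_weight :: "('g, 'b) monoid_scheme \<Rightarrow> 'g set \<Rightarrow> ('g \<Rightarrow> 'f::field) \<Rightarrow> bool" where
  "faithful_weight G H b \<longleftrightarrow> b \<one>\<^bsub>G\<^esub> = 1 \<and> (\<forall>x. x \<notin> H \<longrightarrow> b x = 0) \<and>
     (\<forall>K. subgroup K G \<longrightarrow> K \<subseteq> H \<longrightarrow> (\<forall>h\<in>H. \<forall>k\<in>K. h \<otimes>\<^bsub>G\<^esub> k \<otimes>\<^bsub>G\<^esub> inv\<^bsub>G\<^esub> h \<in> K) \<longrightarrow> K \<noteq> {\<one>\<^bsub>G\<^esub>} \<longrightarrow>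
        (\<forall>x\<in>H. (\<Sum>k\<in>K. b (x \<otimes>\<^bsub>G\<^esub> k)) = 0))"

lemma (in group) inverse_bij_on_subgroup:
  assumes "subgroup K G"
  shows "bij_betw (\<lambda>k. inv k) K K"
proof -
  interpret K: subgroup K G by fact
  show ?thesis
    by (rule bij_betwI[where g="\<lambda>k. inv k"]) auto
qed

lemma (in group) conjugation_bij:
  assumes "subgroup K G" "h \<in> carrier G" and norm: "\<And>k. k \<in> K \<Longrightarrow> h \<otimes> k \<otimes> inv h \<in> K" "\<And>k. k \<in> K \<Longrightarrow> inv h \<otimes> k \<otimes> h \<in> K"
  shows "bij_betw (\<lambda>k. h \<otimes> k \<otimes> inv h) K K"
proof -
  interpret K: subgroup K G by fact
  have cancel: "inv h \<otimes> (h \<otimes> z) = z" "h \<otimes> (inv h \<otimes> z) = z" if "z \<in> carrier G" for z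
    using that assms(2) by (simp_all add: m_assoc[symmetric])
  have "inv h \<otimes> (h \<otimes> k \<otimes> inv h) \<otimes> h = k" "h \<otimes> (inv h \<otimes> k \<otimes> h) \<otimes> inv h = k" if "k \<in> K" for k
    using that assms(2) K.mem_carrier[OF that] by (simp_all add: m_assoc cancel)
  then show ?thesis
    by (intro bij_betwI[where g="\<lambda>k. inv h \<otimes> k \<otimes> h"]) (use norm in auto)
qed

lemma image_subspace:
  fixes E :: "'f::field mat"
  assumes E: "E \<in> carrier_mat n n"
  shows "VectorSpace.subspace class_ring ((*\<^sub>v) E ` carrier_vec n) (module_vec TYPE('f) n)"
proof -
  interpret vec_space "TYPE('f)" n .
  let ?W = "(*\<^sub>v) E ` carrier_vec n"
  have add: "v \<oplus>\<^bsub>V\<^esub> w \<in> ?W" if "v \<in> ?W" "w \<in> ?W" for v w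
  proof -
    obtain v' w' where vw: "v' \<in> carrier_vec n" "v = E *\<^sub>v v'" "w' \<in> carrier_vec n" "w = E *\<^sub>v w'" using \<open>v \<in> ?W\<close> \<open>w \<in> ?W\<close> by blast
    have "v \<oplus>\<^bsub>V\<^esub> w = E *\<^sub>v (v' + w')"
      unfolding vw mult_add_distrib_mat_vec[OF E vw(1,3)] by (simp add: module_vec_simps)
    then show ?thesis using vw by simp
  qed
  have smult: "c \<odot>\<^bsub>V\<^esub> v \<in> ?W" if "v \<in> ?W" for c v
  proof -
    obtain v' where v: "v' \<in> carrier_vec n" "v = E *\<^sub>v v'" using \<open>v \<in> ?W\<close> by blast
    have "c \<odot>\<^bsub>V\<^esub> v = E *\<^sub>v (c \<cdot>\<^sub>v v')"
      unfolding v mult_mat_vec[OF E v(1)] by (simp add: module_vec_simps)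
    then show ?thesis using v by simp
  qed
  have zero: "\<zero>\<^bsub>V\<^esub> \<in> ?W"
  proof -
    have "E *\<^sub>v 0\<^sub>v n = 0\<^sub>v n" using E by (intro eq_vecI) auto
    then have "0\<^sub>v n \<in> ?W" using zero_carrier_vec by (rule rev_image_eqI[OF _ sym, rotated])
    then show ?thesis by (simp add: module_vec_simps)
  qed
  have sub: "?W \<subseteq> carrier V" using E by (auto simp: module_vec_simps)
  show ?thesis
    unfolding VectorSpace.subspace_def LinearCombinations.submodule_def
    by (intro conjI allI impI vec_vs vec_module sub zero add smult)
qed

lemma mat_eq_zero_if_mult_vec_zero:
  fixes E :: "'f::field mat"
  assumes E: "E \<in> carrier_mat n n" and zero: "\<And>v. v \<in> carrier_vec n \<Longrightarrow> E *\<^sub>v v = 0\<^sub>v n"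
  shows "E = 0\<^sub>m n n"
proof (rule eq_matI)
  fix i j assume "i < dim_row (0\<^sub>m n n :: 'f mat)" "j < dim_col (0\<^sub>m n n :: 'f mat)"
  then have ij: "i < n" "j < n" by auto
  have "E *\<^sub>v unit_vec n j = col E j" using E ij by (intro eq_vecI) auto
  then have "col E j = 0\<^sub>v n" using zero[OF unit_vec_carrier] by metis
  then have "col E j $ i = 0" using ij by simp
  then show "E $$ (i, j) = (0\<^sub>m n n :: 'f mat) $$ (i, j)" using E ij by simp
qed (use E in auto)

text \<open>The image of \<open>\<Sum>k\<in>K. \<rho>(k)\<close> is \<open>H\<close>-invariant since \<open>K\<close> is normal, and \<open>K\<close> fixes it pointwise. If
  it were the whole space, \<open>K\<close> would act trivially, contradicting faithfulness; so irreducibility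
  makes it zero.\<close>

lemma normal_subgroup_sum_zero:
  fixes \<rho> :: "'g \<Rightarrow> 'f::field mat"
  assumes "group G" "finite (carrier G)" "subgroup H G"
    and irr: "irreducible_rep (G\<lparr>carrier := H\<rparr>) m \<rho>" and faithful: "faithful_rep (G\<lparr>carrier := H\<rparr>) m \<rho>"
    and K: "subgroup K G" "K \<subseteq> H" "\<And>h k. h \<in> H \<Longrightarrow> k \<in> K \<Longrightarrow> h \<otimes>\<^bsub>G\<^esub> k \<otimes>\<^bsub>G\<^esub> inv\<^bsub>G\<^esub> h \<in> K" "K \<noteq> {\<one>\<^bsub>G\<^esub>}"
  shows "weighted_sum m m K (\<lambda>_. 1) \<rho> = 0\<^sub>m m m"
proof -
  interpret group G by fact
  interpret H: subgroup H G by fact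
  interpret K: subgroup K G by fact
  have lin: "linear_rep (G\<lparr>carrier := H\<rparr>) m \<rho>" using faithful unfolding faithful_rep_def by simp
  have c: "\<rho> h \<in> carrier_mat m m" if "h \<in> H" for h using linear_rep_carrier[OF lin] that by simp
  have mult: "\<rho> (g \<otimes>\<^bsub>G\<^esub> h) = \<rho> g * \<rho> h" if "g \<in> H" "h \<in> H" for g h
    using linear_rep_mult[OF lin] that by simp
  have one: "\<rho> \<one>\<^bsub>G\<^esub> = 1\<^sub>m m"
    using linear_rep_one[OF H.subgroup_is_group[OF assms(1)] lin] by simp
  have inj: "inj_on \<rho> H" using faithful unfolding faithful_rep_def by simp
  define E where "E = weighted_sum m m K (\<lambda>_. 1) \<rho>"
  have E: "E \<in> carrier_mat m m" by (simp add: E_def)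
  have cK: "\<rho> k \<in> carrier_mat m m" if "k \<in> K" for k using c K(2) that by blast
  let ?W = "(*\<^sub>v) E ` carrier_vec m"
  have comm: "\<rho> h * E = E * \<rho> h" if h: "h \<in> H" for h
  proof -
    have bij: "bij_betw (\<lambda>k. h \<otimes>\<^bsub>G\<^esub> k \<otimes>\<^bsub>G\<^esub> inv\<^bsub>G\<^esub> h) K K"
      by (rule conjugation_bij[OF K(1)]) (use K(3)[OF h] K(3)[of "inv\<^bsub>G\<^esub> h"] h in auto)
    have "E * \<rho> h = weighted_sum m m K (\<lambda>_. 1) (\<lambda>k. \<rho> (h \<otimes>\<^bsub>G\<^esub> k \<otimes>\<^bsub>G\<^esub> inv\<^bsub>G\<^esub> h)) * \<rho> h"
      unfolding E_def using weighted_sum_reindex[OF bij, of m m "\<lambda>_. 1" \<rho>] by simp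
    also have "\<dots> = weighted_sum m m K (\<lambda>_. 1) (\<lambda>k. \<rho> (h \<otimes>\<^bsub>G\<^esub> k \<otimes>\<^bsub>G\<^esub> inv\<^bsub>G\<^esub> h) * \<rho> h)"
      by (rule weighted_sum_mult[OF c[OF h] cK]) (rule K(3)[OF h])
    also have "\<dots> = weighted_sum m m K (\<lambda>_. 1) (\<lambda>k. \<rho> h * \<rho> k)"
    proof (rule weighted_sum_cong[OF refl refl])
      fix k assume k: "k \<in> K"
      have kH: "k \<in> H" using k K(2) by blast
      have "h \<otimes>\<^bsub>G\<^esub> k \<otimes>\<^bsub>G\<^esub> inv\<^bsub>G\<^esub> h \<otimes>\<^bsub>G\<^esub> h = h \<otimes>\<^bsub>G\<^esub> k" using h kH by (simp add: m_assoc)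
      moreover have "h \<otimes>\<^bsub>G\<^esub> k \<otimes>\<^bsub>G\<^esub> inv\<^bsub>G\<^esub> h \<in> H" using h kH by simp
      ultimately show "\<rho> (h \<otimes>\<^bsub>G\<^esub> k \<otimes>\<^bsub>G\<^esub> inv\<^bsub>G\<^esub> h) * \<rho> h = \<rho> h * \<rho> k"
        using mult[of "h \<otimes>\<^bsub>G\<^esub> k \<otimes>\<^bsub>G\<^esub> inv\<^bsub>G\<^esub> h" h] mult[OF h kH] h by metis
    qed
    also have "\<dots> = \<rho> h * E"
      unfolding E_def by (rule mult_weighted_sum[symmetric, OF c[OF h] cK])
    finally show ?thesis by simp
  qed
  have "\<rho> h *\<^sub>v w \<in> ?W" if h: "h \<in> H" and w: "w \<in> ?W" for h w
  proof -
    obtain v where v: "v \<in> carrier_vec m" "w = E *\<^sub>v v" using w by blast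
    have "\<rho> h *\<^sub>v w = (\<rho> h * E) *\<^sub>v v" unfolding v(2) by (rule assoc_mult_mat_vec[symmetric, OF c[OF h] E v(1)])
    also have "\<dots> = E *\<^sub>v (\<rho> h *\<^sub>v v)" unfolding comm[OF h] by (rule assoc_mult_mat_vec[OF E c[OF h] v(1)])
    finally show ?thesis using c[OF h] v(1) by simp
  qed
  then have "?W = {0\<^sub>v m} \<or> ?W = carrier_vec m"
    using irr image_subspace[OF E] unfolding irreducible_rep_def irreducible_mats_def by auto
  moreover have "?W \<noteq> carrier_vec m"
  proof
    assume full: "?W = carrier_vec m"
    obtain k where k: "k \<in> K" "k \<noteq> \<one>\<^bsub>G\<^esub>" using K(4) K.one_closed by blast
    have bij: "bij_betw (\<lambda>l. k \<otimes>\<^bsub>G\<^esub> l) K K"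
      by (rule bij_betwI[where g="\<lambda>h. inv\<^bsub>G\<^esub> k \<otimes>\<^bsub>G\<^esub> h"]) (use k(1) in \<open>auto simp: m_assoc[symmetric]\<close>)
    have "\<rho> k * E = weighted_sum m m K (\<lambda>_. 1) (\<lambda>l. \<rho> k * \<rho> l)"
      unfolding E_def by (rule mult_weighted_sum[OF cK[OF k(1)] cK])
    also have "\<dots> = weighted_sum m m K (\<lambda>_. 1) (\<lambda>l. \<rho> (k \<otimes>\<^bsub>G\<^esub> l))"
      by (rule weighted_sum_cong[OF refl refl]) (rule mult[symmetric, OF subsetD[OF K(2) k(1)] subsetD[OF K(2)]])
    also have "\<dots> = E" unfolding E_def using weighted_sum_reindex[OF bij, of m m "\<lambda>_. 1" \<rho>] by simp
    finally have kE: "\<rho> k * E = E" .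
    have "(\<rho> k - 1\<^sub>m m) *\<^sub>v w = 0\<^sub>v m" if w: "w \<in> carrier_vec m" for w
    proof -
      obtain v where v: "v \<in> carrier_vec m" "w = E *\<^sub>v v" using w full by blast
      have "\<rho> k *\<^sub>v w = w"
        unfolding v(2) assoc_mult_mat_vec[symmetric, OF cK[OF k(1)] E v(1)] kE by (rule refl)
      then show ?thesis
        using minus_mult_distrib_mat_vec[OF cK[OF k(1)] one_carrier_mat w] w by simp
    qed
    then have zero: "\<rho> k - 1\<^sub>m m = 0\<^sub>m m m"
      by (rule mat_eq_zero_if_mult_vec_zero[OF minus_carrier_mat[OF one_carrier_mat]])
    have "\<rho> k = 1\<^sub>m m"
    proof (rule eq_matI)
      fix i j assume "i < dim_row (1\<^sub>m m :: 'f mat)" "j < dim_col (1\<^sub>m m :: 'f mat)"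
      moreover have "(\<rho> k - 1\<^sub>m m) $$ (i, j) = (0\<^sub>m m m :: 'f mat) $$ (i, j)" using zero by simp
      ultimately show "\<rho> k $$ (i, j) = (1\<^sub>m m :: 'f mat) $$ (i, j)"
        by (simp only: index_minus_mat index_one_mat index_zero_mat) simp
    qed (use cK[OF k(1)] in auto)
    then show False using inj k K(2) one unfolding inj_on_def by (metis H.one_closed subsetD)
  qed
  ultimately have W0: "?W = {0\<^sub>v m}" by - (erule disjE, assumption, erule (1) notE)
  have "E *\<^sub>v v = 0\<^sub>v m" if "v \<in> carrier_vec m" for v
    using imageI[OF that, of "(*\<^sub>v) E"] unfolding W0 by simp
  then show ?thesis using mat_eq_zero_if_mult_vec_zero[OF E] unfolding E_def by simp
qed

text \<open>The inverse makes \<open>\<Sum>k\<in>K. b(x k)\<close> an entry of \<open>(\<Sum>k\<in>K. \<rho>(k)) \<rho>(x)\<^sup>-\<^sup>1\<close>; a diagonal entry has the value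
  1 at the identity.\<close>

lemma faithful_weight_matrix_coefficient:
  fixes \<rho> :: "'g \<Rightarrow> 'f::field mat"
  assumes "group G" "finite (carrier G)" "subgroup H G"
    and irr: "irreducible_rep (G\<lparr>carrier := H\<rparr>) m \<rho>" and faithful: "faithful_rep (G\<lparr>carrier := H\<rparr>) m \<rho>"
  shows "faithful_weight G H (\<lambda>x. if x \<in> H then \<rho> (inv\<^bsub>G\<^esub> x) $$ (0, 0) else 0)"
proof -
  interpret group G by fact
  interpret H: subgroup H G by fact
  have lin: "linear_rep (G\<lparr>carrier := H\<rparr>) m \<rho>" using faithful unfolding faithful_rep_def by simp
  have c: "\<rho> h \<in> carrier_mat m m" if "h \<in> H" for h using linear_rep_carrier[OF lin] that by simp
  have mult: "\<rho> (g \<otimes>\<^bsub>G\<^esub> h) = \<rho> g * \<rho> h" if "g \<in> H" "h \<in> H" for g h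
    using linear_rep_mult[OF lin] that by simp
  have one: "\<rho> \<one>\<^bsub>G\<^esub> = 1\<^sub>m m"
    using linear_rep_one[OF H.subgroup_is_group[OF assms(1)] lin] by simp
  have m: "0 < m" using irr unfolding irreducible_rep_def irreducible_mats_def by simp
  have "(\<Sum>k\<in>K. if x \<otimes>\<^bsub>G\<^esub> k \<in> H then \<rho> (inv\<^bsub>G\<^esub> (x \<otimes>\<^bsub>G\<^esub> k)) $$ (0, 0) else 0) = 0"
    if K: "subgroup K G" "K \<subseteq> H" "\<forall>h\<in>H. \<forall>k\<in>K. h \<otimes>\<^bsub>G\<^esub> k \<otimes>\<^bsub>G\<^esub> inv\<^bsub>G\<^esub> h \<in> K" "K \<noteq> {\<one>\<^bsub>G\<^esub>}" and x: "x \<in> H" for K x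
  proof -
    interpret K: subgroup K G by fact
    have cK: "\<rho> k \<in> carrier_mat m m" if "k \<in> K" for k using c K(2) that by blast
    have xinv: "inv\<^bsub>G\<^esub> x \<in> H" using x by simp
    have zero: "weighted_sum m m K (\<lambda>_. 1) \<rho> = 0\<^sub>m m m"
      by (rule normal_subgroup_sum_zero[OF assms(1-5) K(1,2) _ K(4)]) (use K(3) in blast)
    have "(\<Sum>k\<in>K. if x \<otimes>\<^bsub>G\<^esub> k \<in> H then \<rho> (inv\<^bsub>G\<^esub> (x \<otimes>\<^bsub>G\<^esub> k)) $$ (0, 0) else 0)
        = (\<Sum>k\<in>K. (\<rho> (inv\<^bsub>G\<^esub> k) * \<rho> (inv\<^bsub>G\<^esub> x)) $$ (0, 0))"
    proof (rule sum.cong[OF refl])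
      fix k assume "k \<in> K"
      then have k: "k \<in> H" using K(2) by blast
      have "inv\<^bsub>G\<^esub> (x \<otimes>\<^bsub>G\<^esub> k) = inv\<^bsub>G\<^esub> k \<otimes>\<^bsub>G\<^esub> inv\<^bsub>G\<^esub> x" using x k by (simp add: inv_mult_group)
      then show "(if x \<otimes>\<^bsub>G\<^esub> k \<in> H then \<rho> (inv\<^bsub>G\<^esub> (x \<otimes>\<^bsub>G\<^esub> k)) $$ (0, 0) else 0) = (\<rho> (inv\<^bsub>G\<^esub> k) * \<rho> (inv\<^bsub>G\<^esub> x)) $$ (0, 0)"
        using x k mult[of "inv\<^bsub>G\<^esub> k" "inv\<^bsub>G\<^esub> x"] by simp
    qed
    also have "\<dots> = (\<Sum>k\<in>K. (\<rho> k * \<rho> (inv\<^bsub>G\<^esub> x)) $$ (0, 0))"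
      by (rule sum.reindex_bij_betw[OF inverse_bij_on_subgroup[OF K(1)]])
    also have "\<dots> = weighted_sum m m K (\<lambda>_. 1) (\<lambda>k. \<rho> k * \<rho> (inv\<^bsub>G\<^esub> x)) $$ (0, 0)"
      using m by (simp add: weighted_sum_def)
    also have "\<dots> = (weighted_sum m m K (\<lambda>_. 1) \<rho> * \<rho> (inv\<^bsub>G\<^esub> x)) $$ (0, 0)"
      using weighted_sum_mult[OF c[OF xinv], of K \<rho> m "\<lambda>_. 1"] cK by simp
    also have "\<dots> = 0"
      unfolding zero left_mult_zero_mat[OF c[OF xinv]] using m by simp
    finally show ?thesis .
  qed
  then show ?thesis
    unfolding faithful_weight_def using one m by auto
qed

text \<open>With \<open>K\<close> the part of the kernel in \<open>H\<close>, translating the summation by \<open>k \<in> K\<close> does not change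
  \<open>\<sigma>(b)\<close>. Adding up over \<open>K\<close> gives \<open>card K\<close> times \<open>\<sigma>(b)\<close> on one side and zero on the other, and
  \<open>card K\<close> divides the order of \<open>G\<close>, so it is nonzero in the field.\<close>

lemma faithful_weight_kernel:
  fixes b :: "'g \<Rightarrow> 'f::field"
  assumes "group G" "finite (carrier G)" and card: "of_nat (card (carrier G)) \<noteq> (0::'f)" and "subgroup H G"
    and b: "faithful_weight G H b"
    and \<sigma>: "linear_rep G n \<sigma>" and nz: "weighted_sum n n (carrier G) b \<sigma> \<noteq> 0\<^sub>m n n"
    and h: "h \<in> H" "\<sigma> h = 1\<^sub>m n"
  shows "h = \<one>\<^bsub>G\<^esub>"
proof (rule ccontr)
  assume "h \<noteq> \<one>\<^bsub>G\<^esub>"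
  interpret group G by fact
  interpret H: subgroup H G by fact
  note \<sigma>c = linear_rep_carrier[OF \<sigma>] and \<sigma>m = linear_rep_mult[OF \<sigma>] and \<sigma>1 = linear_rep_one[OF assms(1) \<sigma>]
  define K where "K = {k \<in> H. \<sigma> k = 1\<^sub>m n}"
  have KH: "K \<subseteq> H" unfolding K_def by blast
  have KG: "K \<subseteq> carrier G" using KH H.subset by blast
  have K: "subgroup K G"
  proof (rule subgroupI[OF KG])
    show "K \<noteq> {}" using \<sigma>1 H.one_closed unfolding K_def by blast
    fix k assume k: "k \<in> K"
    then have kG: "k \<in> carrier G" using KG by blast
    have "\<sigma> k * \<sigma> (inv\<^bsub>G\<^esub> k) = 1\<^sub>m n" using \<sigma>m[OF kG inv_closed[OF kG]] kG \<sigma>1 by simp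
    moreover have "1\<^sub>m n * \<sigma> (inv\<^bsub>G\<^esub> k) = \<sigma> (inv\<^bsub>G\<^esub> k)" by (rule left_mult_one_mat[OF \<sigma>c[OF inv_closed[OF kG]]])
    ultimately have "\<sigma> (inv\<^bsub>G\<^esub> k) = 1\<^sub>m n" using k unfolding K_def by simp
    then show "inv\<^bsub>G\<^esub> k \<in> K" using k unfolding K_def by simp
    fix l assume l: "l \<in> K"
    have lG: "l \<in> carrier G" using l KG by blast
    have "\<sigma> (k \<otimes>\<^bsub>G\<^esub> l) = 1\<^sub>m n" using \<sigma>m[OF kG lG] k l unfolding K_def by simp
    then show "k \<otimes>\<^bsub>G\<^esub> l \<in> K" using k l unfolding K_def by simp
  qed
  have Knorm: "\<forall>x\<in>H. \<forall>k\<in>K. x \<otimes>\<^bsub>G\<^esub> k \<otimes>\<^bsub>G\<^esub> inv\<^bsub>G\<^esub> x \<in> K"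
  proof (intro ballI)
    fix x k assume x: "x \<in> H" and k: "k \<in> K"
    have xG: "x \<in> carrier G" and kG: "k \<in> carrier G" using x k KG by auto
    have k1: "\<sigma> k = 1\<^sub>m n" using k unfolding K_def by simp
    have "\<sigma> (x \<otimes>\<^bsub>G\<^esub> k \<otimes>\<^bsub>G\<^esub> inv\<^bsub>G\<^esub> x) = \<sigma> x * \<sigma> k * \<sigma> (inv\<^bsub>G\<^esub> x)"
      using \<sigma>m[OF m_closed[OF xG kG] inv_closed[OF xG]] \<sigma>m[OF xG kG] by simp
    also have "\<dots> = \<sigma> x * \<sigma> (inv\<^bsub>G\<^esub> x)" unfolding k1 right_mult_one_mat[OF \<sigma>c[OF xG]] by (rule refl)
    also have "\<dots> = 1\<^sub>m n" using \<sigma>m[OF xG inv_closed[OF xG]] xG \<sigma>1 by simp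
    finally show "x \<otimes>\<^bsub>G\<^esub> k \<otimes>\<^bsub>G\<^esub> inv\<^bsub>G\<^esub> x \<in> K" using x k unfolding K_def by simp
  qed
  have "K \<noteq> {\<one>\<^bsub>G\<^esub>}" using h \<open>h \<noteq> \<one>\<^bsub>G\<^esub>\<close> unfolding K_def by blast
  with b K KH Knorm have sumH: "(\<Sum>k\<in>K. b (x \<otimes>\<^bsub>G\<^esub> k)) = 0" if "x \<in> H" for x
    using that unfolding faithful_weight_def by blast
  have sum0: "(\<Sum>k\<in>K. b (x \<otimes>\<^bsub>G\<^esub> k)) = 0" if x: "x \<in> carrier G" for x
  proof (cases "x \<in> H")
    case False
    have "x \<otimes>\<^bsub>G\<^esub> k \<notin> H" if k: "k \<in> K" for k
    proof
      assume "x \<otimes>\<^bsub>G\<^esub> k \<in> H"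
      then have "x \<otimes>\<^bsub>G\<^esub> k \<otimes>\<^bsub>G\<^esub> inv\<^bsub>G\<^esub> k \<in> H" using k KH by blast
      moreover have "x \<otimes>\<^bsub>G\<^esub> k \<otimes>\<^bsub>G\<^esub> inv\<^bsub>G\<^esub> k = x" using x k KG by (simp add: m_assoc subset_iff)
      ultimately show False using False by simp
    qed
    then show ?thesis using b unfolding faithful_weight_def by (intro sum.neutral) blast
  qed (rule sumH)
  have "weighted_sum n n (carrier G) b \<sigma> = 0\<^sub>m n n"
  proof (rule eq_matI)
    fix i j assume "i < dim_row (0\<^sub>m n n :: 'f mat)" "j < dim_col (0\<^sub>m n n :: 'f mat)"
    then have ij: "i < n" "j < n" by auto
    let ?s = "\<Sum>g\<in>carrier G. b g * \<sigma> g $$ (i, j)"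
    have "of_nat (card K) * ?s = (\<Sum>k\<in>K. ?s)" by simp
    also have "\<dots> = (\<Sum>k\<in>K. \<Sum>g\<in>carrier G. b (g \<otimes>\<^bsub>G\<^esub> k) * \<sigma> g $$ (i, j))"
    proof (rule sum.cong[OF refl])
      fix k assume k: "k \<in> K"
      then have kG: "k \<in> carrier G" and k1: "\<sigma> k = 1\<^sub>m n" using KG unfolding K_def by auto
      have bij: "bij_betw (\<lambda>g. g \<otimes>\<^bsub>G\<^esub> k) (carrier G) (carrier G)"
        by (rule bij_betwI[where g="\<lambda>g. g \<otimes>\<^bsub>G\<^esub> inv\<^bsub>G\<^esub> k"]) (use kG in \<open>auto simp: m_assoc\<close>)
      have "?s = (\<Sum>g\<in>carrier G. b (g \<otimes>\<^bsub>G\<^esub> k) * \<sigma> (g \<otimes>\<^bsub>G\<^esub> k) $$ (i, j))"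
        by (rule sum.reindex_bij_betw[OF bij, symmetric])
      also have "\<dots> = (\<Sum>g\<in>carrier G. b (g \<otimes>\<^bsub>G\<^esub> k) * \<sigma> g $$ (i, j))"
        by (rule sum.cong[OF refl]) (simp only: \<sigma>m[OF _ kG] k1 right_mult_one_mat[OF \<sigma>c])
      finally show "?s = (\<Sum>g\<in>carrier G. b (g \<otimes>\<^bsub>G\<^esub> k) * \<sigma> g $$ (i, j))" .
    qed
    also have "\<dots> = (\<Sum>g\<in>carrier G. (\<Sum>k\<in>K. b (g \<otimes>\<^bsub>G\<^esub> k)) * \<sigma> g $$ (i, j))"
      unfolding sum_distrib_right by (rule sum.swap)
    also have "\<dots> = 0" using sum0 by simp
    finally have "of_nat (card K) * ?s = 0" .
    moreover have "of_nat (card K) \<noteq> (0::'f)"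
    proof
      assume "of_nat (card K) = (0::'f)"
      then have "of_nat (card (rcosets\<^bsub>G\<^esub> K) * card K) = (0::'f)" by simp
      then show False using lagrange[OF K] card unfolding Coset.order_def by simp
    qed
    ultimately show "weighted_sum n n (carrier G) b \<sigma> $$ (i, j) = (0\<^sub>m n n :: 'f mat) $$ (i, j)"
      using ij by (simp add: weighted_sum_def)
  qed (auto simp: weighted_sum_def)
  then show False using nz by contradiction
qed

section \<open>Multiplication by factors 1 - a\<close>

text \<open>The product \<open>(1 - a) f\<close> in the group algebra.\<close>

definition twist :: "('g, 'b) monoid_scheme \<Rightarrow> 'g \<Rightarrow> ('g \<Rightarrow> 'f::field) \<Rightarrow> 'g \<Rightarrow> 'f" where
  "twist G a f x = f x - f (inv\<^bsub>G\<^esub> a \<otimes>\<^bsub>G\<^esub> x)"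

lemma weighted_sum_twist:
  fixes f :: "'g \<Rightarrow> 'f::field"
  assumes "group G" "linear_rep G n \<sigma>" "a \<in> carrier G"
  shows "weighted_sum n n (carrier G) (twist G a f) \<sigma>
    = weighted_sum n n (carrier G) f \<sigma> - \<sigma> a * weighted_sum n n (carrier G) f \<sigma>"
proof -
  interpret group G by fact
  note \<sigma>c = linear_rep_carrier[OF assms(2)] and \<sigma>m = linear_rep_mult[OF assms(2)]
  have cancel: "inv\<^bsub>G\<^esub> a \<otimes>\<^bsub>G\<^esub> (a \<otimes>\<^bsub>G\<^esub> x) = x" if "x \<in> carrier G" for x
    using that assms(3) by (simp add: m_assoc[symmetric])
  have "\<sigma> a * weighted_sum n n (carrier G) f \<sigma> = weighted_sum n n (carrier G) f (\<lambda>x. \<sigma> a * \<sigma> x)"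
    by (rule mult_weighted_sum[OF \<sigma>c[OF assms(3)] \<sigma>c])
  also have "\<dots> = weighted_sum n n (carrier G) (\<lambda>x. f (inv\<^bsub>G\<^esub> a \<otimes>\<^bsub>G\<^esub> (a \<otimes>\<^bsub>G\<^esub> x))) (\<lambda>x. \<sigma> (a \<otimes>\<^bsub>G\<^esub> x))"
    by (rule weighted_sum_cong) (simp_all add: cancel \<sigma>m[OF assms(3)])
  also have "\<dots> = weighted_sum n n (carrier G) (\<lambda>x. f (inv\<^bsub>G\<^esub> a \<otimes>\<^bsub>G\<^esub> x)) \<sigma>"
    by (rule weighted_sum_reindex[OF left_translation_bij[OF assms(1,3)], symmetric])
  finally have shifted: "\<sigma> a * weighted_sum n n (carrier G) f \<sigma>
      = weighted_sum n n (carrier G) (\<lambda>x. f (inv\<^bsub>G\<^esub> a \<otimes>\<^bsub>G\<^esub> x)) \<sigma>" .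
  show ?thesis
    unfolding shifted
    by (rule eq_matI) (simp_all add: weighted_sum_def twist_def left_diff_distrib sum_subtractf)
qed

lemma weighted_sum_twist_list:
  fixes f :: "'g \<Rightarrow> 'f::field"
  assumes "group G" "linear_rep G n \<sigma>" "set as \<subseteq> carrier G"
    and "weighted_sum n n (carrier G) (foldr (twist G) as f) \<sigma> \<noteq> 0\<^sub>m n n"
  shows "weighted_sum n n (carrier G) f \<sigma> \<noteq> 0\<^sub>m n n \<and> (\<forall>a\<in>set as. \<sigma> a \<noteq> 1\<^sub>m n)"
  using assms(3,4)
proof (induction as)
  case Nil
  then show ?case by simp
next
  case (Cons a as)
  let ?S = "weighted_sum n n (carrier G) (foldr (twist G) as f) \<sigma>"
  have a: "a \<in> carrier G" using Cons.prems(1) by simp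
  have S: "?S \<in> carrier_mat n n" by simp
  have nz: "?S - \<sigma> a * ?S \<noteq> 0\<^sub>m n n"
    using Cons.prems(2) weighted_sum_twist[OF assms(1,2) a, of "foldr (twist G) as f"] by simp
  have "?S \<noteq> 0\<^sub>m n n"
  proof
    assume z: "?S = 0\<^sub>m n n"
    show False using nz right_mult_zero_mat[OF linear_rep_carrier[OF assms(2) a]] unfolding z by simp
  qed
  moreover have "\<sigma> a \<noteq> 1\<^sub>m n"
  proof
    assume z: "\<sigma> a = 1\<^sub>m n"
    show False using nz minus_r_inv_mat[OF S] unfolding z left_mult_one_mat[OF S] by simp
  qed
  ultimately show ?case using Cons.IH Cons.prems(1) by simp
qed

definition (in monoid) mult_list :: "'a list \<Rightarrow> 'a" where
  "mult_list as = foldr (\<otimes>) as \<one>"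

lemma (in monoid) mult_list_simps [simp]:
  "mult_list [] = \<one>" "mult_list (a # as) = a \<otimes> mult_list as"
  by (simp_all add: mult_list_def)

lemma (in monoid) mult_list_closed [simp]: "set as \<subseteq> carrier G \<Longrightarrow> mult_list as \<in> carrier G"
  by (induction as) auto

text \<open>The expanded product \<open>(1 - a\<^sub>1) \<cdots> (1 - a\<^sub>k) f\<close> is supported on the cosets \<open>c H\<close> of the ordered
  subproducts \<open>c\<close>. Only the empty subproduct contributes to the coset \<open>H\<close>.\<close>

lemma twist_list_one:
  fixes f :: "'g \<Rightarrow> 'f::field"
  assumes "group G" "subgroup H G" and f: "\<And>x. x \<notin> H \<Longrightarrow> f x = 0"
    and as: "set as \<subseteq> carrier G"
    and avoid: "\<And>cs. cs \<in> set (subseqs as) \<Longrightarrow> cs \<noteq> [] \<Longrightarrow> monoid.mult_list G cs \<notin> H"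
  shows "foldr (twist G) as f \<one>\<^bsub>G\<^esub> = f \<one>\<^bsub>G\<^esub>"
proof -
  interpret group G by fact
  interpret H: subgroup H G by fact
  have supp: "\<exists>cs\<in>set (subseqs as). \<exists>h\<in>H. x = mult_list cs \<otimes>\<^bsub>G\<^esub> h"
    if "set as \<subseteq> carrier G" "x \<in> carrier G" "foldr (twist G) as f x \<noteq> 0" for as x
    using that
  proof (induction as arbitrary: x)
    case Nil
    then have "x \<in> H" using f by auto
    then show ?case by auto
  next
    case (Cons a as)
    have a: "a \<in> carrier G" and as: "set as \<subseteq> carrier G" using Cons.prems by auto
    let ?F = "foldr (twist G) as f"
    have "?F x - ?F (inv\<^bsub>G\<^esub> a \<otimes>\<^bsub>G\<^esub> x) \<noteq> 0" using Cons.prems(3) by (simp add: twist_def[of G a "foldr (twist G) as f"])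
    then consider "?F x \<noteq> 0" | "?F (inv\<^bsub>G\<^esub> a \<otimes>\<^bsub>G\<^esub> x) \<noteq> 0" by fastforce
    then show ?case
    proof cases
      case 1
      then obtain cs h where "cs \<in> set (subseqs as)" "h \<in> H" "x = mult_list cs \<otimes>\<^bsub>G\<^esub> h"
        using Cons.IH[OF as Cons.prems(2)] by blast
      then show ?thesis by (auto simp: Let_def)
    next
      case 2
      then obtain cs h where cs: "cs \<in> set (subseqs as)" "h \<in> H" "inv\<^bsub>G\<^esub> a \<otimes>\<^bsub>G\<^esub> x = mult_list cs \<otimes>\<^bsub>G\<^esub> h"
        using Cons.IH[OF as, of "inv\<^bsub>G\<^esub> a \<otimes>\<^bsub>G\<^esub> x"] a Cons.prems(2) by auto
      have "set cs \<subseteq> carrier G" using cs(1) as subseqs_powset[of as] by auto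
      then have "x = mult_list (a # cs) \<otimes>\<^bsub>G\<^esub> h"
        using cs(2,3) a Cons.prems(2) by (simp add: m_assoc inv_solve_left')
      moreover have "a # cs \<in> set (subseqs (a # as))" using cs(1) by (auto simp: Let_def)
      ultimately show ?thesis using cs(2) by blast
    qed
  qed
  show ?thesis using as avoid
  proof (induction as)
    case Nil
    then show ?case by simp
  next
    case (Cons a as)
    have a: "a \<in> carrier G" and as: "set as \<subseteq> carrier G" using Cons.prems by auto
    let ?F = "foldr (twist G) as f"
    have "?F (inv\<^bsub>G\<^esub> a) = 0"
    proof (rule ccontr)
      assume "?F (inv\<^bsub>G\<^esub> a) \<noteq> 0"
      then obtain cs h where cs: "cs \<in> set (subseqs as)" "h \<in> H" "inv\<^bsub>G\<^esub> a = mult_list cs \<otimes>\<^bsub>G\<^esub> h"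
        using supp[OF as, of "inv\<^bsub>G\<^esub> a"] a by auto
      have csc: "set cs \<subseteq> carrier G" using cs(1) as subseqs_powset[of as] by auto
      have "mult_list (a # cs) \<otimes>\<^bsub>G\<^esub> h = a \<otimes>\<^bsub>G\<^esub> inv\<^bsub>G\<^esub> a"
        using a csc cs(2,3) by (simp add: m_assoc)
      then have "mult_list (a # cs) \<otimes>\<^bsub>G\<^esub> h = \<one>\<^bsub>G\<^esub>" using a by simp
      then have "mult_list (a # cs) = inv\<^bsub>G\<^esub> h"
        using a csc cs(2) by (intro inv_equality[symmetric]) auto
      then have "mult_list (a # cs) \<in> H" using cs(2) by simp
      moreover have "a # cs \<in> set (subseqs (a # as))" using cs(1) by (auto simp: Let_def)
      ultimately show False using Cons.prems(2) by blast
    qed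
    moreover have "?F \<one>\<^bsub>G\<^esub> = f \<one>\<^bsub>G\<^esub>"
      by (rule Cons.IH[OF as]) (use Cons.prems(2) in \<open>auto simp: Let_def\<close>)
    ultimately show ?case using a by (simp add: twist_def[of G a "foldr (twist G) as f"])
  qed
qed

section \<open>Elements that are central modulo a normal subgroup\<close>

context group begin

text \<open>For normal \<open>L\<close> this is the preimage of the centre of \<open>G/L\<close>.\<close>

definition central_mod :: "'a set \<Rightarrow> 'a set" where
  "central_mod L = {y \<in> carrier G. \<forall>g\<in>carrier G. y \<otimes> g \<otimes> inv y \<otimes> inv g \<in> L}"

lemma commute_iff_commutator_one:
  assumes "y \<in> carrier G" "g \<in> carrier G"
  shows "y \<otimes> g \<otimes> inv y \<otimes> inv g = \<one> \<longleftrightarrow> y \<otimes> g = g \<otimes> y"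
proof -
  have "y \<otimes> g \<otimes> inv y \<otimes> inv g = (y \<otimes> g) \<otimes> inv (g \<otimes> y)"
    using assms by (simp add: m_assoc inv_mult_group)
  then show ?thesis using inv_solve_right'[of \<one> "y \<otimes> g" "g \<otimes> y"] assms by simp
qed

lemma central_mod_one: "central_mod {\<one>} = group_center G"
  unfolding central_mod_def group_center_def using commute_iff_commutator_one by auto

lemma central_mod_pow:
  assumes L: "L \<lhd> G" and y: "y \<in> central_mod L"
  shows "y [^] (k::nat) \<in> central_mod L"
proof (induction k)
  case 0
  interpret L: normal L G by fact
  show ?case by (simp add: central_mod_def)
next
  case (Suc k)
  interpret L: normal L G by fact
  let ?z = "y [^] k"
  have yc: "y \<in> carrier G" using y unfolding central_mod_def by simp
  have "?z \<otimes> y \<otimes> g \<otimes> inv (?z \<otimes> y) \<otimes> inv g \<in> L" if g: "g \<in> carrier G" for g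
  proof -
    have cancel: "inv g \<otimes> (g \<otimes> w) = w" if "w \<in> carrier G" for w
      using g that by (simp add: m_assoc[symmetric])
    have cancel': "inv ?z \<otimes> (?z \<otimes> w) = w" if "w \<in> carrier G" for w
      using yc that by (simp add: m_assoc[symmetric])
    have "?z \<otimes> y \<otimes> g \<otimes> inv (?z \<otimes> y) \<otimes> inv g
        = (?z \<otimes> (y \<otimes> g \<otimes> inv y \<otimes> inv g) \<otimes> inv ?z) \<otimes> (?z \<otimes> g \<otimes> inv ?z \<otimes> inv g)"
      using g yc by (simp add: m_assoc inv_mult_group cancel cancel' del: nat_pow_Suc)
    moreover have "y \<otimes> g \<otimes> inv y \<otimes> inv g \<in> L" "?z \<otimes> g \<otimes> inv ?z \<otimes> inv g \<in> L"
      using y Suc g unfolding central_mod_def by auto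
    ultimately show ?thesis using L.inv_op_closed2[of ?z] yc by simp
  qed
  then show ?case using yc unfolding central_mod_def by simp
qed

lemma subgroup_nat_pow: "subgroup H G \<Longrightarrow> x \<in> H \<Longrightarrow> x [^] (k::nat) \<in> H"
  by (induction k) (auto simp: subgroup.one_closed subgroup.m_closed)

end

section \<open>Products that avoid a subgroup\<close>

context group begin

text \<open>An element of finite order is a product of powers of itself of prime power order, and these
  cannot all lie in \<open>Z\<close>. The proof splits off one prime power factor of the order at a time.\<close>

lemma prime_power_part_outside:
  assumes Z: "subgroup Z G"
  shows "y \<in> carrier G \<Longrightarrow> y \<notin> Z \<Longrightarrow> 0 < N \<Longrightarrow> y [^] (N::nat) = \<one> \<Longrightarrow>
    \<exists>k p a. prime (p::nat) \<and> y [^] (k::nat) \<notin> Z \<and> (y [^] k) [^] (p ^ a) = \<one>"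
proof (induction N arbitrary: y rule: less_induct)
  case (less N)
  interpret Z: subgroup Z G by fact
  note y = less.prems(1)
  have "N \<noteq> 1" using less.prems Z.one_closed by auto
  then obtain p where p: "prime p" "p dvd N" using prime_factor_nat by blast
  define a where "a = multiplicity p N"
  obtain m where m: "N = p ^ a * m" "\<not> p dvd m"
    using multiplicity_decompose'[of N p] p less.prems(3) unfolding a_def by (auto simp: prime_nat_iff)
  have "a \<noteq> 0" using m p by (metis mult_1 power_0)
  then have pa: "1 < p ^ a" using p(1) prime_gt_1_nat one_less_power by blast
  have m0: "0 < m" "m < N" using m less.prems(3) pa by auto
  consider "y [^] m \<notin> Z" | "y [^] (p ^ a) \<notin> Z" | "y [^] m \<in> Z" "y [^] (p ^ a) \<in> Z" by blast
  then show ?case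
  proof cases
    case 1
    moreover have "(y [^] m) [^] (p ^ a) = \<one>" using less.prems(4) y m(1) by (simp add: nat_pow_pow mult.commute)
    ultimately show ?thesis using p(1) by blast
  next
    case 2
    have "(y [^] (p ^ a)) [^] m = \<one>" using less.prems(4) y m(1) by (simp add: nat_pow_pow)
    then obtain k q c :: nat where "prime q" "(y [^] (p ^ a)) [^] k \<notin> Z" "((y [^] (p ^ a)) [^] k) [^] (q ^ c) = \<one>"
      using less.IH[OF m0(2) _ 2 m0(1)] y by blast
    then have "prime q \<and> y [^] (p ^ a * k) \<notin> Z \<and> (y [^] (p ^ a * k)) [^] (q ^ c) = \<one>"
      using y by (simp add: nat_pow_pow)
    then show ?thesis by blast
  next
    case 3
    have "coprime (p ^ a) m" using prime_imp_coprime[OF p(1) m(2)] by simp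
    then have gcd: "gcd (p ^ a) m = 1" by (rule coprime_imp_gcd_eq_1)
    have "p ^ a \<noteq> 0" using pa by linarith
    from bezout_nat[OF this, of m] obtain u v where uv: "p ^ a * u = m * v + 1" unfolding gcd by blast
    have "y [^] (p ^ a * u) \<in> Z" "y [^] (m * v) \<in> Z"
      unfolding nat_pow_pow[OF y, symmetric] using 3 by (simp_all add: subgroup_nat_pow[OF Z])
    moreover have "y = inv (y [^] (m * v)) \<otimes> y [^] (p ^ a * u)"
      unfolding uv using y by (simp add: nat_pow_mult[symmetric] m_assoc[symmetric])
    ultimately have "y \<in> Z" using Z.m_closed Z.m_inv_closed by metis
    then show ?thesis using less.prems(2) by contradiction
  qed
qed

lemma commute_mult_list:
  assumes "c \<in> carrier G" "\<And>x. x \<in> set xs \<Longrightarrow> x \<in> carrier G" "\<And>x. x \<in> set xs \<Longrightarrow> c \<otimes> x = x \<otimes> c"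
  shows "c \<otimes> mult_list xs = mult_list xs \<otimes> c"
  using assms(2,3)
proof (induction xs)
  case Nil
  then show ?case using assms(1) by simp
next
  case (Cons x xs)
  have "set xs \<subseteq> carrier G" using Cons.prems(1) by auto
  then have x: "x \<in> carrier G" and xs: "mult_list xs \<in> carrier G" using Cons.prems(1) by simp_all
  have "c \<otimes> (x \<otimes> mult_list xs) = (c \<otimes> x) \<otimes> mult_list xs"
    using assms(1) x xs by (simp add: m_assoc)
  also have "\<dots> = (x \<otimes> c) \<otimes> mult_list xs" using Cons.prems(2)[of x] by simp
  also have "\<dots> = x \<otimes> (c \<otimes> mult_list xs)" using assms(1) x xs by (simp add: m_assoc)
  also have "\<dots> = x \<otimes> (mult_list xs \<otimes> c)" using Cons by simp
  also have "\<dots> = (x \<otimes> mult_list xs) \<otimes> c" using assms(1) x xs by (simp add: m_assoc)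
  finally show ?case by simp
qed

lemma mult_list_append:
  assumes "set xs \<subseteq> carrier G" "set ys \<subseteq> carrier G"
  shows "mult_list (xs @ ys) = mult_list xs \<otimes> mult_list ys"
  using assms(1) by (induction xs) (use assms(2) in \<open>simp_all add: m_assoc\<close>)

text \<open>Such a product becomes trivial after raising it to a power prime to \<open>p\<close>, so this power removes
  it from a product with an element of \<open>p\<close>-power order while losing nothing of that element.\<close>

lemma mult_list_coprime_torsion:
  assumes "\<And>x. x \<in> set xs \<Longrightarrow> x \<in> carrier G"
    and "\<And>x y. x \<in> set xs \<Longrightarrow> y \<in> set xs \<Longrightarrow> x \<otimes> y = y \<otimes> x"
    and "\<And>x. x \<in> set xs \<Longrightarrow> \<exists>m::nat. coprime m p \<and> x [^] m = \<one>"
  shows "\<exists>m::nat. coprime m p \<and> mult_list xs [^] m = \<one>"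
  using assms
proof (induction xs)
  case Nil
  show ?case by (intro exI[of _ 1]) simp
next
  case (Cons x xs)
  have "set xs \<subseteq> carrier G" using Cons.prems(1) by auto
  then have x: "x \<in> carrier G" and xs: "mult_list xs \<in> carrier G" using Cons.prems(1) by simp_all
  have "\<exists>m::nat. coprime m p \<and> mult_list xs [^] m = \<one>"
    by (rule Cons.IH) (use Cons.prems in auto)
  then obtain m where m: "coprime m p" "mult_list xs [^] m = \<one>" by blast
  obtain l :: nat where l: "coprime l p" "x [^] l = \<one>" using Cons.prems(3)[of x] by auto
  have comm: "x \<otimes> mult_list xs = mult_list xs \<otimes> x"
    by (rule commute_mult_list) (use x Cons.prems in auto)
  have "x [^] (l * m) = \<one>" using l(2) x nat_pow_pow[OF x, of l m] by simp
  moreover have "mult_list xs [^] (l * m) = \<one>"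
    using m(2) nat_pow_pow[OF xs, of m l] by (simp add: mult.commute)
  ultimately have "(x \<otimes> mult_list xs) [^] (l * m) = \<one>"
    using pow_mult_distrib[OF comm x xs, of "l * m"] by simp
  then show ?case using l m by (intro exI[of _ "l * m"]) simp
qed

text \<open>There are two ways to see that a product of the \<open>n L\<close> is not in \<open>H\<close>. If some \<open>y L\<close> fails to
  commute with its own \<open>n L\<close>, it commutes with all other factors and with all of \<open>H\<close>, so it does not
  commute with the product. Otherwise the factors are commuting elements of coprime
  prime power orders, and a suitable power of the product is a nontrivial power of a single factor.\<close>

lemma separated_products_avoid_subgroup:
  assumes H: "subgroup H G"
    and Ls: "distinct Ls" "Ls \<noteq> []"
    and n: "\<And>L. L \<in> set Ls \<Longrightarrow> n L \<in> carrier G" "\<And>L. L \<in> set Ls \<Longrightarrow> n L \<noteq> \<one>"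
    and nH: "\<And>L k. L \<in> set Ls \<Longrightarrow> n L [^] (k::nat) \<in> H \<Longrightarrow> n L [^] k = \<one>"
    and y: "\<And>L. L \<in> set Ls \<Longrightarrow> y L \<in> carrier G" "\<And>L h. L \<in> set Ls \<Longrightarrow> h \<in> H \<Longrightarrow> y L \<otimes> h = h \<otimes> y L"
    and yn: "\<And>L L'. L \<in> set Ls \<Longrightarrow> L' \<in> set Ls \<Longrightarrow> L \<noteq> L' \<Longrightarrow> y L \<otimes> n L' = n L' \<otimes> y L"
    and nn: "\<And>L L'. L \<in> set Ls \<Longrightarrow> L' \<in> set Ls \<Longrightarrow> L \<noteq> L' \<Longrightarrow> n L \<otimes> n L' = n L' \<otimes> n L"
    and p: "\<And>L. L \<in> set Ls \<Longrightarrow> prime (p L :: nat)" "inj_on p (set Ls)"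
    and kind: "\<And>L. L \<in> set Ls \<Longrightarrow> y L \<otimes> n L \<noteq> n L \<otimes> y L \<or> n L [^] (p L ^ a L :: nat) = \<one>"
  shows "mult_list (map n Ls) \<notin> H"
proof
  assume prod: "mult_list (map n Ls) \<in> H"
  interpret H: subgroup H G by fact
  note Hpow = subgroup_nat_pow[OF H.subgroup_axioms]
  show False
  proof (cases "\<exists>L\<in>set Ls. y L \<otimes> n L \<noteq> n L \<otimes> y L")
    case True
    then obtain L where L: "L \<in> set Ls" "y L \<otimes> n L \<noteq> n L \<otimes> y L" by blast
    obtain xs ys where split: "Ls = xs @ L # ys" using L(1) by (meson split_list)
    let ?c = "y L" and ?u = "mult_list (map n xs)" and ?v = "mult_list (map n ys)"
    have c: "?c \<in> carrier G" and nL: "n L \<in> carrier G" using y(1) n(1) L(1) by auto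
    have inc: "set xs \<subseteq> set Ls" "set ys \<subseteq> set Ls" "L \<notin> set xs" "L \<notin> set ys"
      using Ls(1) unfolding split by auto
    have cx: "set (map n xs) \<subseteq> carrier G" "set (map n ys) \<subseteq> carrier G"
      using inc n(1) by auto
    have uc: "?u \<in> carrier G" "?v \<in> carrier G" using cx by simp_all
    have cu: "?c \<otimes> ?u = ?u \<otimes> ?c"
      by (rule commute_mult_list[OF c]) (use cx(1) inc yn[OF L(1)] in auto)
    have cv: "?c \<otimes> ?v = ?v \<otimes> ?c"
      by (rule commute_mult_list[OF c]) (use cx(2) inc yn[OF L(1)] in auto)
    have prod_eq: "mult_list (map n Ls) = ?u \<otimes> (n L \<otimes> ?v)"
      unfolding split using mult_list_append[of "map n xs" "map n (L # ys)"] cx nL by simp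
    have "?u \<otimes> (?c \<otimes> n L) \<otimes> ?v = (?u \<otimes> ?c) \<otimes> (n L \<otimes> ?v)"
      using c nL uc by (simp add: m_assoc)
    also have "\<dots> = ?c \<otimes> (?u \<otimes> (n L \<otimes> ?v))"
      unfolding cu[symmetric] using c nL uc by (simp add: m_assoc)
    also have "\<dots> = (?u \<otimes> (n L \<otimes> ?v)) \<otimes> ?c"
      using y(2)[OF L(1) prod] unfolding prod_eq .
    also have "\<dots> = ?u \<otimes> (n L \<otimes> (?v \<otimes> ?c))" using c nL uc by (simp add: m_assoc)
    also have "\<dots> = ?u \<otimes> (n L \<otimes> ?c) \<otimes> ?v" unfolding cv[symmetric] using c nL uc by (simp add: m_assoc)
    finally have "?c \<otimes> n L = n L \<otimes> ?c" using c nL uc by simp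
    then show False using L(2) by contradiction
  next
    case False
    obtain L ys where split: "Ls = L # ys" using Ls(2) by (cases Ls) auto
    have L: "L \<in> set Ls" "L \<notin> set ys" "set ys \<subseteq> set Ls" using Ls(1) unfolding split by auto
    let ?v = "mult_list (map n ys)"
    have nL: "n L \<in> carrier G" using n(1) L(1) .
    have "set (map n ys) \<subseteq> carrier G" using L(3) n(1) by auto
    then have v: "?v \<in> carrier G" by simp
    have torsion: "n L' [^] (p L' ^ a L') = \<one>" if "L' \<in> set Ls" for L' using False kind[OF that] that by blast
    have "\<exists>m::nat. coprime m (p L) \<and> ?v [^] m = \<one>"
    proof (rule mult_list_coprime_torsion)
      fix x z assume "x \<in> set (map n ys)" "z \<in> set (map n ys)"
      then obtain L1 L2 where "L1 \<in> set Ls" "x = n L1" "L2 \<in> set Ls" "z = n L2" using L(3) by auto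
      then show "x \<otimes> z = z \<otimes> x" using nn by (cases "L1 = L2") auto
    next
      fix x assume "x \<in> set (map n ys)"
      then obtain L1 where L1: "L1 \<in> set ys" "x = n L1" by auto
      then have "p L1 \<noteq> p L" using p(2) L unfolding inj_on_def by (metis subsetD)
      then have "coprime (p L1 ^ a L1) (p L)"
        using primes_coprime[OF p(1) p(1)] L L1(1) by auto
      moreover have "x [^] (p L1 ^ a L1) = \<one>" using torsion L L1 by auto
      ultimately show "\<exists>m::nat. coprime m (p L) \<and> x [^] m = \<one>" by blast
    qed (use L(3) n(1) in auto)
    then obtain m :: nat where m: "coprime m (p L)" "?v [^] m = \<one>" by blast
    have comm: "n L \<otimes> ?v = ?v \<otimes> n L"
      by (rule commute_mult_list[OF nL]) (use L n(1) nn[OF L(1)] in auto)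
    have "(n L \<otimes> ?v) [^] m = n L [^] m"
      using pow_mult_distrib[OF comm nL v, of m] m(2) nL by simp
    moreover have "(n L \<otimes> ?v) [^] m \<in> H" using prod Hpow unfolding split by simp
    ultimately have "n L [^] m = \<one>" using nH[OF L(1)] by simp
    then have "ord (n L) dvd m" using pow_eq_id[OF nL] by simp
    moreover have "ord (n L) dvd p L ^ a L" using pow_eq_id[OF nL] torsion[OF L(1)] by simp
    moreover have "coprime m (p L ^ a L)" using m(1) by simp
    ultimately have "ord (n L) = 1" using coprime_common_divisor_nat by blast
    then show False using n(2)[OF L(1)] nL ord_eq_1[OF nL] by blast
  qed
qed

end

section \<open>The centre of H has cyclic Sylow subgroups\<close>

text \<open>A central element of prime order generates a nontrivial normal subgroup of \<open>H\<close>, over whose cosets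
  \<open>b\<close> sums to zero.\<close>

lemma weight_cyclic_sum:
  fixes b :: "'g \<Rightarrow> 'f::field"
  assumes "group G" "finite (carrier G)" "subgroup H G" "faithful_weight G H b"
    and v: "v \<in> H" "\<And>h. h \<in> H \<Longrightarrow> v \<otimes>\<^bsub>G\<^esub> h = h \<otimes>\<^bsub>G\<^esub> v" "v \<noteq> \<one>\<^bsub>G\<^esub>"
    and p: "prime (p::nat)" "v [^]\<^bsub>G\<^esub> p = \<one>\<^bsub>G\<^esub>" and x: "x \<in> H"
  shows "(\<Sum>i<p. b (x \<otimes>\<^bsub>G\<^esub> v [^]\<^bsub>G\<^esub> i)) = 0"
proof -
  interpret group G by fact
  interpret H: subgroup H G by fact
  note Hpow = subgroup_nat_pow[OF H.subgroup_axioms]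
  have vG: "v \<in> carrier G" using v(1) by simp
  have "ord v dvd p" using pow_eq_id[OF vG] p(2) by simp
  moreover have "ord v \<noteq> 1" using ord_eq_1[OF vG] v(3) by simp
  ultimately have ord: "ord v = p" using p(1) prime_nat_iff by blast
  define K where "K = generate G {v}"
  have K_eq: "K = {v [^]\<^bsub>G\<^esub> k |k. k \<in> (UNIV::nat set)}"
    unfolding K_def by (rule generate_pow_on_finite_carrier[OF assms(2) vG])
  have K_range: "K = (\<lambda>i. v [^]\<^bsub>G\<^esub> i) ` {..<p}"
  proof -
    have "{0..ord v - 1} = {..<p}" using ord prime_gt_0_nat[OF p(1)] by auto
    then show ?thesis unfolding K_eq ord_elems[OF assms(2) vG] by auto
  qed
  have "inj_on (\<lambda>i. v [^]\<^bsub>G\<^esub> i) {0..ord v - 1}" by (rule ord_inj[OF vG])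
  moreover have "{0..ord v - 1} = {..<p}" using ord prime_gt_0_nat[OF p(1)] by auto
  ultimately have bij: "bij_betw (\<lambda>i. v [^]\<^bsub>G\<^esub> i) {..<p} K" unfolding K_range by (simp add: bij_betw_def)
  have K: "subgroup K G" unfolding K_def by (rule generate_is_subgroup) (use vG in simp)
  have KH: "K \<subseteq> H" unfolding K_eq using Hpow[OF v(1)] by auto
  have "\<forall>h\<in>H. \<forall>k\<in>K. h \<otimes>\<^bsub>G\<^esub> k \<otimes>\<^bsub>G\<^esub> inv\<^bsub>G\<^esub> h \<in> K"
  proof (intro ballI)
    fix h k assume h: "h \<in> H" and k: "k \<in> K"
    then obtain i :: nat where i: "k = v [^]\<^bsub>G\<^esub> i" unfolding K_eq by blast
    have hG: "h \<in> carrier G" using h by simp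
    have "v [^]\<^bsub>G\<^esub> i \<otimes>\<^bsub>G\<^esub> h = h \<otimes>\<^bsub>G\<^esub> v [^]\<^bsub>G\<^esub> i"
      by (rule group_commutes_pow[OF v(2)[OF h] vG hG])
    then have "h \<otimes>\<^bsub>G\<^esub> k \<otimes>\<^bsub>G\<^esub> inv\<^bsub>G\<^esub> h = k \<otimes>\<^bsub>G\<^esub> h \<otimes>\<^bsub>G\<^esub> inv\<^bsub>G\<^esub> h" unfolding i by simp
    also have "\<dots> = k" unfolding i using hG vG by (simp add: m_assoc)
    finally show "h \<otimes>\<^bsub>G\<^esub> k \<otimes>\<^bsub>G\<^esub> inv\<^bsub>G\<^esub> h \<in> K" using k by simp
  qed
  moreover have "v \<in> K" unfolding K_def by (rule generate.incl) simp
  then have "K \<noteq> {\<one>\<^bsub>G\<^esub>}" using v(3) by blast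
  ultimately have "(\<Sum>k\<in>K. b (x \<otimes>\<^bsub>G\<^esub> k)) = 0"
    using assms(4) K KH x unfolding faithful_weight_def by blast
  then show ?thesis using sum.reindex_bij_betw[OF bij, of "\<lambda>k. b (x \<otimes>\<^bsub>G\<^esub> k)"] by simp
qed

text \<open>If \<open>u\<close> were not a power of \<open>w\<close>, then all of \<open>u w\<^sup>j\<close> would have order \<open>p\<close>. Sum the values
  \<open>b((u w\<^sup>j)\<^sup>i)\<close> over \<open>i, j < p\<close>: for fixed \<open>j\<close> they run through the group generated by \<open>u w\<^sup>j\<close> and
  give zero, whereas for fixed \<open>i\<close> they run through a coset of the group generated by \<open>w\<close> and give zero
  except for \<open>i = 0\<close>, where they give \<open>p\<close>. Since \<open>p\<close> divides the order of \<open>G\<close>, it is nonzero in the field.\<close>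

lemma central_prime_order_subgroup_unique:
  fixes b :: "'g \<Rightarrow> 'f::field"
  assumes "group G" "finite (carrier G)" and card: "of_nat (card (carrier G)) \<noteq> (0::'f)"
    and "subgroup H G" and b: "faithful_weight G H b"
    and u: "u \<in> H" "\<And>h. h \<in> H \<Longrightarrow> u \<otimes>\<^bsub>G\<^esub> h = h \<otimes>\<^bsub>G\<^esub> u"
    and w: "w \<in> H" "\<And>h. h \<in> H \<Longrightarrow> w \<otimes>\<^bsub>G\<^esub> h = h \<otimes>\<^bsub>G\<^esub> w" "w \<noteq> \<one>\<^bsub>G\<^esub>"
    and p: "prime (p::nat)" "u [^]\<^bsub>G\<^esub> p = \<one>\<^bsub>G\<^esub>" "w [^]\<^bsub>G\<^esub> p = \<one>\<^bsub>G\<^esub>"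
  shows "\<exists>j::nat. u = w [^]\<^bsub>G\<^esub> j"
proof (rule ccontr)
  assume none: "\<nexists>j::nat. u = w [^]\<^bsub>G\<^esub> j"
  interpret group G by fact
  interpret H: subgroup H G by fact
  note Hpow = subgroup_nat_pow[OF H.subgroup_axioms]
  have uG: "u \<in> carrier G" and wG: "w \<in> carrier G" using u(1) w(1) by auto
  have "ord w dvd p" using pow_eq_id[OF wG] p(3) by simp
  moreover have "ord w \<noteq> 1" using ord_eq_1[OF wG] w(3) by simp
  ultimately have ord: "ord w = p" using p(1) prime_nat_iff by blast
  have wi: "w [^]\<^bsub>G\<^esub> i \<noteq> \<one>\<^bsub>G\<^esub>" if "0 < i" "i < p" for i :: nat
    using that pow_eq_id[OF wG, of i] ord nat_dvd_not_less by auto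
  have pow_uw: "(u \<otimes>\<^bsub>G\<^esub> w [^]\<^bsub>G\<^esub> j) [^]\<^bsub>G\<^esub> i = u [^]\<^bsub>G\<^esub> i \<otimes>\<^bsub>G\<^esub> (w [^]\<^bsub>G\<^esub> i) [^]\<^bsub>G\<^esub> j" for i j :: nat
  proof -
    have "u \<otimes>\<^bsub>G\<^esub> w [^]\<^bsub>G\<^esub> j = w [^]\<^bsub>G\<^esub> j \<otimes>\<^bsub>G\<^esub> u" by (rule u(2)) (rule Hpow[OF w(1)])
    then show ?thesis
      unfolding nat_pow_pow[OF wG] mult.commute[of i j] unfolding nat_pow_pow[OF wG, symmetric]
      by (rule pow_mult_distrib[OF _ uG nat_pow_closed[OF wG]])
  qed
  have b1: "b \<one>\<^bsub>G\<^esub> = 1" using b unfolding faithful_weight_def by simp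
  have rows: "(\<Sum>i<p. b ((u \<otimes>\<^bsub>G\<^esub> w [^]\<^bsub>G\<^esub> j) [^]\<^bsub>G\<^esub> i)) = 0" for j :: nat
  proof -
    let ?v = "u \<otimes>\<^bsub>G\<^esub> w [^]\<^bsub>G\<^esub> j"
    have wj: "w [^]\<^bsub>G\<^esub> j \<in> H" by (rule Hpow[OF w(1)])
    have vH: "?v \<in> H" using u(1) wj by simp
    have vcomm: "?v \<otimes>\<^bsub>G\<^esub> h = h \<otimes>\<^bsub>G\<^esub> ?v" if h: "h \<in> H" for h
    proof -
      have hG: "h \<in> carrier G" using h by simp
      have "?v \<otimes>\<^bsub>G\<^esub> h = u \<otimes>\<^bsub>G\<^esub> (w [^]\<^bsub>G\<^esub> j \<otimes>\<^bsub>G\<^esub> h)" using uG wG hG by (simp add: m_assoc)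
      also have "\<dots> = (u \<otimes>\<^bsub>G\<^esub> h) \<otimes>\<^bsub>G\<^esub> w [^]\<^bsub>G\<^esub> j" unfolding group_commutes_pow[OF w(2)[OF h] wG hG] using uG wG hG by (simp add: m_assoc)
      also have "\<dots> = h \<otimes>\<^bsub>G\<^esub> ?v" unfolding u(2)[OF h] using uG wG hG by (simp add: m_assoc)
      finally show ?thesis .
    qed
    have v1: "?v \<noteq> \<one>\<^bsub>G\<^esub>"
    proof
      assume v: "?v = \<one>\<^bsub>G\<^esub>"
      \<comment> \<open>The inverse of \<open>w\<^sup>j\<close> is \<open>w\<close> to the power \<open>(p - 1) j\<close>, so \<open>u\<close> would be a power of \<open>w\<close>.\<close>
      have "p * j = (p - 1) * j + j" using prime_gt_0_nat[OF p(1)] by (cases p) auto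
      then have "w [^]\<^bsub>G\<^esub> ((p - 1) * j) \<otimes>\<^bsub>G\<^esub> w [^]\<^bsub>G\<^esub> j = w [^]\<^bsub>G\<^esub> (p * j)"
        using wG by (simp add: nat_pow_mult)
      also have "\<dots> = \<one>\<^bsub>G\<^esub>" using wG p(3) nat_pow_pow[OF wG, of p j] by simp
      finally have "u \<otimes>\<^bsub>G\<^esub> w [^]\<^bsub>G\<^esub> j = w [^]\<^bsub>G\<^esub> ((p - 1) * j) \<otimes>\<^bsub>G\<^esub> w [^]\<^bsub>G\<^esub> j" using v by simp
      then have "u = w [^]\<^bsub>G\<^esub> ((p - 1) * j)" using uG wG by simp
      then show False using none by blast
    qed
    have vp: "?v [^]\<^bsub>G\<^esub> p = \<one>\<^bsub>G\<^esub>" unfolding pow_uw p(2,3) by simp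
    have "(\<Sum>i<p. b (\<one>\<^bsub>G\<^esub> \<otimes>\<^bsub>G\<^esub> ?v [^]\<^bsub>G\<^esub> i)) = 0"
      by (rule weight_cyclic_sum[OF assms(1,2,4) b vH vcomm v1 p(1) vp H.one_closed])
    then show ?thesis using uG wG by simp
  qed
  have columns: "(\<Sum>j<p. b (u [^]\<^bsub>G\<^esub> i \<otimes>\<^bsub>G\<^esub> (w [^]\<^bsub>G\<^esub> i) [^]\<^bsub>G\<^esub> j)) = (if i = 0 then of_nat p else 0)" if i: "i < p" for i
  proof (cases "i = 0")
    case True
    then show ?thesis using b1 by simp
  next
    case False
    have wiH: "w [^]\<^bsub>G\<^esub> i \<in> H" "u [^]\<^bsub>G\<^esub> i \<in> H" using Hpow w(1) u(1) by auto
    have wip: "(w [^]\<^bsub>G\<^esub> i) [^]\<^bsub>G\<^esub> p = \<one>\<^bsub>G\<^esub>"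
      using wG p(3) nat_pow_pow[OF wG, of p i] nat_pow_pow[OF wG, of i p] by (simp add: mult.commute)
    have wic: "w [^]\<^bsub>G\<^esub> i \<otimes>\<^bsub>G\<^esub> h = h \<otimes>\<^bsub>G\<^esub> w [^]\<^bsub>G\<^esub> i" if h: "h \<in> H" for h
      by (rule group_commutes_pow[OF w(2)[OF h] wG H.mem_carrier[OF h]])
    have wi1: "w [^]\<^bsub>G\<^esub> i \<noteq> \<one>\<^bsub>G\<^esub>" using wi False i by simp
    have "(\<Sum>j<p. b (u [^]\<^bsub>G\<^esub> i \<otimes>\<^bsub>G\<^esub> (w [^]\<^bsub>G\<^esub> i) [^]\<^bsub>G\<^esub> j)) = 0"
      by (rule weight_cyclic_sum[OF assms(1,2,4) b wiH(1) wic wi1 p(1) wip wiH(2)])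
    then show ?thesis using False by simp
  qed
  have "(0::'f) = (\<Sum>j<p. \<Sum>i<p. b (u [^]\<^bsub>G\<^esub> i \<otimes>\<^bsub>G\<^esub> (w [^]\<^bsub>G\<^esub> i) [^]\<^bsub>G\<^esub> j))"
    using rows unfolding pow_uw by simp
  also have "\<dots> = (\<Sum>i<p. \<Sum>j<p. b (u [^]\<^bsub>G\<^esub> i \<otimes>\<^bsub>G\<^esub> (w [^]\<^bsub>G\<^esub> i) [^]\<^bsub>G\<^esub> j))" by (rule sum.swap)
  also have "\<dots> = (\<Sum>i<p. if i = 0 then of_nat p else 0)" by (rule sum.cong[OF refl]) (simp add: columns)
  also have "\<dots> = of_nat p" using prime_gt_0_nat[OF p(1)] by simp
  finally have "of_nat p = (0::'f)" by simp
  moreover have "p dvd card (carrier G)"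
    using ord_dvd_group_order[OF wG] ord unfolding Coset.order_def by simp
  ultimately show False using card by (metis dvd_def mult_zero_left of_nat_mult)
qed

text \<open>Uniqueness of the subgroup of order \<open>p\<close> makes the central elements of \<open>p\<close>-power order a
  chain: by induction \<open>z\<^sup>p\<close> is a power of \<open>y\<close>, its exponent is divisible by \<open>p\<close> for reasons of order, and
  dividing \<open>z\<close> by the corresponding power of \<open>y\<close> leaves an element of order dividing \<open>p\<close>.\<close>

lemma central_prime_power_chain:
  fixes b :: "'g \<Rightarrow> 'f::field"
  assumes "group G" "finite (carrier G)" and card: "of_nat (card (carrier G)) \<noteq> (0::'f)"
    and "subgroup H G" and b: "faithful_weight G H b"
    and y: "y \<in> H" "\<And>h. h \<in> H \<Longrightarrow> y \<otimes>\<^bsub>G\<^esub> h = h \<otimes>\<^bsub>G\<^esub> y"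
    and p: "prime (p::nat)" and ordy: "group.ord G y = p ^ a"
  shows "e \<le> a \<Longrightarrow> z \<in> H \<Longrightarrow> (\<And>h. h \<in> H \<Longrightarrow> z \<otimes>\<^bsub>G\<^esub> h = h \<otimes>\<^bsub>G\<^esub> z) \<Longrightarrow> z [^]\<^bsub>G\<^esub> (p ^ e) = \<one>\<^bsub>G\<^esub> \<Longrightarrow>
    \<exists>c::nat. z = y [^]\<^bsub>G\<^esub> c"
proof (induction e arbitrary: z)
  case 0
  interpret group G by fact
  interpret H: subgroup H G by fact
  note Hpow = subgroup_nat_pow[OF H.subgroup_axioms]
  have "z = y [^]\<^bsub>G\<^esub> (0::nat)" using 0 H.mem_carrier by simp
  then show ?case by blast
next
  case (Suc e)
  interpret group G by fact
  interpret H: subgroup H G by fact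
  note Hpow = subgroup_nat_pow[OF H.subgroup_axioms]
  note z = Suc.prems(2,3)
  have yG: "y \<in> carrier G" and zG: "z \<in> carrier G" using y z by auto
  have "\<exists>c::nat. z [^]\<^bsub>G\<^esub> p = y [^]\<^bsub>G\<^esub> c"
  proof (rule Suc.IH)
    show "(z [^]\<^bsub>G\<^esub> p) [^]\<^bsub>G\<^esub> (p ^ e) = \<one>\<^bsub>G\<^esub>" using Suc.prems(4) zG by (simp add: nat_pow_pow)
    show "z [^]\<^bsub>G\<^esub> p \<otimes>\<^bsub>G\<^esub> h = h \<otimes>\<^bsub>G\<^esub> z [^]\<^bsub>G\<^esub> p" if "h \<in> H" for h
      by (rule group_commutes_pow[OF z(2)[OF that] zG H.mem_carrier[OF that]])
  qed (use Suc.prems(1) Hpow[OF z(1)] in auto)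
  then obtain c :: nat where c: "z [^]\<^bsub>G\<^esub> p = y [^]\<^bsub>G\<^esub> c" by blast
  have "y [^]\<^bsub>G\<^esub> (c * p ^ e) = \<one>\<^bsub>G\<^esub>"
    unfolding nat_pow_pow[OF yG, symmetric] c[symmetric] using Suc.prems(4) zG by (simp add: nat_pow_pow)
  then have "p ^ a dvd c * p ^ e" using pow_eq_id[OF yG] ordy by simp
  moreover have "p ^ Suc e dvd p ^ a" using Suc.prems(1) by (rule le_imp_power_dvd)
  ultimately have "p ^ Suc e dvd c * p ^ e" by (rule dvd_trans[rotated])
  then have "p * p ^ e dvd c * p ^ e" by (simp only: power_Suc)
  then have "p dvd c" using prime_gt_0_nat[OF p] by simp
  then obtain d where d: "c = p * d" by (rule dvdE)
  let ?x = "inv\<^bsub>G\<^esub> (y [^]\<^bsub>G\<^esub> d)" and ?w = "y [^]\<^bsub>G\<^esub> (p ^ (a - 1))"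
  have ydH: "y [^]\<^bsub>G\<^esub> d \<in> H" by (rule Hpow[OF y(1)])
  have ydG: "y [^]\<^bsub>G\<^esub> d \<in> carrier G" using yG by simp
  have xcomm: "?x \<otimes>\<^bsub>G\<^esub> h = h \<otimes>\<^bsub>G\<^esub> ?x" if h: "h \<in> H" for h
  proof -
    have hG: "h \<in> carrier G" using h by simp
    have "h = ?x \<otimes>\<^bsub>G\<^esub> (y [^]\<^bsub>G\<^esub> d \<otimes>\<^bsub>G\<^esub> h)" using hG ydG by (simp add: m_assoc[symmetric])
    also have "\<dots> = (?x \<otimes>\<^bsub>G\<^esub> h) \<otimes>\<^bsub>G\<^esub> y [^]\<^bsub>G\<^esub> d" unfolding group_commutes_pow[OF y(2)[OF h] yG hG] using hG ydG by (simp add: m_assoc)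
    finally show ?thesis using inv_solve_right[of "?x \<otimes>\<^bsub>G\<^esub> h" h "y [^]\<^bsub>G\<^esub> d"] hG ydG by simp
  qed
  let ?u = "z \<otimes>\<^bsub>G\<^esub> ?x"
  have uH: "?u \<in> H" using z(1) ydH by simp
  have ucomm: "?u \<otimes>\<^bsub>G\<^esub> h = h \<otimes>\<^bsub>G\<^esub> ?u" if h: "h \<in> H" for h
  proof -
    have hG: "h \<in> carrier G" using h by simp
    have "?u \<otimes>\<^bsub>G\<^esub> h = z \<otimes>\<^bsub>G\<^esub> (?x \<otimes>\<^bsub>G\<^esub> h)" using zG ydG hG by (simp add: m_assoc)
    also have "\<dots> = (z \<otimes>\<^bsub>G\<^esub> h) \<otimes>\<^bsub>G\<^esub> ?x" unfolding xcomm[OF h] using zG ydG hG by (simp add: m_assoc)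
    also have "\<dots> = h \<otimes>\<^bsub>G\<^esub> ?u" unfolding z(2)[OF h] using zG ydG hG by (simp add: m_assoc)
    finally show ?thesis .
  qed
  have up: "?u [^]\<^bsub>G\<^esub> p = \<one>\<^bsub>G\<^esub>"
  proof -
    have "?u [^]\<^bsub>G\<^esub> p = z [^]\<^bsub>G\<^esub> p \<otimes>\<^bsub>G\<^esub> ?x [^]\<^bsub>G\<^esub> p"
      by (rule pow_mult_distrib[OF _ zG]) (use z(2) ydH ydG in auto)
    also have "?x [^]\<^bsub>G\<^esub> p = inv\<^bsub>G\<^esub> (y [^]\<^bsub>G\<^esub> c)" unfolding nat_pow_inv[OF ydG] nat_pow_pow[OF yG] d by (simp add: mult.commute)
    finally show ?thesis unfolding c using yG by simp
  qed
  have a: "a = Suc (a - 1)" using Suc.prems(1) by simp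
  have wp: "?w [^]\<^bsub>G\<^esub> p = \<one>\<^bsub>G\<^esub>"
  proof -
    have "?w [^]\<^bsub>G\<^esub> p = y [^]\<^bsub>G\<^esub> (p ^ a)" unfolding nat_pow_pow[OF yG] using power_minus_mult[of a p] a by simp
    then show ?thesis using pow_ord_eq_1[OF yG] ordy by simp
  qed
  have w1: "?w \<noteq> \<one>\<^bsub>G\<^esub>"
  proof
    assume "?w = \<one>\<^bsub>G\<^esub>"
    then have "p ^ a dvd p ^ (a - 1)" using pow_eq_id[OF yG] ordy by simp
    then have "a \<le> a - 1" using prime_gt_1_nat[OF p] power_dvd_imp_le by blast
    then show False using a by simp
  qed
  have wcomm: "?w \<otimes>\<^bsub>G\<^esub> h = h \<otimes>\<^bsub>G\<^esub> ?w" if "h \<in> H" for h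
    by (rule group_commutes_pow[OF y(2)[OF that] yG H.mem_carrier[OF that]])
  have "\<exists>j::nat. ?u = ?w [^]\<^bsub>G\<^esub> j"
    by (rule central_prime_order_subgroup_unique[OF assms(1,2) card assms(4) b uH ucomm Hpow[OF y(1)] wcomm w1 p up wp])
  then obtain j :: nat where j: "?u = ?w [^]\<^bsub>G\<^esub> j" by blast
  have "z = ?u \<otimes>\<^bsub>G\<^esub> y [^]\<^bsub>G\<^esub> d" using zG ydG by (simp add: m_assoc)
  also have "\<dots> = y [^]\<^bsub>G\<^esub> (p ^ (a - 1) * j + d)"
    unfolding j using yG by (simp add: nat_pow_pow nat_pow_mult)
  finally show ?case by blast
qed

section \<open>The case where every obstruction is a minimal normal subgroup\<close>

context group begin

lemma group_center_subgroup: "subgroup (group_center G) G"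
proof (rule subgroupI)
  show "group_center G \<subseteq> carrier G" unfolding group_center_def by blast
  show "group_center G \<noteq> {}" unfolding group_center_def by auto
next
  fix a assume a: "a \<in> group_center G"
  then have aG: "a \<in> carrier G" unfolding group_center_def by simp
  have "inv a \<otimes> g = g \<otimes> inv a" if g: "g \<in> carrier G" for g
  proof -
    have "inv a \<otimes> g = inv a \<otimes> (g \<otimes> a) \<otimes> inv a" using aG g by (simp add: m_assoc)
    also have "\<dots> = inv a \<otimes> (a \<otimes> g) \<otimes> inv a" using a g unfolding group_center_def by auto
    also have "\<dots> = g \<otimes> inv a" using aG g by (simp add: m_assoc[symmetric])
    finally show ?thesis .
  qed
  then show "inv a \<in> group_center G" using aG unfolding group_center_def by simp
  fix b assume b: "b \<in> group_center G"
  then have bG: "b \<in> carrier G" unfolding group_center_def by simp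
  have "(a \<otimes> b) \<otimes> g = g \<otimes> (a \<otimes> b)" if g: "g \<in> carrier G" for g
  proof -
    have "(a \<otimes> b) \<otimes> g = a \<otimes> (g \<otimes> b)" using aG bG g b unfolding group_center_def by (simp add: m_assoc)
    also have "\<dots> = (g \<otimes> a) \<otimes> b" using aG bG g a unfolding group_center_def by (simp add: m_assoc[symmetric])
    finally show ?thesis using aG bG g by (simp add: m_assoc)
  qed
  then show "a \<otimes> b \<in> group_center G" using aG bG unfolding group_center_def by simp
qed

lemma conjugate_nat_pow:
  assumes "g \<in> carrier G" "y \<in> carrier G"
  shows "(g \<otimes> y \<otimes> inv g) [^] (k::nat) = g \<otimes> y [^] k \<otimes> inv g"
proof (induction k)
  case 0
  then show ?case using assms by simp
next
  case (Suc k)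
  have cancel: "inv g \<otimes> (g \<otimes> z) = z" if "z \<in> carrier G" for z
    using that assms by (simp add: m_assoc[symmetric])
  show ?case using Suc assms by (simp add: m_assoc cancel)
qed

text \<open>Either \<open>L\<close> contains an element not commuting with \<open>y\<close>, or a nontrivial commutator \<open>n\<close> of \<open>y\<close>
  commutes with \<open>y\<close>. In the second case \<open>y = n c\<close> with \<open>c\<close> a conjugate of \<open>y\<close> commuting
  with \<open>n\<close>, so that the \<open>q\<close>-th powers give \<open>1 = n\<^sup>q\<close>.\<close>

lemma central_mod_witness:
  assumes L: "L \<lhd> G" and y: "y \<in> central_mod L" "y \<notin> group_center G" and q: "y [^] (q::nat) = \<one>"
  shows "\<exists>n\<in>L. n \<noteq> \<one> \<and> (y \<otimes> n \<noteq> n \<otimes> y \<or> n [^] q = \<one>)"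
proof -
  interpret L: normal L G by fact
  have yG: "y \<in> carrier G" using y(1) unfolding central_mod_def by simp
  obtain g where g: "g \<in> carrier G" "y \<otimes> g \<noteq> g \<otimes> y" using y(2) yG unfolding group_center_def by blast
  define n where "n = y \<otimes> g \<otimes> inv y \<otimes> inv g"
  have nL: "n \<in> L" using y(1) g(1) unfolding central_mod_def n_def by blast
  then have nG: "n \<in> carrier G" by simp
  have n1: "n \<noteq> \<one>" unfolding n_def commute_iff_commutator_one[OF yG g(1)] by (rule g(2))
  have "n [^] q = \<one>" if comm: "y \<otimes> n = n \<otimes> y"
  proof -
    have cancel: "inv y \<otimes> (y \<otimes> z) = z" "y \<otimes> (inv y \<otimes> z) = z" "g \<otimes> (inv g \<otimes> z) = z" "inv g \<otimes> (g \<otimes> z) = z"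
      if "z \<in> carrier G" for z
      using that yG g(1) by (simp_all add: m_assoc[symmetric])
    have y_eq: "y = n \<otimes> (g \<otimes> y \<otimes> inv g)" unfolding n_def using yG g(1) by (simp add: m_assoc cancel)
    let ?c = "g \<otimes> y \<otimes> inv g"
    have cG: "?c \<in> carrier G" using yG g(1) by simp
    have "n \<otimes> (n \<otimes> ?c) = n \<otimes> (?c \<otimes> n)"
      using comm unfolding arg_cong[OF y_eq, of "\<lambda>z. z \<otimes> n"] arg_cong[OF y_eq, of "\<lambda>z. n \<otimes> z"]
      using nG cG by (simp add: m_assoc)
    then have "n \<otimes> ?c = ?c \<otimes> n" using nG cG by simp
    then have "(n \<otimes> ?c) [^] q = n [^] q \<otimes> ?c [^] q" by (rule pow_mult_distrib[OF _ nG cG])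
    moreover have "?c [^] q = \<one>" unfolding conjugate_nat_pow[OF g(1) yG] q using g(1) by simp
    moreover have "(n \<otimes> ?c) [^] q = \<one>" unfolding y_eq[symmetric] by (rule q)
    ultimately show ?thesis using nG by simp
  qed
  then show ?thesis using nL n1 by blast
qed

end

lemma subseqs_map: "subseqs (map f xs) = map (map f) (subseqs xs)"
  by (induction xs) (simp_all add: Let_def comp_def)

text \<open>It is enough to be nontrivial on the minimal normal subgroups \<open>L\<close> of \<open>G\<close> that meet \<open>H\<close>
  trivially: if \<open>\<sigma>(h)\<close> is scalar and \<open>h\<close> is not central, the kernel is nontrivial and meets \<open>H\<close>
  trivially, so it contains such an \<open>L\<close>. The hypothesis on normal subgroups supplies
  the elements \<open>y\<close> with which \<open>separated_products_avoid_subgroup\<close> is applied.\<close>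

lemma irreducible_rep_scalars_central_reduced:
  fixes b :: "'g \<Rightarrow> 'f::field"
  assumes "group G" "finite (carrier G)" and card: "of_nat (card (carrier G)) \<noteq> (0::'f)"
    and "subgroup H G" and b: "faithful_weight G H b"
    and star: "\<And>L. L \<lhd> G \<Longrightarrow> L \<noteq> {\<one>\<^bsub>G\<^esub>} \<Longrightarrow> L \<inter> H = {\<one>\<^bsub>G\<^esub>} \<Longrightarrow>
      \<exists>y\<in>H. y \<notin> group_center G \<and> y \<in> group.central_mod G L"
  shows "\<exists>n (\<sigma> :: 'g \<Rightarrow> 'f mat). irreducible_rep G n \<sigma> \<and>
    (\<forall>h\<in>H. \<sigma> h \<in> scalar_mats TYPE('f) n \<longrightarrow> h \<in> group_center G)"
proof -
  interpret group G by fact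
  interpret H: subgroup H G by fact
  define \<L> where "\<L> = {L. L \<lhd> G \<and> L \<noteq> {\<one>\<^bsub>G\<^esub>} \<and> L \<inter> H = {\<one>\<^bsub>G\<^esub>} \<and>
    (\<forall>M. M \<lhd> G \<longrightarrow> M \<subseteq> L \<longrightarrow> M = {\<one>\<^bsub>G\<^esub>} \<or> M = L)}"
  have LN: "L \<lhd> G" if "L \<in> \<L>" for L using that unfolding \<L>_def by blast
  have Lsub: "L \<subseteq> carrier G" if "L \<in> \<L>" for L
    by (rule normal_imp_subgroup[OF LN[OF that], THEN subgroup.subset])
  have "\<L> \<subseteq> Pow (carrier G)" using Lsub by blast
  then have finL: "finite \<L>" using assms(2) by (simp add: finite_subset)
  have inter: "L \<inter> L' = {\<one>\<^bsub>G\<^esub>}" if L: "L \<in> \<L>" and L': "L' \<in> \<L>" and ne: "L \<noteq> L'" for L L'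
  proof -
    have N: "L \<inter> L' \<lhd> G" by (rule normal_subgroup_intersect[OF LN[OF L] LN[OF L']])
    then have "L \<inter> L' = {\<one>\<^bsub>G\<^esub>} \<or> L \<inter> L' = L" using L unfolding \<L>_def by auto
    moreover have "L \<inter> L' = {\<one>\<^bsub>G\<^esub>} \<or> L \<inter> L' = L'" using N L' unfolding \<L>_def by auto
    ultimately show ?thesis using ne by auto
  qed
  have cmG: "y \<in> carrier G" if "y \<in> central_mod L" for y L using that unfolding central_mod_def by simp
  have comm_in: "y \<otimes>\<^bsub>G\<^esub> g \<otimes>\<^bsub>G\<^esub> inv\<^bsub>G\<^esub> y \<otimes>\<^bsub>G\<^esub> inv\<^bsub>G\<^esub> g \<in> L" if "y \<in> central_mod L" "g \<in> carrier G" for y g L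
    using that unfolding central_mod_def by simp
  have comm_normal: "y \<otimes>\<^bsub>G\<^esub> l \<otimes>\<^bsub>G\<^esub> inv\<^bsub>G\<^esub> y \<otimes>\<^bsub>G\<^esub> inv\<^bsub>G\<^esub> l \<in> L" if L: "L \<in> \<L>" and "y \<in> carrier G" "l \<in> L" for y l L
  proof -
    interpret L: normal L G by (rule LN[OF L])
    show ?thesis using L.inv_op_closed2[OF that(2,3)] that(3) by simp
  qed
  define good where "good L t \<longleftrightarrow> (case t of (y, p, a, n) \<Rightarrow> y \<in> H \<and> y \<notin> group_center G \<and> y \<in> central_mod L \<and>
    prime (p::nat) \<and> y [^]\<^bsub>G\<^esub> (p ^ a :: nat) = \<one>\<^bsub>G\<^esub> \<and> n \<in> L \<and> n \<noteq> \<one>\<^bsub>G\<^esub> \<and>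
    (y \<otimes>\<^bsub>G\<^esub> n \<noteq> n \<otimes>\<^bsub>G\<^esub> y \<or> n [^]\<^bsub>G\<^esub> (p ^ a :: nat) = \<one>\<^bsub>G\<^esub>))" for L t
  have "\<exists>t. good L t" if L: "L \<in> \<L>" for L
  proof -
    obtain y where y: "y \<in> H" "y \<notin> group_center G" "y \<in> central_mod L"
      using star[of L] L unfolding \<L>_def by blast
    have yG: "y \<in> carrier G" using y(1) by simp
    have "0 < ord y" using ord_ge_1[OF assms(2) yG] by simp
    then obtain k p a :: nat where k: "prime p" "y [^]\<^bsub>G\<^esub> k \<notin> group_center G" "(y [^]\<^bsub>G\<^esub> k) [^]\<^bsub>G\<^esub> (p ^ a) = \<one>\<^bsub>G\<^esub>"
      using prime_power_part_outside[OF group_center_subgroup yG y(2), of "ord y"] pow_ord_eq_1[OF yG] by blast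
    have cm: "y [^]\<^bsub>G\<^esub> k \<in> central_mod L" by (rule central_mod_pow[OF LN[OF L] y(3)])
    obtain n where "n \<in> L" "n \<noteq> \<one>\<^bsub>G\<^esub>"
      "y [^]\<^bsub>G\<^esub> k \<otimes>\<^bsub>G\<^esub> n \<noteq> n \<otimes>\<^bsub>G\<^esub> y [^]\<^bsub>G\<^esub> k \<or> n [^]\<^bsub>G\<^esub> (p ^ a) = \<one>\<^bsub>G\<^esub>"
      using central_mod_witness[OF LN[OF L] cm k(2,3)] by blast
    then have "good L (y [^]\<^bsub>G\<^esub> k, p, a, n)"
      unfolding good_def using k cm subgroup_nat_pow[OF assms(4) y(1)] by simp
    then show ?thesis by blast
  qed
  then obtain t where t: "\<And>L. L \<in> \<L> \<Longrightarrow> good L (t L)" by metis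
  define y p a n where "y L = fst (t L)" and "p L = fst (snd (t L))" and "a L = fst (snd (snd (t L)))"
    and "n L = snd (snd (snd (t L)))" for L
  have dat: "y L \<in> H" "y L \<notin> group_center G" "y L \<in> central_mod L" "prime (p L)"
    "y L [^]\<^bsub>G\<^esub> (p L ^ a L) = \<one>\<^bsub>G\<^esub>" "n L \<in> L" "n L \<noteq> \<one>\<^bsub>G\<^esub>"
    "y L \<otimes>\<^bsub>G\<^esub> n L \<noteq> n L \<otimes>\<^bsub>G\<^esub> y L \<or> n L [^]\<^bsub>G\<^esub> (p L ^ a L) = \<one>\<^bsub>G\<^esub>" if "L \<in> \<L>" for L
    using t[OF that] unfolding good_def y_def p_def a_def n_def by (simp_all add: case_prod_unfold)
  have yG: "y L \<in> carrier G" if "L \<in> \<L>" for L using dat(1)[OF that] by simp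
  have nG: "n L \<in> carrier G" if "L \<in> \<L>" for L using dat(6)[OF that] Lsub[OF that] by blast
  have yH: "y L \<otimes>\<^bsub>G\<^esub> h = h \<otimes>\<^bsub>G\<^esub> y L" if L: "L \<in> \<L>" and h: "h \<in> H" for L h
  proof -
    have "y L \<otimes>\<^bsub>G\<^esub> h \<otimes>\<^bsub>G\<^esub> inv\<^bsub>G\<^esub> (y L) \<otimes>\<^bsub>G\<^esub> inv\<^bsub>G\<^esub> h \<in> L \<inter> H"
      using comm_in[OF dat(3)[OF L]] dat(1)[OF L] h by simp
    then have "y L \<otimes>\<^bsub>G\<^esub> h \<otimes>\<^bsub>G\<^esub> inv\<^bsub>G\<^esub> (y L) \<otimes>\<^bsub>G\<^esub> inv\<^bsub>G\<^esub> h = \<one>\<^bsub>G\<^esub>" using L unfolding \<L>_def by blast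
    then show ?thesis using commute_iff_commutator_one[OF yG[OF L], of h] h by simp
  qed
  have yL: "y L \<otimes>\<^bsub>G\<^esub> l = l \<otimes>\<^bsub>G\<^esub> y L" if L: "L \<in> \<L>" and L': "L' \<in> \<L>" and ne: "L \<noteq> L'" and l: "l \<in> L'" for L L' l
  proof -
    have lG: "l \<in> carrier G" using l Lsub[OF L'] by blast
    have "y L \<otimes>\<^bsub>G\<^esub> l \<otimes>\<^bsub>G\<^esub> inv\<^bsub>G\<^esub> (y L) \<otimes>\<^bsub>G\<^esub> inv\<^bsub>G\<^esub> l \<in> L \<inter> L'"
      using comm_in[OF dat(3)[OF L] lG] comm_normal[OF L' yG[OF L] l] by blast
    then show ?thesis using inter[OF L L' ne] commute_iff_commutator_one[OF yG[OF L] lG] by blast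
  qed
  have LL: "l \<otimes>\<^bsub>G\<^esub> l' = l' \<otimes>\<^bsub>G\<^esub> l" if L: "L \<in> \<L>" and L': "L' \<in> \<L>" and ne: "L \<noteq> L'" and l: "l \<in> L" and l': "l' \<in> L'" for L L' l l'
  proof -
    interpret L: normal L G by (rule LN[OF L])
    have lG: "l \<in> carrier G" "l' \<in> carrier G" using l l' Lsub L L' by blast+
    have "l' \<otimes>\<^bsub>G\<^esub> inv\<^bsub>G\<^esub> l \<otimes>\<^bsub>G\<^esub> inv\<^bsub>G\<^esub> l' \<in> L" using L.inv_op_closed2[OF lG(2), of "inv\<^bsub>G\<^esub> l"] l by simp
    then have "l \<otimes>\<^bsub>G\<^esub> (l' \<otimes>\<^bsub>G\<^esub> inv\<^bsub>G\<^esub> l \<otimes>\<^bsub>G\<^esub> inv\<^bsub>G\<^esub> l') \<in> L" using l by simp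
    then have "l \<otimes>\<^bsub>G\<^esub> l' \<otimes>\<^bsub>G\<^esub> inv\<^bsub>G\<^esub> l \<otimes>\<^bsub>G\<^esub> inv\<^bsub>G\<^esub> l' \<in> L" using lG by (simp add: m_assoc)
    then have "l \<otimes>\<^bsub>G\<^esub> l' \<otimes>\<^bsub>G\<^esub> inv\<^bsub>G\<^esub> l \<otimes>\<^bsub>G\<^esub> inv\<^bsub>G\<^esub> l' \<in> L \<inter> L'"
      using comm_normal[OF L' lG(1) l'] by blast
    then show ?thesis using inter[OF L L' ne] commute_iff_commutator_one[OF lG] by blast
  qed
  have ordy: "\<exists>i. ord (y L) = p L ^ i" if L: "L \<in> \<L>" for L
    using dat(5)[OF L] pow_eq_id[OF yG[OF L]] divides_primepow_nat[OF dat(4)[OF L]] by auto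
  \<comment> \<open>If the primes agree, one of the two elements is a power of the other, hence central modulo \<open>L \<inter> L' = 1\<close>.\<close>
  have not_power: False if L: "L \<in> \<L>" and L': "L' \<in> \<L>" and ne: "L \<noteq> L'" and pp: "p L = p L'"
    and i: "ord (y L) = p L ^ i" and j: "ord (y L') = p L' ^ j" and ij: "i \<le> j" for L L' i j
  proof -
    have yi: "y L [^]\<^bsub>G\<^esub> (p L' ^ i) = \<one>\<^bsub>G\<^esub>" using pow_ord_eq_1[OF yG[OF L]] unfolding i pp .
    have "\<exists>c::nat. y L = y L' [^]\<^bsub>G\<^esub> c"
      by (rule central_prime_power_chain[OF assms(1,2) card assms(4) b dat(1)[OF L'] yH[OF L'] dat(4)[OF L'] j ij dat(1)[OF L] yH[OF L] yi])
    then obtain c :: nat where c: "y L = y L' [^]\<^bsub>G\<^esub> c" by blast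
    have "y L \<in> central_mod L'" unfolding c by (rule central_mod_pow[OF LN[OF L'] dat(3)[OF L']])
    then have "y L \<in> central_mod (L \<inter> L')" using dat(3)[OF L] unfolding central_mod_def by blast
    then show False using dat(2)[OF L] unfolding inter[OF L L' ne] central_mod_one by contradiction
  qed
  have p_inj: "inj_on p \<L>"
  proof (rule inj_onI, rule ccontr)
    fix L L' assume L: "L \<in> \<L>" and L': "L' \<in> \<L>" and pp: "p L = p L'" and ne: "L \<noteq> L'"
    obtain i where i: "ord (y L) = p L ^ i" using ordy[OF L] by blast
    obtain j where j: "ord (y L') = p L' ^ j" using ordy[OF L'] by blast
    show False
    proof (cases "i \<le> j")
      case True
      show False by (rule not_power[OF L L' ne pp i j True])
    next
      case False
      then have ji: "j \<le> i" by simp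
      show False by (rule not_power[OF L' L ne[symmetric] pp[symmetric] j i ji])
    qed
  qed
  obtain Ls where Ls: "set Ls = \<L>" "distinct Ls" using finite_distinct_list[OF finL] by blast
  have as: "set (map n Ls) \<subseteq> carrier G" using nG Ls(1) by auto
  have avoid: "mult_list cs \<notin> H" if cs: "cs \<in> set (subseqs (map n Ls))" "cs \<noteq> []" for cs
  proof -
    obtain Ms where Ms: "Ms \<in> set (subseqs Ls)" "cs = map n Ms" using cs(1) unfolding subseqs_map by auto
    have MsL: "set Ms \<subseteq> \<L>" using Ms(1) subseqs_powset[of Ls] Ls(1) by auto
    have Msd: "distinct Ms" using subseqs_distinctD[OF Ms(1) Ls(2)] .
    have inL: "L \<in> \<L>" if "L \<in> set Ms" for L using MsL that by blast
    have "mult_list (map n Ms) \<notin> H"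
    proof (rule separated_products_avoid_subgroup[where y=y and p=p and a=a, OF assms(4) Msd])
      show "Ms \<noteq> []" using cs(2) Ms(2) by simp
      show "n L [^]\<^bsub>G\<^esub> k = \<one>\<^bsub>G\<^esub>" if "L \<in> set Ms" "n L [^]\<^bsub>G\<^esub> k \<in> H" for L and k :: nat
      proof -
        have L: "L \<in> \<L>" using inL that(1) .
        have "n L [^]\<^bsub>G\<^esub> k \<in> L" by (rule subgroup_nat_pow[OF normal_imp_subgroup[OF LN[OF L]] dat(6)[OF L]])
        then show ?thesis using that(2) L unfolding \<L>_def by blast
      qed
      show "inj_on p (set Ms)" using p_inj MsL by (rule inj_on_subset)
      show "y L \<otimes>\<^bsub>G\<^esub> n L' = n L' \<otimes>\<^bsub>G\<^esub> y L" if "L \<in> set Ms" "L' \<in> set Ms" "L \<noteq> L'" for L L'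
        by (rule yL[OF inL[OF that(1)] inL[OF that(2)] that(3) dat(6)[OF inL[OF that(2)]]])
      show "n L \<otimes>\<^bsub>G\<^esub> n L' = n L' \<otimes>\<^bsub>G\<^esub> n L" if "L \<in> set Ms" "L' \<in> set Ms" "L \<noteq> L'" for L L'
        by (rule LL[OF inL[OF that(1)] inL[OF that(2)] that(3) dat(6)[OF inL[OF that(1)]] dat(6)[OF inL[OF that(2)]]])
      show "y L \<otimes>\<^bsub>G\<^esub> h = h \<otimes>\<^bsub>G\<^esub> y L" if "L \<in> set Ms" "h \<in> H" for L h
        by (rule yH[OF inL[OF that(1)] that(2)])
    qed (rule nG dat(7) yG dat(4) dat(8), erule inL)+
    then show ?thesis using Ms(2) by simp
  qed
  have bH: "b x = 0" if "x \<notin> H" for x using b that unfolding faithful_weight_def by blast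
  let ?f = "foldr (twist G) (map n Ls) b"
  have "?f \<one>\<^bsub>G\<^esub> = b \<one>\<^bsub>G\<^esub>"
    by (rule twist_list_one[OF assms(1,4) bH as avoid])
  then have "?f \<one>\<^bsub>G\<^esub> \<noteq> 0" using b unfolding faithful_weight_def by simp
  then obtain m \<rho> where "linear_rep G m \<rho>" "weighted_sum m m (carrier G) ?f \<rho> \<noteq> 0\<^sub>m m m"
    using regular_rep_nonzero[OF assms(1,2)] by blast
  then obtain d and \<sigma> :: "'g \<Rightarrow> 'f mat" where \<sigma>: "irreducible_rep G d \<sigma>" "weighted_sum d d (carrier G) ?f \<sigma> \<noteq> 0\<^sub>m d d"
    using irreducible_not_annihilated[OF assms(1,2) card] by blast
  have lin: "linear_rep G d \<sigma>" using \<sigma>(1) unfolding irreducible_rep_def by simp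
  have survive: "weighted_sum d d (carrier G) b \<sigma> \<noteq> 0\<^sub>m d d" "\<forall>c\<in>set (map n Ls). \<sigma> c \<noteq> 1\<^sub>m d"
    using weighted_sum_twist_list[OF assms(1) lin as \<sigma>(2)] by auto
  have "h \<in> group_center G" if h: "h \<in> H" and scalar: "\<sigma> h \<in> scalar_mats TYPE('f) d" for h
  proof (rule ccontr)
    assume nc: "h \<notin> group_center G"
    have hG: "h \<in> carrier G" using h by simp
    note \<sigma>c = linear_rep_carrier[OF lin] and \<sigma>m = linear_rep_mult[OF lin] and \<sigma>1 = linear_rep_one[OF assms(1) lin]
    define N where "N = {g \<in> carrier G. \<sigma> g = 1\<^sub>m d}"
    interpret GLd: group "GL TYPE('f) d" by (rule GL_group)
    interpret \<sigma>: group_hom G "GL TYPE('f) d" \<sigma>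
      using lin unfolding linear_rep_def by unfold_locales
    have "kernel G (GL TYPE('f) d) \<sigma> = N" unfolding N_def kernel_def one_GL ..
    then have N: "N \<lhd> G" using \<sigma>.normal_kernel by simp
    have NH: "N \<inter> H = {\<one>\<^bsub>G\<^esub>}"
    proof
      show "N \<inter> H \<subseteq> {\<one>\<^bsub>G\<^esub>}"
        using faithful_weight_kernel[OF assms(1,2) card assms(4) b lin survive(1)] unfolding N_def by blast
      show "{\<one>\<^bsub>G\<^esub>} \<subseteq> N \<inter> H" using \<sigma>1 unfolding N_def by simp
    qed
    obtain g where g: "g \<in> carrier G" "h \<otimes>\<^bsub>G\<^esub> g \<noteq> g \<otimes>\<^bsub>G\<^esub> h"
      using nc hG unfolding group_center_def by blast
    obtain c where c: "\<sigma> h = c \<cdot>\<^sub>m 1\<^sub>m d" using scalar unfolding scalar_mats_def by blast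
    have "\<sigma> h * \<sigma> g = c \<cdot>\<^sub>m \<sigma> g" "\<sigma> g * \<sigma> h = c \<cdot>\<^sub>m \<sigma> g"
      unfolding c using \<sigma>c[OF g(1)]
      by (simp_all add: mult_smult_assoc_mat[of _ d d _ d] mult_smult_distrib[of _ d d _ d])
    then have "\<sigma> (h \<otimes>\<^bsub>G\<^esub> g) = \<sigma> (g \<otimes>\<^bsub>G\<^esub> h)" using \<sigma>m hG g(1) by simp
    then have "\<sigma> ((h \<otimes>\<^bsub>G\<^esub> g) \<otimes>\<^bsub>G\<^esub> inv\<^bsub>G\<^esub> (g \<otimes>\<^bsub>G\<^esub> h)) = \<sigma> ((g \<otimes>\<^bsub>G\<^esub> h) \<otimes>\<^bsub>G\<^esub> inv\<^bsub>G\<^esub> (g \<otimes>\<^bsub>G\<^esub> h))"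
      using \<sigma>m[OF m_closed[OF hG g(1)] inv_closed[OF m_closed[OF g(1) hG]]]
        \<sigma>m[OF m_closed[OF g(1) hG] inv_closed[OF m_closed[OF g(1) hG]]] by simp
    then have comm_N: "(h \<otimes>\<^bsub>G\<^esub> g) \<otimes>\<^bsub>G\<^esub> inv\<^bsub>G\<^esub> (g \<otimes>\<^bsub>G\<^esub> h) \<in> N" unfolding N_def using \<sigma>1 hG g(1) by simp
    have "(h \<otimes>\<^bsub>G\<^esub> g) \<otimes>\<^bsub>G\<^esub> inv\<^bsub>G\<^esub> (g \<otimes>\<^bsub>G\<^esub> h) \<noteq> \<one>\<^bsub>G\<^esub>"
      using inv_solve_right'[of "\<one>\<^bsub>G\<^esub>" "h \<otimes>\<^bsub>G\<^esub> g" "g \<otimes>\<^bsub>G\<^esub> h"] g hG by simp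
    then have N1: "N \<noteq> {\<one>\<^bsub>G\<^esub>}" using comm_N by blast
    \<comment> \<open>A nontrivial normal subgroup of least cardinality inside the kernel is a minimal normal subgroup of \<open>G\<close>.\<close>
    let ?Q = "\<lambda>M. M \<lhd> G \<and> M \<noteq> {\<one>\<^bsub>G\<^esub>} \<and> M \<subseteq> N"
    have "?Q N" using N N1 by simp
    then obtain L where L: "?Q L" and least: "\<And>M. ?Q M \<Longrightarrow> card L \<le> card M"
      using ex_has_least_nat[of ?Q N card] by blast
    have NG: "N \<subseteq> carrier G" unfolding N_def by blast
    have Lfin: "finite L" using L NG assms(2) by (meson finite_subset subset_trans)
    have "L \<in> \<L>" unfolding \<L>_def
    proof (intro CollectI conjI allI impI)
      have "\<one>\<^bsub>G\<^esub> \<in> L" using normal_imp_subgroup[of L G] L subgroup.one_closed by blast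
      then show "L \<inter> H = {\<one>\<^bsub>G\<^esub>}" using L NH by auto
      fix M assume M: "M \<lhd> G" "M \<subseteq> L"
      show "M = {\<one>\<^bsub>G\<^esub>} \<or> M = L"
      proof (rule disjCI)
        assume "M \<noteq> L"
        then have "card M < card L" using M(2) Lfin psubset_card_mono by blast
        then show "M = {\<one>\<^bsub>G\<^esub>}" using least[of M] M L by (meson leD subset_trans)
      qed
    qed (use L in auto)
    then have "n L \<in> N" "n L \<in> set (map n Ls)" using dat(6) L Ls(1) by auto
    then show False using survive(2) unfolding N_def by blast
  qed
  then show ?thesis using \<sigma>(1) by blast
qed

section \<open>Reduction to that case, and the theorem\<close>

text \<open>The maximality of \<open>R\<close> ensures that \<open>G/R\<close> satisfies the additional hypothesis of the previous
  lemma: the preimage of a nontrivial normal subgroup of \<open>G/R\<close> is larger than \<open>R\<close>, so if it meets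
  \<open>H\<close> trivially, it makes some noncentral element of \<open>H\<close> central. Since \<open>R \<inter> H = 1\<close>, the group \<open>H\<close> and
  the function \<open>b\<close> can be transported to \<open>G/R\<close>; and since \<open>R\<close> makes no noncentral element of \<open>H\<close>
  central, the conclusion comes back.\<close>

lemma irreducible_rep_scalars_central:
  fixes b :: "'g \<Rightarrow> 'f::field"
  assumes "group G" "finite (carrier G)" and card: "of_nat (card (carrier G)) \<noteq> (0::'f)"
    and "subgroup H G" and b: "faithful_weight G H b"
  shows "\<exists>n (\<sigma> :: 'g \<Rightarrow> 'f mat). irreducible_rep G n \<sigma> \<and>
    (\<forall>h\<in>H. \<sigma> h \<in> scalar_mats TYPE('f) n \<longrightarrow> h \<in> group_center G)"
proof -
  interpret group G by fact
  interpret H: subgroup H G by fact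
  let ?P = "\<lambda>R. R \<lhd> G \<and> R \<inter> H = {\<one>\<^bsub>G\<^esub>} \<and> (\<forall>x\<in>H. x \<in> central_mod R \<longrightarrow> x \<in> group_center G)"
  have "{\<one>\<^bsub>G\<^esub>} \<inter> H = {\<one>\<^bsub>G\<^esub>}" by simp
  then have P1: "?P {\<one>\<^bsub>G\<^esub>}" using one_is_normal central_mod_one by simp
  have subG: "R \<subseteq> carrier G" if "R \<lhd> G" for R
    by (rule normal_imp_subgroup[OF that, THEN subgroup.subset])
  have bound: "\<forall>R. ?P R \<longrightarrow> card R < Suc (card (carrier G))"
    using card_mono[OF assms(2) subG] by (simp add: less_Suc_eq_le)
  obtain R where R: "?P R" and max: "\<And>R'. ?P R' \<Longrightarrow> card R' \<le> card R"
    using ex_has_greatest_nat[of ?P "{\<one>\<^bsub>G\<^esub>}" card "Suc (card (carrier G))", OF P1 bound] by blast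
  have RN: "R \<lhd> G" and RH: "R \<inter> H = {\<one>\<^bsub>G\<^esub>}" using R by auto
  have R_central: "x \<in> group_center G" if "x \<in> H" "x \<in> central_mod R" for x using R that by blast
  interpret R: normal R G by (rule RN)
  define Q where "Q = G Mod R"
  define \<pi> where "\<pi> = (\<lambda>g. R #>\<^bsub>G\<^esub> g)"
  interpret Q: group Q unfolding Q_def by (rule R.factorgroup_is_group)
  have "\<pi> \<in> hom G Q" unfolding Q_def \<pi>_def by (rule R.r_coset_hom_Mod)
  then interpret \<pi>: group_hom G Q \<pi> by unfold_locales
  have surj: "carrier Q = \<pi> ` carrier G" unfolding Q_def \<pi>_def FactGroup_def RCOSETS_def by auto
  have \<pi>_one: "\<pi> g = \<one>\<^bsub>Q\<^esub> \<longleftrightarrow> g \<in> R" if g: "g \<in> carrier G" for g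
  proof -
    have "\<one>\<^bsub>Q\<^esub> = R" unfolding Q_def FactGroup_def by simp
    moreover have "R #>\<^bsub>G\<^esub> g = R \<longleftrightarrow> g \<in> R"
      using coset_join1[OF _ g R.subgroup_axioms] coset_join2[OF g R.subgroup_axioms] by blast
    ultimately show ?thesis unfolding \<pi>_def by simp
  qed
  have \<pi>c: "\<pi> g \<in> carrier Q" if "g \<in> carrier G" for g using that by simp
  have finQ: "finite (carrier Q)" unfolding surj using assms(2) by simp
  have cardQ: "of_nat (card (carrier Q)) \<noteq> (0::'f)"
  proof
    assume "of_nat (card (carrier Q)) = (0::'f)"
    then have "of_nat (card (carrier Q) * card R) = (0::'f)" by simp
    moreover have "card (carrier Q) * card R = card (carrier G)"
      using lagrange[OF R.subgroup_axioms] unfolding Q_def FactGroup_def Coset.order_def by simp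
    ultimately show False using card by simp
  qed
  have HG: "h \<in> carrier G" if "h \<in> H" for h using that by simp
  have inj: "inj_on \<pi> H"
  proof (rule inj_onI)
    fix h k assume h: "h \<in> H" and k: "k \<in> H" and eq: "\<pi> h = \<pi> k"
    have "\<pi> (h \<otimes>\<^bsub>G\<^esub> inv\<^bsub>G\<^esub> k) = \<one>\<^bsub>Q\<^esub>" using eq HG[OF h] HG[OF k] \<pi>c[OF HG[OF k]] by simp
    then have "h \<otimes>\<^bsub>G\<^esub> inv\<^bsub>G\<^esub> k \<in> R \<inter> H" using \<pi>_one[of "h \<otimes>\<^bsub>G\<^esub> inv\<^bsub>G\<^esub> k"] h k by simp
    then have "h \<otimes>\<^bsub>G\<^esub> inv\<^bsub>G\<^esub> k = \<one>\<^bsub>G\<^esub>" unfolding RH by simp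
    then show "h = k" using inv_solve_right'[of "\<one>\<^bsub>G\<^esub>" h k] HG[OF h] HG[OF k] by simp
  qed
  \<comment> \<open>On the image of \<open>H\<close>, which is isomorphic to \<open>H\<close>, this is \<open>b\<close>.\<close>
  define b' where "b' X = (if X \<in> \<pi> ` H then b (inv_into H \<pi> X) else 0)" for X
  have b'\<pi>: "b' (\<pi> h) = b h" if "h \<in> H" for h
    unfolding b'_def using inv_into_f_f[OF inj that] that by simp
  have H': "subgroup (\<pi> ` H) Q" by (rule \<pi>.subgroup_img_is_subgroup[OF assms(4)])
  have b': "faithful_weight Q (\<pi> ` H) b'"
    unfolding faithful_weight_def
  proof (intro conjI allI impI ballI)
    show "b' \<one>\<^bsub>Q\<^esub> = 1" using b'\<pi>[OF H.one_closed] b unfolding faithful_weight_def by simp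
    show "b' X = 0" if "X \<notin> \<pi> ` H" for X using that unfolding b'_def by simp
    fix K' X assume K': "subgroup K' Q" "K' \<subseteq> \<pi> ` H" "\<forall>h\<in>\<pi> ` H. \<forall>k\<in>K'. h \<otimes>\<^bsub>Q\<^esub> k \<otimes>\<^bsub>Q\<^esub> inv\<^bsub>Q\<^esub> h \<in> K'" "K' \<noteq> {\<one>\<^bsub>Q\<^esub>}"
      and X: "X \<in> \<pi> ` H"
    interpret K': subgroup K' Q by (rule K'(1))
    define K where "K = {h \<in> H. \<pi> h \<in> K'}"
    have KH: "K \<subseteq> H" unfolding K_def by blast
    have img: "\<pi> ` K = K'" unfolding K_def using K'(2) by blast
    have K: "subgroup K G"
    proof (rule subgroupI)
      show "K \<subseteq> carrier G" using KH HG by blast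
      show "K \<noteq> {}" using img K'.one_closed by blast
      show "inv\<^bsub>G\<^esub> k \<in> K" if "k \<in> K" for k using that HG unfolding K_def by simp
      show "k \<otimes>\<^bsub>G\<^esub> l \<in> K" if "k \<in> K" "l \<in> K" for k l using that HG unfolding K_def by simp
    qed
    have Kn: "\<forall>h\<in>H. \<forall>k\<in>K. h \<otimes>\<^bsub>G\<^esub> k \<otimes>\<^bsub>G\<^esub> inv\<^bsub>G\<^esub> h \<in> K"
    proof (intro ballI)
      fix h k assume h: "h \<in> H" and k: "k \<in> K"
      then have kH: "k \<in> H" "\<pi> k \<in> K'" unfolding K_def by auto
      have "\<pi> (h \<otimes>\<^bsub>G\<^esub> k \<otimes>\<^bsub>G\<^esub> inv\<^bsub>G\<^esub> h) = \<pi> h \<otimes>\<^bsub>Q\<^esub> \<pi> k \<otimes>\<^bsub>Q\<^esub> inv\<^bsub>Q\<^esub> (\<pi> h)"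
        using HG[OF h] HG[OF kH(1)] by simp
      then have "\<pi> (h \<otimes>\<^bsub>G\<^esub> k \<otimes>\<^bsub>G\<^esub> inv\<^bsub>G\<^esub> h) \<in> K'" using K'(3) h kH(2) by simp
      then show "h \<otimes>\<^bsub>G\<^esub> k \<otimes>\<^bsub>G\<^esub> inv\<^bsub>G\<^esub> h \<in> K" unfolding K_def using h kH(1) by simp
    qed
    have "K \<noteq> {\<one>\<^bsub>G\<^esub>}" using img K'(4) by auto
    then have sum0: "(\<Sum>k\<in>K. b (x \<otimes>\<^bsub>G\<^esub> k)) = 0" if "x \<in> H" for x
      using b K KH Kn that unfolding faithful_weight_def by blast
    obtain x where x: "x \<in> H" "X = \<pi> x" using X by blast
    have "bij_betw \<pi> K K'" unfolding bij_betw_def using inj_on_subset[OF inj KH] img by simp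
    then have "(\<Sum>k\<in>K'. b' (X \<otimes>\<^bsub>Q\<^esub> k)) = (\<Sum>k\<in>K. b' (X \<otimes>\<^bsub>Q\<^esub> \<pi> k))" by (rule sum.reindex_bij_betw[symmetric])
    also have "\<dots> = (\<Sum>k\<in>K. b (x \<otimes>\<^bsub>G\<^esub> k))"
    proof (rule sum.cong[OF refl])
      fix k assume "k \<in> K"
      then have k: "k \<in> H" using KH by blast
      have "X \<otimes>\<^bsub>Q\<^esub> \<pi> k = \<pi> (x \<otimes>\<^bsub>G\<^esub> k)" unfolding x(2) using HG[OF x(1)] HG[OF k] by simp
      then show "b' (X \<otimes>\<^bsub>Q\<^esub> \<pi> k) = b (x \<otimes>\<^bsub>G\<^esub> k)" using b'\<pi>[of "x \<otimes>\<^bsub>G\<^esub> k"] x(1) k by simp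
    qed
    also have "\<dots> = 0" by (rule sum0[OF x(1)])
    finally show "(\<Sum>k\<in>K'. b' (X \<otimes>\<^bsub>Q\<^esub> k)) = 0" .
  qed
  have \<pi>comm: "\<pi> (x \<otimes>\<^bsub>G\<^esub> g \<otimes>\<^bsub>G\<^esub> inv\<^bsub>G\<^esub> x \<otimes>\<^bsub>G\<^esub> inv\<^bsub>G\<^esub> g) = \<pi> x \<otimes>\<^bsub>Q\<^esub> \<pi> g \<otimes>\<^bsub>Q\<^esub> inv\<^bsub>Q\<^esub> (\<pi> x) \<otimes>\<^bsub>Q\<^esub> inv\<^bsub>Q\<^esub> (\<pi> g)"
    if "x \<in> carrier G" "g \<in> carrier G" for x g
    using that by simp
  have center: "x \<in> group_center G" if x: "x \<in> H" and c: "\<pi> x \<in> group_center Q" for x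
  proof (rule R_central[OF x])
    have "x \<otimes>\<^bsub>G\<^esub> g \<otimes>\<^bsub>G\<^esub> inv\<^bsub>G\<^esub> x \<otimes>\<^bsub>G\<^esub> inv\<^bsub>G\<^esub> g \<in> R" if g: "g \<in> carrier G" for g
    proof -
      have "\<pi> x \<otimes>\<^bsub>Q\<^esub> \<pi> g = \<pi> g \<otimes>\<^bsub>Q\<^esub> \<pi> x" using c \<pi>c[OF g] unfolding group_center_def by blast
      then have "\<pi> (x \<otimes>\<^bsub>G\<^esub> g \<otimes>\<^bsub>G\<^esub> inv\<^bsub>G\<^esub> x \<otimes>\<^bsub>G\<^esub> inv\<^bsub>G\<^esub> g) = \<one>\<^bsub>Q\<^esub>"
        unfolding \<pi>comm[OF HG[OF x] g] using Q.commute_iff_commutator_one[OF \<pi>c[OF HG[OF x]] \<pi>c[OF g]] by simp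
      then show ?thesis using \<pi>_one[of "x \<otimes>\<^bsub>G\<^esub> g \<otimes>\<^bsub>G\<^esub> inv\<^bsub>G\<^esub> x \<otimes>\<^bsub>G\<^esub> inv\<^bsub>G\<^esub> g"] HG[OF x] g by simp
    qed
    then show "x \<in> central_mod R" unfolding central_mod_def using HG[OF x] by simp
  qed
  have star: "\<exists>y\<in>\<pi> ` H. y \<notin> group_center Q \<and> y \<in> Q.central_mod L'"
    if L': "L' \<lhd> Q" "L' \<noteq> {\<one>\<^bsub>Q\<^esub>}" "L' \<inter> \<pi> ` H = {\<one>\<^bsub>Q\<^esub>}" for L'
  proof -
    interpret L': normal L' Q by (rule L'(1))
    define L where "L = {g \<in> carrier G. \<pi> g \<in> L'}"
    have "subgroup L G"
    proof (rule subgroupI)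
      show "L \<subseteq> carrier G" unfolding L_def by blast
      have "\<one>\<^bsub>G\<^esub> \<in> L" unfolding L_def by simp
      then show "L \<noteq> {}" by blast
      show "inv\<^bsub>G\<^esub> k \<in> L" if "k \<in> L" for k using that unfolding L_def by simp
      show "k \<otimes>\<^bsub>G\<^esub> l \<in> L" if "k \<in> L" "l \<in> L" for k l using that unfolding L_def by simp
    qed
    moreover have "g \<otimes>\<^bsub>G\<^esub> l \<otimes>\<^bsub>G\<^esub> inv\<^bsub>G\<^esub> g \<in> L" if "g \<in> carrier G" "l \<in> L" for g l
      using that L'.inv_op_closed2[of "\<pi> g" "\<pi> l"] unfolding L_def by simp
    ultimately have LN: "L \<lhd> G" unfolding normal_inv_iff by blast
    have "l \<in> L" if "l \<in> R" for l
    proof -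
      have lG: "l \<in> carrier G" using that by simp
      have "\<pi> l = \<one>\<^bsub>Q\<^esub>" using \<pi>_one[OF lG] that by simp
      then show ?thesis unfolding L_def using lG by simp
    qed
    moreover obtain X where X: "X \<in> L'" "X \<noteq> \<one>\<^bsub>Q\<^esub>" using L'(2) L'.one_closed by blast
    obtain g where g: "g \<in> carrier G" "X = \<pi> g" using X(1) surj L'.subset by blast
    have "g \<in> L" "g \<notin> R" using X g \<pi>_one unfolding L_def by auto
    ultimately have "R \<subset> L" by blast
    then have "card R < card L" using finite_subset[OF subG[OF LN] assms(2)] psubset_card_mono by blast
    then have "\<not> ?P L" using max[of L] by linarith
    moreover have "L \<inter> H = {\<one>\<^bsub>G\<^esub>}"
    proof
      show "{\<one>\<^bsub>G\<^esub>} \<subseteq> L \<inter> H" unfolding L_def by simp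
      show "L \<inter> H \<subseteq> {\<one>\<^bsub>G\<^esub>}"
      proof
        fix h assume h: "h \<in> L \<inter> H"
        then have "\<pi> h \<in> L' \<inter> \<pi> ` H" unfolding L_def by blast
        then have "\<pi> h = \<one>\<^bsub>Q\<^esub>" unfolding L'(3) by simp
        then have "h \<in> R \<inter> H" using \<pi>_one h HG by blast
        then show "h \<in> {\<one>\<^bsub>G\<^esub>}" unfolding RH .
      qed
    qed
    ultimately obtain x where x: "x \<in> H" "x \<in> central_mod L" "x \<notin> group_center G" using LN by blast
    have "\<pi> x \<otimes>\<^bsub>Q\<^esub> X \<otimes>\<^bsub>Q\<^esub> inv\<^bsub>Q\<^esub> (\<pi> x) \<otimes>\<^bsub>Q\<^esub> inv\<^bsub>Q\<^esub> X \<in> L'" if XQ: "X \<in> carrier Q" for X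
    proof -
      obtain g where g: "g \<in> carrier G" "X = \<pi> g" using XQ surj by blast
      have "x \<otimes>\<^bsub>G\<^esub> g \<otimes>\<^bsub>G\<^esub> inv\<^bsub>G\<^esub> x \<otimes>\<^bsub>G\<^esub> inv\<^bsub>G\<^esub> g \<in> L" using x(2) g(1) unfolding central_mod_def by blast
      then show ?thesis unfolding g(2) \<pi>comm[OF HG[OF x(1)] g(1), symmetric] L_def by blast
    qed
    then have "\<pi> x \<in> Q.central_mod L'" unfolding Q.central_mod_def using \<pi>c[OF HG[OF x(1)]] by simp
    then show ?thesis using center[OF x(1)] x by blast
  qed
  have "\<exists>n (\<sigma> :: 'g set \<Rightarrow> 'f mat). irreducible_rep Q n \<sigma> \<and>
    (\<forall>h\<in>\<pi> ` H. \<sigma> h \<in> scalar_mats TYPE('f) n \<longrightarrow> h \<in> group_center Q)"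
    by (rule irreducible_rep_scalars_central_reduced[OF Q.is_group finQ cardQ H' b' star])
  then obtain n and \<sigma> :: "'g set \<Rightarrow> 'f mat" where \<sigma>: "irreducible_rep Q n \<sigma>"
    and \<sigma>Z: "\<And>h. h \<in> \<pi> ` H \<Longrightarrow> \<sigma> h \<in> scalar_mats TYPE('f) n \<Longrightarrow> h \<in> group_center Q" by blast
  have "\<sigma> \<in> hom Q (GL TYPE('f) n)" using \<sigma> unfolding irreducible_rep_def linear_rep_def by simp
  then have "\<sigma> \<circ> \<pi> \<in> hom G (GL TYPE('f) n)" by (rule Group.hom_compose[OF \<pi>.homh])
  moreover have "(\<sigma> \<circ> \<pi>) ` carrier G = \<sigma> ` carrier Q" unfolding surj image_comp ..
  ultimately have "irreducible_rep G n (\<sigma> \<circ> \<pi>)"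
    using \<sigma> unfolding irreducible_rep_def linear_rep_def by simp
  moreover have "h \<in> group_center G" if "h \<in> H" "(\<sigma> \<circ> \<pi>) h \<in> scalar_mats TYPE('f) n" for h
    using center[OF that(1)] \<sigma>Z[of "\<pi> h"] that by simp
  ultimately show ?thesis by blast
qed

theorem corollary1p6:
  fixes G :: "('g, 'b) monoid_scheme" (structure) and H :: "'g set"
  assumes "group G" and "finite (carrier G)" and "subgroup H G"
    and "\<not> CHAR('f::field) dvd card (carrier G)"
    and "\<exists>m (\<rho> :: 'g \<Rightarrow> 'f mat). irreducible_rep (G\<lparr>carrier := H\<rparr>) m \<rho>
           \<and> faithful_rep (G\<lparr>carrier := H\<rparr>) m \<rho>"
  shows "\<exists>n (\<sigma> :: 'g \<Rightarrow> 'f mat set).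
           irreducible_proj_rep G n \<sigma> \<and> one_proj_rep G n \<sigma>
         \<and> kernel G (PGL TYPE('f) n) \<sigma> \<inter> H \<subseteq> group_center G
         \<and> (group_center G \<inter> H = {\<one>} \<longrightarrow> inj_on \<sigma> H)"
proof -
  interpret group G by fact
  interpret H: subgroup H G by fact
  have card: "of_nat (card (carrier G)) \<noteq> (0::'f)"
    using assms(4) by (simp add: of_nat_eq_0_iff_char_dvd)
  obtain m and \<rho>\<^sub>H :: "'g \<Rightarrow> 'f mat" where \<rho>\<^sub>H: "irreducible_rep (G\<lparr>carrier := H\<rparr>) m \<rho>\<^sub>H"
    "faithful_rep (G\<lparr>carrier := H\<rparr>) m \<rho>\<^sub>H" using assms(5) by blast
  have "\<exists>n (\<rho> :: 'g \<Rightarrow> 'f mat). irreducible_rep G n \<rho> \<and>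
    (\<forall>h\<in>H. \<rho> h \<in> scalar_mats TYPE('f) n \<longrightarrow> h \<in> group_center G)"
    by (rule irreducible_rep_scalars_central[OF assms(1,2) card assms(3)
          faithful_weight_matrix_coefficient[OF assms(1,2,3) \<rho>\<^sub>H]])
  then obtain n and \<rho> :: "'g \<Rightarrow> 'f mat" where irr: "irreducible_rep G n \<rho>"
    and scalar: "\<And>h. h \<in> H \<Longrightarrow> \<rho> h \<in> scalar_mats TYPE('f) n \<Longrightarrow> h \<in> group_center G" by blast
  have lin: "linear_rep G n \<rho>" using irr unfolding irreducible_rep_def by simp
  let ?GL = "GL TYPE('f) n" and ?S = "scalar_mats TYPE('f) n"
  interpret S: normal ?S ?GL by (rule scalar_mats_normal)
  interpret PGL: group "PGL TYPE('f) n" unfolding PGL_def by (rule S.factorgroup_is_group)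
  define \<sigma> where "\<sigma> = (\<lambda>A. ?S #>\<^bsub>?GL\<^esub> A) \<circ> \<rho>"
  have \<sigma>hom: "\<sigma> \<in> hom G (PGL TYPE('f) n)"
    unfolding \<sigma>_def PGL_def by (rule Group.hom_compose[OF lin[unfolded linear_rep_def] S.r_coset_hom_Mod])
  interpret \<sigma>: group_hom G "PGL TYPE('f) n" \<sigma> using \<sigma>hom by unfold_locales
  have \<rho>GL: "\<rho> g \<in> carrier ?GL" if "g \<in> carrier G" for g
    using lin that unfolding linear_rep_def hom_def by blast
  have mem: "\<rho> g \<in> \<sigma> g" if "g \<in> carrier G" for g
    unfolding \<sigma>_def comp_def using S.rcos_self[OF \<rho>GL[OF that] S.subgroup_axioms] .
  have "irreducible_mats n (\<Union>g\<in>carrier G. \<sigma> g)"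
  proof -
    have "\<rho> ` carrier G \<subseteq> (\<Union>g\<in>carrier G. \<sigma> g)" using mem by blast
    then show ?thesis using irr unfolding irreducible_rep_def irreducible_mats_def by (meson subsetD)
  qed
  then have "irreducible_proj_rep G n \<sigma>" unfolding irreducible_proj_rep_def proj_rep_def using \<sigma>hom by simp
  moreover have "one_proj_rep G n \<sigma>"
    unfolding one_proj_rep_def proj_rep_def using \<sigma>hom lin by (auto simp: \<sigma>_def)
  moreover have ker: "kernel G (PGL TYPE('f) n) \<sigma> \<inter> H \<subseteq> group_center G"
  proof
    fix h assume h: "h \<in> kernel G (PGL TYPE('f) n) \<sigma> \<inter> H"
    then have hG: "h \<in> carrier G" and "\<sigma> h = \<one>\<^bsub>PGL TYPE('f) n\<^esub>" unfolding kernel_def by auto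
    then have "\<sigma> h = ?S" unfolding PGL_def FactGroup_def by simp
    then have "\<rho> h \<in> ?S" using mem[OF hG] by simp
    then show "h \<in> group_center G" using scalar h by blast
  qed
  moreover have "inj_on \<sigma> H" if trivial: "group_center G \<inter> H = {\<one>}"
  proof (rule inj_onI)
    fix h k assume h: "h \<in> H" and k: "k \<in> H" and eq: "\<sigma> h = \<sigma> k"
    have hG: "h \<in> carrier G" and kG: "k \<in> carrier G" using h k by auto
    have "\<sigma> (h \<otimes> inv k) = \<one>\<^bsub>PGL TYPE('f) n\<^esub>" using eq hG kG \<sigma>.hom_closed[OF kG] by simp
    then have "h \<otimes> inv k \<in> kernel G (PGL TYPE('f) n) \<sigma> \<inter> H" using h k unfolding kernel_def by simp
    then have "h \<otimes> inv k = \<one>" using ker trivial h k by blast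
    then show "h = k" using inv_solve_right'[of \<one> h k] hG kG by simp
  qed
  ultimately show ?thesis by blast
qed

end
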